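(* Let $k\in\mathbb{N}\cup\{\infty\}$. Then the classical ring of quotients $Q_{\mathrm{cl}}(C^{k}(\mathbb{R}))$, the complete ring of quotients $Q(C^{k}(\mathbb{R}))$, and the maximal flat epimorphic extension $Q_{\mathrm{tot}}(C^{k}(\mathbb{R}))$ of $C^{k}(\mathbb{R})$ coincide, and this ring is a self-injective (von Neumann) regular ring.
   Context: Here $\mathbb{N}=\{1,2,3,\dots\}$. For $k\in\mathbb{N}$, $C^{k}(\mathbb{R})$ is the ring of functions $\mathbb{R}\to\mathbb{R}$ with continuous derivatives up to and including the $k$-th, and $C^{\infty}(\mathbb{R})=\bigcap_{k\in\mathbb{N}}C^{k}(\mathbb{R})$. Let $R$ be a commutative ring with $1$. - $Q_{\mathrm{cl}}(R)$ is the localization of $R$ at the set of all its non-zero divisors. - An ideal $D$ of $R$ is dense if its annihilator is $0$. The complete ring of quotients is $Q(R)=\varinjlim \operatorname{Hom}_R(D,R)$, the direct limit over the dense ideals $D$ of $R$ (ordered by reverse inclusion, with transition maps given by restriction); $R$ embeds in $Q(R)$ by multiplications, and there is a canonical embedding $Q_{\mathrm{cl}}(R)\subseteq Q(R)$ over $R$. - $Q_{\mathrm{tot}}(R)$ is the maximal flat epimorphic ring of quotients: the map $R\to Q_{\mathrm{tot}}(R)$ is an injective ring homomorphism which is an epimorphism in the category of rings with $1$ and makes $Q_{\mathrm{tot}}(R)$ a flat $R$-module, and every injective flat ring epimorphism $R\to S$ admits a unique ring homomorphism $S\to Q_{\mathrm{tot}}(R)$ over $R$, which is injective. "Coincide"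 means that the three rings are equal as extensions of $R$, i.e. isomorphic via the canonical maps over $R$. *)

theory Defs
  imports "HOL-Analysis.Analysis" "HOL-Algebra.Free_Abelian_Groups" "HOL-Algebra.Weak_Morphisms"
    "HOL-Algebra.Generated_Rings"
begin

section \<open>The rings of continuously differentiable functions\<close>

definition C_fin :: "nat \<Rightarrow> (real \<Rightarrow> real) set" where
  "C_fin n = {f. (\<forall>j<n. \<forall>x. ((deriv ^^ j) f) differentiable (at x)) \<and>
                 (\<forall>j\<le>n. continuous_on UNIV ((deriv ^^ j) f))}"

definition C_class :: "enat \<Rightarrow> (real \<Rightarrow> real) set" where
  "C_class k = (case k of enat n \<Rightarrow> C_fin n | \<infinity> \<Rightarrow> (\<Inter>n\<in>{1..}. C_fin n))"

definition C_ring :: "enat \<Rightarrow> (real \<Rightarrow> real) ring" where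
  "C_ring k = \<lparr>carrier = C_class k, mult = (\<lambda>f g x. f x * g x), one = (\<lambda>x. 1),
               ring.zero = (\<lambda>x. 0), add = (\<lambda>f g x. f x + g x)\<rparr>"


section \<open>Modules\<close>

text \<open>Linear maps are extensional, i.e. they take a fixed junk value outside the carrier, so
  that two of them are equal iff they agree on the carrier.\<close>

definition module_hom ::
  "('a, 'r) ring_scheme \<Rightarrow> ('a, 'b, 'm) module_scheme \<Rightarrow> ('a, 'c, 'n) module_scheme \<Rightarrow> ('b \<Rightarrow> 'c) set"
  where
  "module_hom R M N = {f \<in> carrier M \<rightarrow>\<^sub>E carrier N.
     (\<forall>x\<in>carrier M. \<forall>y\<in>carrier M. f (x \<oplus>\<^bsub>M\<^esub> y) = f x \<oplus>\<^bsub>N\<^esub> f y) \<and>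
     (\<forall>r\<in>carrier R. \<forall>x\<in>carrier M. f (r \<odot>\<^bsub>M\<^esub> x) = r \<odot>\<^bsub>N\<^esub> f x)}"

text \<open>An ideal \<open>D\<close> of \<open>R\<close> as an \<open>R\<close>-module. The fields for the multiplication and the unit of
  a module record play no role.\<close>

definition ideal_module :: "('a, 'r) ring_scheme \<Rightarrow> 'a set \<Rightarrow> ('a, 'a) module" where
  "ideal_module R D = \<lparr>carrier = D, mult = mult R, one = one R, ring.zero = ring.zero R, add = add R,
                       smult = mult R\<rparr>"

abbreviation regular_module :: "('a, 'r) ring_scheme \<Rightarrow> ('a, 'a) module" where
  "regular_module R \<equiv> ideal_module R (carrier R)"

definition restrict_scalars :: "('a \<Rightarrow> 's) \<Rightarrow> ('s, 'r) ring_scheme \<Rightarrow> ('a, 's) module" where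
  "restrict_scalars \<phi> S = \<lparr>carrier = carrier S, mult = mult S, one = one S, ring.zero = ring.zero S,
                           add = add S, smult = (\<lambda>r s. \<phi> r \<otimes>\<^bsub>S\<^esub> s)\<rparr>"


section \<open>The classical ring of quotients\<close>

definition non_zero_divisors :: "('a, 'r) ring_scheme \<Rightarrow> 'a set" where
  "non_zero_divisors R = {s \<in> carrier R. \<forall>x\<in>carrier R. s \<otimes>\<^bsub>R\<^esub> x = \<zero>\<^bsub>R\<^esub> \<longrightarrow> x = \<zero>\<^bsub>R\<^esub>}"

definition frac_rel :: "('a, 'r) ring_scheme \<Rightarrow> 'a set \<Rightarrow> (('a \<times> 'a) \<times> ('a \<times> 'a)) set" where
  "frac_rel R S = {((a, s), (b, t)) | a s b t. a \<in> carrier R \<and> b \<in> carrier R \<and> s \<in> S \<and> t \<in> S \<and>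
     (\<exists>u\<in>S. u \<otimes>\<^bsub>R\<^esub> (a \<otimes>\<^bsub>R\<^esub> t) = u \<otimes>\<^bsub>R\<^esub> (b \<otimes>\<^bsub>R\<^esub> s))}"

definition localization :: "('a, 'r) ring_scheme \<Rightarrow> 'a set \<Rightarrow> ('a \<times> 'a) set ring" where
  "localization R S =
    \<lparr>carrier = (carrier R \<times> S) // frac_rel R S,
     mult = (\<lambda>X Y. \<Union>(a, s)\<in>X. \<Union>(b, t)\<in>Y. frac_rel R S `` {(a \<otimes>\<^bsub>R\<^esub> b, s \<otimes>\<^bsub>R\<^esub> t)}),
     one = frac_rel R S `` {(\<one>\<^bsub>R\<^esub>, \<one>\<^bsub>R\<^esub>)},
     ring.zero = frac_rel R S `` {(\<zero>\<^bsub>R\<^esub>, \<one>\<^bsub>R\<^esub>)},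
     add = (\<lambda>X Y. \<Union>(a, s)\<in>X. \<Union>(b, t)\<in>Y.
              frac_rel R S `` {(a \<otimes>\<^bsub>R\<^esub> t \<oplus>\<^bsub>R\<^esub> b \<otimes>\<^bsub>R\<^esub> s, s \<otimes>\<^bsub>R\<^esub> t)})\<rparr>"

definition Q_cl :: "('a, 'r) ring_scheme \<Rightarrow> ('a \<times> 'a) set ring" where
  "Q_cl R = localization R (non_zero_divisors R)"

definition Q_cl_map :: "('a, 'r) ring_scheme \<Rightarrow> 'a \<Rightarrow> ('a \<times> 'a) set" where
  "Q_cl_map R a = frac_rel R (non_zero_divisors R) `` {(a, \<one>\<^bsub>R\<^esub>)}"


section \<open>The complete ring of quotients\<close>

definition annihilator :: "('a, 'r) ring_scheme \<Rightarrow> 'a set \<Rightarrow> 'a set" where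
  "annihilator R D = {r \<in> carrier R. \<forall>d\<in>D. r \<otimes>\<^bsub>R\<^esub> d = \<zero>\<^bsub>R\<^esub>}"

definition dense_ideal :: "('a, 'r) ring_scheme \<Rightarrow> 'a set \<Rightarrow> bool" where
  "dense_ideal R D \<longleftrightarrow> ideal D R \<and> annihilator R D = {\<zero>\<^bsub>R\<^esub>}"

text \<open>The direct limit is the disjoint union of the \<open>Hom\<^sub>R(D, R)\<close>, where two maps are identified
  iff they have the same restriction to some dense ideal inside both domains.\<close>

definition partial_homs :: "('a, 'r) ring_scheme \<Rightarrow> ('a set \<times> ('a \<Rightarrow> 'a)) set" where
  "partial_homs R = (SIGMA D:{D. dense_ideal R D}. module_hom R (ideal_module R D) (regular_module R))"

definition germ_rel ::
  "('a, 'r) ring_scheme \<Rightarrow> (('a set \<times> ('a \<Rightarrow> 'a)) \<times> ('a set \<times> ('a \<Rightarrow> 'a))) set" where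
  "germ_rel R = {((D, f), (E, g)) | D f E g. (D, f) \<in> partial_homs R \<and> (E, g) \<in> partial_homs R \<and>
     (\<exists>F. dense_ideal R F \<and> F \<subseteq> D \<inter> E \<and> (\<forall>x\<in>F. f x = g x))}"

text \<open>Addition is pointwise on the intersection of the domains; multiplication is composition
  \<open>f \<circ> g\<close> on the preimage under \<open>g\<close> of the domain of \<open>f\<close>.\<close>

definition Q_complete :: "('a, 'r) ring_scheme \<Rightarrow> ('a set \<times> ('a \<Rightarrow> 'a)) set ring" where
  "Q_complete R =
    \<lparr>carrier = partial_homs R // germ_rel R,
     mult = (\<lambda>X Y. \<Union>(D, f)\<in>X. \<Union>(E, g)\<in>Y.
       germ_rel R `` {({x \<in> E. g x \<in> D}, \<lambda>x\<in>{x \<in> E. g x \<in> D}. f (g x))}),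
     one = germ_rel R `` {(carrier R, \<lambda>x\<in>carrier R. x)},
     ring.zero = germ_rel R `` {(carrier R, \<lambda>x\<in>carrier R. \<zero>\<^bsub>R\<^esub>)},
     add = (\<lambda>X Y. \<Union>(D, f)\<in>X. \<Union>(E, g)\<in>Y.
       germ_rel R `` {(D \<inter> E, \<lambda>x\<in>D \<inter> E. f x \<oplus>\<^bsub>R\<^esub> g x)})\<rparr>"

definition Q_complete_map :: "('a, 'r) ring_scheme \<Rightarrow> 'a \<Rightarrow> ('a set \<times> ('a \<Rightarrow> 'a)) set" where
  "Q_complete_map R a = germ_rel R `` {(carrier R, \<lambda>x\<in>carrier R. a \<otimes>\<^bsub>R\<^esub> x)}"


section \<open>Flatness\<close>

text \<open>The tensor product of two \<open>R\<close>-modules as an abelian group: the free abelian group on the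
  pairs modulo the subgroup generated by the bilinearity relations.\<close>

definition tensor_relations ::
  "('a, 'r) ring_scheme \<Rightarrow> ('a, 'b, 'm) module_scheme \<Rightarrow> ('a, 'c, 'n) module_scheme \<Rightarrow>
   (('b \<times> 'c) \<Rightarrow>\<^sub>0 int) set" where
  "tensor_relations R M P =
     {frag_of (x \<oplus>\<^bsub>M\<^esub> y, p) - frag_of (x, p) - frag_of (y, p) | x y p.
        x \<in> carrier M \<and> y \<in> carrier M \<and> p \<in> carrier P} \<union>
     {frag_of (x, p \<oplus>\<^bsub>P\<^esub> q) - frag_of (x, p) - frag_of (x, q) | x p q.
        x \<in> carrier M \<and> p \<in> carrier P \<and> q \<in> carrier P} \<union>
     {frag_of (r \<odot>\<^bsub>M\<^esub> x, p) - frag_of (x, r \<odot>\<^bsub>P\<^esub> p) | r x p.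
        r \<in> carrier R \<and> x \<in> carrier M \<and> p \<in> carrier P}"

definition tensor_subgroup ::
  "('a, 'r) ring_scheme \<Rightarrow> ('a, 'b, 'm) module_scheme \<Rightarrow> ('a, 'c, 'n) module_scheme \<Rightarrow>
   (('b \<times> 'c) \<Rightarrow>\<^sub>0 int) set" where
  "tensor_subgroup R M P =
     generate (free_Abelian_group (carrier M \<times> carrier P)) (tensor_relations R M P)"

definition tensor_product ::
  "('a, 'r) ring_scheme \<Rightarrow> ('a, 'b, 'm) module_scheme \<Rightarrow> ('a, 'c, 'n) module_scheme \<Rightarrow>
   (('b \<times> 'c) \<Rightarrow>\<^sub>0 int) set monoid" where
  "tensor_product R M P =
     free_Abelian_group (carrier M \<times> carrier P) Mod tensor_subgroup R M P"

text \<open>The homomorphism \<open>M \<otimes> P \<rightarrow> N \<otimes> P\<close>, \<open>x \<otimes> p \<mapsto> u x \<otimes> p\<close>, induced by \<open>u : M \<rightarrow> N\<close>.\<close>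

definition tensor_map ::
  "('a, 'r) ring_scheme \<Rightarrow> ('a, 'd, 'k) module_scheme \<Rightarrow> ('a, 'c, 'n) module_scheme \<Rightarrow>
   ('b \<Rightarrow> 'd) \<Rightarrow> (('b \<times> 'c) \<Rightarrow>\<^sub>0 int) set \<Rightarrow> (('d \<times> 'c) \<Rightarrow>\<^sub>0 int) set" where
  "tensor_map R N P u X = (\<Union>z\<in>X. tensor_subgroup R N P
     #>\<^bsub>free_Abelian_group (carrier N \<times> carrier P)\<^esub> frag_extend (\<lambda>(x, p). frag_of (u x, p)) z)"

text \<open>Tensoring with \<open>P\<close> preserves injectivity of linear maps. HOL cannot quantify over all types
  inside a definition, so the type of the elements of the test modules is a parameter. A positive
  occurrence should let it be an arbitrary type variable. In a hypothesis the element type of \<open>R\<close>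
  is enough: then all inclusions of ideals are among the test maps, and these already decide
  flatness.\<close>

definition flat_module ::
  "'m itself \<Rightarrow> ('a, 'r) ring_scheme \<Rightarrow> ('a, 'p, 'q) module_scheme \<Rightarrow> bool" where
  "flat_module _ R P \<longleftrightarrow> Module.module R P \<and>
     (\<forall>(M :: ('a, 'm) module) (N :: ('a, 'm) module). \<forall>u\<in>module_hom R M N.
        Module.module R M \<longrightarrow> Module.module R N \<longrightarrow> inj_on u (carrier M) \<longrightarrow>
        inj_on (tensor_map R N P u) (carrier (tensor_product R M P)))"


section \<open>Epimorphisms of rings\<close>

text \<open>To test whether \<open>\<phi> : R \<rightarrow> S\<close> is an epimorphism, one may replace the common target of two
  homomorphisms by the subring generated by their images. That subring is in bijection with a set
  of ring terms over two copies of \<open>S\<close>, so a single target type suffices. Lemma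
  \<open>ring_epi_cancel\<close> below confirms this.\<close>

datatype 'x ring_term =
    Gen 'x
  | One
  | Neg "'x ring_term"
  | Add "'x ring_term" "'x ring_term"
  | Mul "'x ring_term" "'x ring_term"

definition ring_epi ::
  "('a, 'r) ring_scheme \<Rightarrow> 's ring \<Rightarrow> ('a \<Rightarrow> 's) \<Rightarrow> bool" where
  "ring_epi R S \<phi> \<longleftrightarrow> \<phi> \<in> ring_hom R S \<and>
     (\<forall>T :: ('s + 's) ring_term ring. ring T \<longrightarrow>
        (\<forall>g\<in>ring_hom S T. \<forall>h\<in>ring_hom S T.
           (\<forall>r\<in>carrier R. g (\<phi> r) = h (\<phi> r)) \<longrightarrow> (\<forall>s\<in>carrier S. g s = h s)))"

primrec term_val :: "('t, 'z) ring_scheme \<Rightarrow> ('x \<Rightarrow> 't) \<Rightarrow> 'x ring_term \<Rightarrow> 't" where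
  "term_val T v (Gen x) = v x"
| "term_val T v One = \<one>\<^bsub>T\<^esub>"
| "term_val T v (Neg a) = \<ominus>\<^bsub>T\<^esub> term_val T v a"
| "term_val T v (Add a b) = term_val T v a \<oplus>\<^bsub>T\<^esub> term_val T v b"
| "term_val T v (Mul a b) = term_val T v a \<otimes>\<^bsub>T\<^esub> term_val T v b"

lemma ring_epi_cancel:
  fixes T :: "('t, 'z) ring_scheme"
  assumes epi: "ring_epi R S \<phi>" and T: "ring T"
    and g: "g \<in> ring_hom S T" and h: "h \<in> ring_hom S T"
    and eq: "\<And>r. r \<in> carrier R \<Longrightarrow> g (\<phi> r) = h (\<phi> r)" and s: "s \<in> carrier S"
  shows "g s = h s"
proof -
  interpret T: ring T by (rule T)
  define H where "H = g ` carrier S \<union> h ` carrier S"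
  define P where "P = generate_ring T H"
  have H: "H \<subseteq> carrier T"
    using g h by (auto simp: H_def ring_hom_def)
  have P: "subring P T"
    unfolding P_def by (rule T.generate_ring_is_subring[OF H])
  define T' where "T' = T\<lparr>carrier := P\<rparr>"
  have T': "ring T'"
    unfolding T'_def by (rule T.subring_is_ring[OF P])
  have HP: "H \<subseteq> P"
    unfolding P_def by (auto intro: generate_ring.incl)
  have repr: "\<exists>w. term_val T (case_sum g h) w = t" if "t \<in> P" for t
    using that unfolding P_def
  proof (induction rule: generate_ring.induct)
    case one
    show ?case by (rule exI[of _ One]) simp
  next
    case (incl x)
    then consider a where "x = g a" | a where "x = h a"
      by (auto simp: H_def)
    then show ?case
    proof cases
      case 1 then show ?thesis by (intro exI[of _ "Gen (Inl a)"]) simp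
    next
      case 2 then show ?thesis by (intro exI[of _ "Gen (Inr a)"]) simp
    qed
  next
    case (a_inv x)
    then obtain w where "term_val T (case_sum g h) w = x" by blast
    then show ?case by (intro exI[of _ "Neg w"]) simp
  next
    case (eng_add x y)
    then obtain v w where "term_val T (case_sum g h) v = x" "term_val T (case_sum g h) w = y" by blast
    then show ?case by (intro exI[of _ "Add v w"]) simp
  next
    case (eng_mult x y)
    then obtain v w where "term_val T (case_sum g h) v = x" "term_val T (case_sum g h) w = y" by blast
    then show ?case by (intro exI[of _ "Mul v w"]) simp
  qed
  define c where "c t = (SOME w. term_val T (case_sum g h) w = t)" for t
  have c: "term_val T (case_sum g h) (c t) = t" if "t \<in> P" for t
    unfolding c_def using repr[OF that] by (rule someI_ex)
  have inj: "inj_on c (carrier T')"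
    by (rule inj_on_inverseI[where g = "term_val T (case_sum g h)"]) (simp add: T'_def c)
  have iso: "c \<in> ring_iso T' (image_ring c T')"
    by (rule inj_imp_image_ring_iso[OF inj])
  have U: "ring (image_ring c T')"
    by (rule ring.inj_imp_image_ring_is_ring[OF T' inj])
  have lift: "c \<circ> f \<in> ring_hom S (image_ring c T')"
    if f: "f \<in> ring_hom S T" and fP: "f ` carrier S \<subseteq> P" for f
  proof -
    have "f \<in> ring_hom S T'"
      using f fP by (auto simp: ring_hom_def T'_def)
    then show ?thesis
      using iso by (intro ring_hom_trans) (auto simp: ring_iso_def)
  qed
  have g': "c \<circ> g \<in> ring_hom S (image_ring c T')" and h': "c \<circ> h \<in> ring_hom S (image_ring c T')"
    using HP by (auto intro!: lift g h simp: H_def)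
  have "\<forall>r\<in>carrier R. (c \<circ> g) (\<phi> r) = (c \<circ> h) (\<phi> r)"
    using eq by simp
  with epi U g' h' s have "(c \<circ> g) s = (c \<circ> h) s"
    unfolding ring_epi_def by blast
  moreover have "g s \<in> carrier T'" "h s \<in> carrier T'"
    using HP s by (auto simp: T'_def H_def)
  ultimately show ?thesis
    using inj by (auto dest: inj_onD)
qed


section \<open>Extensions of a ring\<close>

definition homs_over ::
  "('a, 'r) ring_scheme \<Rightarrow> 'b ring \<Rightarrow> ('a \<Rightarrow> 'b) \<Rightarrow> 'c ring \<Rightarrow> ('a \<Rightarrow> 'c) \<Rightarrow> ('b \<Rightarrow> 'c) set" where
  "homs_over R A \<alpha> B \<beta> =
     {h \<in> ring_hom A B \<inter> extensional (carrier A). \<forall>r\<in>carrier R. h (\<alpha> r) = \<beta> r}"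

text \<open>The extensions coincide if there is exactly one homomorphism \<open>A \<rightarrow> B\<close> over \<open>R\<close>
  (the canonical map), and it is an isomorphism.\<close>

definition coincide_over ::
  "('a, 'r) ring_scheme \<Rightarrow> 'b ring \<Rightarrow> ('a \<Rightarrow> 'b) \<Rightarrow> 'c ring \<Rightarrow> ('a \<Rightarrow> 'c) \<Rightarrow> bool" where
  "coincide_over R A \<alpha> B \<beta> \<longleftrightarrow> (\<exists>h. homs_over R A \<alpha> B \<beta> = {h} \<and> h \<in> ring_iso A B)"

definition flat_epi_ext ::
  "'m itself \<Rightarrow> ('a, 'r) ring_scheme \<Rightarrow> 's ring \<Rightarrow> ('a \<Rightarrow> 's) \<Rightarrow> bool" where
  "flat_epi_ext tm R S \<phi> \<longleftrightarrow> ring S \<and> \<phi> \<in> ring_hom R S \<and> inj_on \<phi> (carrier R) \<and>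
     ring_epi R S \<phi> \<and> flat_module tm R (restrict_scalars \<phi> S)"

text \<open>\<open>\<iota> : R \<rightarrow> Q\<close> is a maximal flat epimorphic ring of quotients of \<open>R\<close>, where the universal
  property is required with respect to extensions with elements of type \<open>'s\<close>; the first type
  parameter is that of the test modules for flatness of \<open>Q\<close>. Positive occurrences should let
  both be type variables; a hypothesis at fixed types only asks for less.\<close>

definition is_Q_tot ::
  "'m itself \<Rightarrow> 's itself \<Rightarrow> ('a, 'r) ring_scheme \<Rightarrow> 'q ring \<Rightarrow> ('a \<Rightarrow> 'q) \<Rightarrow> bool" where
  "is_Q_tot tm _ R Q \<iota> \<longleftrightarrow> flat_epi_ext tm R Q \<iota> \<and>
     (\<forall>(S :: 's ring) \<phi>. flat_epi_ext TYPE('a) R S \<phi> \<longrightarrow>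
        (\<exists>h. homs_over R S \<phi> Q \<iota> = {h} \<and> inj_on h (carrier S)))"


section \<open>Regular and self-injective rings\<close>

definition von_neumann_regular :: "('a, 'r) ring_scheme \<Rightarrow> bool" where
  "von_neumann_regular A \<longleftrightarrow> ring A \<and>
     (\<forall>a\<in>carrier A. \<exists>b\<in>carrier A. a \<otimes>\<^bsub>A\<^esub> b \<otimes>\<^bsub>A\<^esub> a = a)"

text \<open>As for flatness, the element type of the test modules is a parameter.\<close>

definition injective_module ::
  "'m itself \<Rightarrow> ('a, 'r) ring_scheme \<Rightarrow> ('a, 'e, 'q) module_scheme \<Rightarrow> bool" where
  "injective_module _ A E \<longleftrightarrow> Module.module A E \<and>
     (\<forall>(M :: ('a, 'm) module) (N :: ('a, 'm) module). \<forall>u\<in>module_hom A M N. \<forall>f\<in>module_hom A M E.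
        Module.module A M \<longrightarrow> Module.module A N \<longrightarrow> inj_on u (carrier M) \<longrightarrow>
        (\<exists>g\<in>module_hom A N E. \<forall>x\<in>carrier M. g (u x) = f x))"

definition self_injective :: "'m itself \<Rightarrow> ('a, 'r) ring_scheme \<Rightarrow> bool" where
  "self_injective tm A \<longleftrightarrow> injective_module tm A (regular_module A)"

end

theory Submission
  imports Defs
begin

text \<open>Everything follows from one property of \<open>R = C\<^sup>k\<close>: every linear map \<open>f : D \<rightarrow> R\<close> on an
  ideal is multiplication by a fraction \<open>a / v\<close> with \<open>v\<close> a non-zero-divisor. By Lindelof's theorem, countably
  many \<open>d\<^sub>i \<in> D\<close> have the same cozero set as \<open>D\<close>. For positive \<open>c\<^sub>i\<close> decreasing fast enough,
  \<open>s = \<Sum> c\<^sub>i d\<^sub>i\<^sup>2\<close> and \<open>a = \<Sum> c\<^sub>i d\<^sub>i f(d\<^sub>i)\<close> are again in \<open>C\<^sup>k\<close> and satisfy \<open>s f(d) = a d\<close>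
  on \<open>D\<close>; adding to \<open>s\<close> a similar sum for the annihilator of \<open>D\<close> gives \<open>v\<close>.

  Applied to dense ideals, the property identifies \<open>Q\<^sub>c\<^sub>l\<close> with the complete ring of quotients; through
  Baer's criterion it makes \<open>Q\<^sub>c\<^sub>l\<close> injective over \<open>R\<close> and over itself; and for the map
  \<open>r a\<^sup>2 \<mapsto> r a\<close> it gives regularity. If \<open>R \<rightarrow> S\<close> is a flat epimorphism, injectivity yields an
  \<open>R\<close>-linear map \<open>S \<rightarrow> Q\<^sub>c\<^sub>l\<close> over \<open>R\<close>, which turns out to be an injective ring homomorphism because
  \<open>t \<otimes> y = 1 \<otimes> t y\<close> in \<open>S \<otimes>\<^sub>R S\<close>.\<close>

section \<open>Baer's criterion\<close>

text \<open>The obstacle is that \<open>f d / d\<close> is a function only on the cozero set of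
  \<open>D\<close>; it may be unbounded near the boundary and need not extend. Numerator and
  denominator are therefore built separately, as global series. The identity
  \<open>s f(d) = a d\<close> holds term by term because
  \<open>d\<^sub>i f(d) = f(d\<^sub>i d) = d f(d\<^sub>i)\<close>. The squares keep the terms of
  \<open>s\<close> nonnegative, so \<open>s\<close> vanishes only where all \<open>d\<^sub>i\<close>
  do. For \<open>k = \<infinity>\<close> no single coefficient can control all derivatives;
  \<open>c\<^sub>i\<close> controls those of order at most \<open>i\<close> on
  \<open>[-i, i]\<close>, and this suffices because finitely many terms do no harm.

  On the algebraic side, an epimorphic extension \<open>S\<close> is not assumed to be commutative,
  so \<open>S \<otimes>\<^sub>R S\<close> is not at hand as a ring to test against. The tests take
  place in a square-zero extension of \<open>S\<close> by a bimodule of biadditive maps, and the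
  same lemma shows that the image of \<open>R\<close> is central in \<open>S\<close>.\<close>

lemma module_homD:
  assumes "f \<in> module_hom R M N"
  shows "x \<in> carrier M \<Longrightarrow> f x \<in> carrier N"
    "x \<in> carrier M \<Longrightarrow> y \<in> carrier M \<Longrightarrow> f (x \<oplus>\<^bsub>M\<^esub> y) = f x \<oplus>\<^bsub>N\<^esub> f y"
    "r \<in> carrier R \<Longrightarrow> x \<in> carrier M \<Longrightarrow> f (r \<odot>\<^bsub>M\<^esub> x) = r \<odot>\<^bsub>N\<^esub> f x"
    "f \<in> extensional (carrier M)"
  using assms by (auto simp: module_hom_def PiE_def)

lemma module_homI:
  assumes "\<And>x. x \<in> carrier M \<Longrightarrow> f x \<in> carrier N"
    "\<And>x y. x \<in> carrier M \<Longrightarrow> y \<in> carrier M \<Longrightarrow> f (x \<oplus>\<^bsub>M\<^esub> y) = f x \<oplus>\<^bsub>N\<^esub> f y"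
    "\<And>r x. r \<in> carrier R \<Longrightarrow> x \<in> carrier M \<Longrightarrow> f (r \<odot>\<^bsub>M\<^esub> x) = r \<odot>\<^bsub>N\<^esub> f x"
    "f \<in> extensional (carrier M)"
  shows "f \<in> module_hom R M N"
  using assms by (auto simp: module_hom_def PiE_def)

lemma ideal_module_simps [simp]:
  "carrier (ideal_module R D) = D" "\<zero>\<^bsub>ideal_module R D\<^esub> = \<zero>\<^bsub>R\<^esub>"
  "x \<oplus>\<^bsub>ideal_module R D\<^esub> y = x \<oplus>\<^bsub>R\<^esub> y" "r \<odot>\<^bsub>ideal_module R D\<^esub> x = r \<otimes>\<^bsub>R\<^esub> x"
  by (simp_all add: ideal_module_def)

lemma restrict_scalars_simps [simp]:
  "carrier (restrict_scalars \<phi> S) = carrier S" "\<zero>\<^bsub>restrict_scalars \<phi> S\<^esub> = \<zero>\<^bsub>S\<^esub>"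
  "x \<oplus>\<^bsub>restrict_scalars \<phi> S\<^esub> y = x \<oplus>\<^bsub>S\<^esub> y" "r \<odot>\<^bsub>restrict_scalars \<phi> S\<^esub> x = \<phi> r \<otimes>\<^bsub>S\<^esub> x"
  by (simp_all add: restrict_scalars_def)

lemma abelian_group_cong:
  assumes G: "abelian_group G"
    and eq: "carrier H = carrier G" "add H = add G" "ring.zero H = ring.zero G"
  shows "abelian_group H"
proof -
  interpret abelian_group G by (rule G)
  show ?thesis
    by (rule abelian_groupI) (auto simp: eq a_ac intro: l_neg a_inv_closed)
qed

lemma module_regular_module:
  assumes "cring R"
  shows "Module.module R (regular_module R)"
proof -
  interpret R: cring R by fact
  show ?thesis
    by (intro moduleI abelian_group_cong[OF R.is_abelian_group] R.is_cring)
      (auto simp: R.l_distr R.r_distr R.m_assoc ideal_module_def)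
qed

lemma module_restrict_scalars:
  assumes "cring R" "ring S" and \<phi>: "\<phi> \<in> ring_hom R S"
  shows "Module.module R (restrict_scalars \<phi> S)"
proof -
  interpret R: cring R by fact
  interpret S: ring S by fact
  note hom = ring_hom_closed[OF \<phi>] ring_hom_add[OF \<phi>] ring_hom_mult[OF \<phi>] ring_hom_one[OF \<phi>]
  show ?thesis
    by (intro moduleI abelian_group_cong[OF S.is_abelian_group] R.is_cring)
      (auto simp: hom S.l_distr S.r_distr S.m_assoc restrict_scalars_def)
qed

text \<open>Partial linear maps from \<open>N\<close> to \<open>E\<close>, as graphs. Being single-valued amounts to containing
  no \<open>(0, e)\<close> with \<open>e \<noteq> 0\<close>.\<close>

definition linear_graphs ::
  "('a, 'r) ring_scheme \<Rightarrow> ('a, 'b, 'm) module_scheme \<Rightarrow> ('a, 'c, 'n) module_scheme \<Rightarrow> ('b \<times> 'c) set set"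
  where
  "linear_graphs R N E = {G. G \<subseteq> carrier N \<times> carrier E \<and> (\<zero>\<^bsub>N\<^esub>, \<zero>\<^bsub>E\<^esub>) \<in> G \<and>
     (\<forall>x e y f. (x, e) \<in> G \<longrightarrow> (y, f) \<in> G \<longrightarrow> (x \<oplus>\<^bsub>N\<^esub> y, e \<oplus>\<^bsub>E\<^esub> f) \<in> G) \<and>
     (\<forall>r x e. r \<in> carrier R \<longrightarrow> (x, e) \<in> G \<longrightarrow> (r \<odot>\<^bsub>N\<^esub> x, r \<odot>\<^bsub>E\<^esub> e) \<in> G) \<and>
     (\<forall>e. (\<zero>\<^bsub>N\<^esub>, e) \<in> G \<longrightarrow> e = \<zero>\<^bsub>E\<^esub>)}"

lemma linear_graphsD:
  assumes "G \<in> linear_graphs R N E"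
  shows "(x, e) \<in> G \<Longrightarrow> x \<in> carrier N" "(x, e) \<in> G \<Longrightarrow> e \<in> carrier E"
    "(\<zero>\<^bsub>N\<^esub>, \<zero>\<^bsub>E\<^esub>) \<in> G"
    "(x, e) \<in> G \<Longrightarrow> (y, f) \<in> G \<Longrightarrow> (x \<oplus>\<^bsub>N\<^esub> y, e \<oplus>\<^bsub>E\<^esub> f) \<in> G"
    "r \<in> carrier R \<Longrightarrow> (x, e) \<in> G \<Longrightarrow> (r \<odot>\<^bsub>N\<^esub> x, r \<odot>\<^bsub>E\<^esub> e) \<in> G"
    "(\<zero>\<^bsub>N\<^esub>, e) \<in> G \<Longrightarrow> e = \<zero>\<^bsub>E\<^esub>"
  using assms by (auto simp: linear_graphs_def)

lemma linear_graphs_Union_chain: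
  assumes "C \<noteq> {}" "\<And>G. G \<in> C \<Longrightarrow> G \<in> linear_graphs R N E" "\<And>G H. G \<in> C \<Longrightarrow> H \<in> C \<Longrightarrow> G \<subseteq> H \<or> H \<subseteq> G"
  shows "\<Union>C \<in> linear_graphs R N E"
  unfolding linear_graphs_def mem_Collect_eq
proof (intro conjI allI impI)
  show "\<Union>C \<subseteq> carrier N \<times> carrier E" using linear_graphsD(1,2)[OF assms(2)] by fast
  show "(\<zero>\<^bsub>N\<^esub>, \<zero>\<^bsub>E\<^esub>) \<in> \<Union>C" using linear_graphsD(3)[OF assms(2)] assms(1) by blast
next
  fix x e y f assume "(x, e) \<in> \<Union>C" "(y, f) \<in> \<Union>C"
  then obtain G where "G \<in> C" "(x, e) \<in> G" "(y, f) \<in> G" using assms(3) by blast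
  then show "(x \<oplus>\<^bsub>N\<^esub> y, e \<oplus>\<^bsub>E\<^esub> f) \<in> \<Union>C" using linear_graphsD(4)[OF assms(2)] by blast
next
  fix r x e assume "r \<in> carrier R" "(x, e) \<in> \<Union>C"
  then show "(r \<odot>\<^bsub>N\<^esub> x, r \<odot>\<^bsub>E\<^esub> e) \<in> \<Union>C" using linear_graphsD(5)[OF assms(2)] by blast
next
  fix e assume "(\<zero>\<^bsub>N\<^esub>, e) \<in> \<Union>C"
  then show "e = \<zero>\<^bsub>E\<^esub>" using linear_graphsD(6)[OF assms(2)] by blast
qed

lemma linear_graph_minus:
  assumes "Module.module R N" "Module.module R E" "G \<in> linear_graphs R N E" "(x, e) \<in> G" "(y, f) \<in> G"
  shows "(x \<ominus>\<^bsub>N\<^esub> y, e \<ominus>\<^bsub>E\<^esub> f) \<in> G"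
proof -
  interpret N: Module.module R N by fact
  interpret E: Module.module R E by fact
  note G = linear_graphsD[OF assms(3)]
  have "((\<ominus>\<^bsub>R\<^esub> \<one>\<^bsub>R\<^esub>) \<odot>\<^bsub>N\<^esub> y, (\<ominus>\<^bsub>R\<^esub> \<one>\<^bsub>R\<^esub>) \<odot>\<^bsub>E\<^esub> f) \<in> G" using assms(5) by (intro G(5)) auto
  then have "(\<ominus>\<^bsub>N\<^esub> y, \<ominus>\<^bsub>E\<^esub> f) \<in> G"
    using assms(5) G(1,2) by (simp add: N.smult_l_minus E.smult_l_minus)
  then show ?thesis unfolding a_minus_def by (rule G(4)[OF assms(4)])
qed

lemma linear_graph_unique:
  assumes "Module.module R N" "Module.module R E" "G \<in> linear_graphs R N E" "(x, e) \<in> G" "(x, f) \<in> G"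
  shows "e = f"
proof -
  interpret N: Module.module R N by fact
  interpret E: Module.module R E by fact
  note G = linear_graphsD[OF assms(3)]
  have "(x \<ominus>\<^bsub>N\<^esub> x, e \<ominus>\<^bsub>E\<^esub> f) \<in> G" by (rule linear_graph_minus[OF assms])
  then have "e \<ominus>\<^bsub>E\<^esub> f = \<zero>\<^bsub>E\<^esub>" using G(1)[OF assms(4)] G(6) by (simp add: N.M.r_neg a_minus_def)
  then show ?thesis
    using E.M.minus_equality[of e "\<ominus>\<^bsub>E\<^esub> f"] G(2)[OF assms(4)] G(2)[OF assms(5)] by (simp add: E.M.minus_eq)
qed

text \<open>This is the hypothesis of Baer's criterion: a linear map \<open>f\<close> on
  \<open>D\<close> extends to all of \<open>R\<close> iff it is multiplication by some
  \<open>e\<close>, namely the value of the extension at one.\<close>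

definition baer :: "('a, 'r) ring_scheme \<Rightarrow> ('a, 'e, 'm) module_scheme \<Rightarrow> bool" where
  "baer R E \<longleftrightarrow> (\<forall>D. ideal D R \<longrightarrow> (\<forall>f\<in>module_hom R (ideal_module R D) E.
     \<exists>e\<in>carrier E. \<forall>d\<in>D. f d = d \<odot>\<^bsub>E\<^esub> e))"

text \<open>One step of Baer's argument. The scalars \<open>r\<close> with \<open>r y\<close> in the
  domain of \<open>G\<close> form an ideal \<open>D\<close>, and \<open>r \<mapsto> G(r y)\<close>
  is linear on it; the element \<open>e0\<close> that the criterion supplies is a consistent value
  at \<open>y\<close>.\<close>

lemma linear_graph_extend:
  assumes N: "Module.module R N" and E: "Module.module R E" and G: "G \<in> linear_graphs R N E"
    and y: "y \<in> carrier N" and baer: "baer R E"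
  shows "\<exists>H\<in>linear_graphs R N E. G \<subseteq> H \<and> y \<in> fst ` H"
proof -
  interpret N: Module.module R N by fact
  interpret E: Module.module R E by fact
  note GD = linear_graphsD[OF G]
  define D where "D = {r \<in> carrier R. \<exists>e. (r \<odot>\<^bsub>N\<^esub> y, e) \<in> G}"
  define f where "f = (\<lambda>r\<in>D. THE e. (r \<odot>\<^bsub>N\<^esub> y, e) \<in> G)"
  have f_eq: "f r = e" if "r \<in> carrier R" "(r \<odot>\<^bsub>N\<^esub> y, e) \<in> G" for r e
    using that linear_graph_unique[OF N E G] by (auto simp: f_def D_def)
  have DI: "r \<in> D" if "r \<in> carrier R" "(r \<odot>\<^bsub>N\<^esub> y, e) \<in> G" for r e
    using that by (auto simp: D_def)
  have fG: "(r \<odot>\<^bsub>N\<^esub> y, f r) \<in> G" if "r \<in> D" for r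
    using that f_eq by (auto simp: D_def)
  have DR: "r \<in> carrier R" if "r \<in> D" for r using that by (simp add: D_def)
  have add: "((r \<oplus>\<^bsub>R\<^esub> s) \<odot>\<^bsub>N\<^esub> y, f r \<oplus>\<^bsub>E\<^esub> f s) \<in> G" if "r \<in> D" "s \<in> D" for r s
    using GD(4)[OF fG fG] that DR y by (simp add: N.smult_l_distr)
  have mult: "((r \<otimes>\<^bsub>R\<^esub> s) \<odot>\<^bsub>N\<^esub> y, r \<odot>\<^bsub>E\<^esub> f s) \<in> G" if "r \<in> carrier R" "s \<in> D" for r s
    using GD(5)[OF _ fG] that DR y by (simp add: N.smult_assoc1)
  have "ideal D R"
  proof (rule idealI)
    show "ring R" by (rule N.R.ring_axioms)
    show "subgroup D (add_monoid R)"
    proof (rule N.R.add.subgroupI)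
      show "D \<subseteq> carrier R" using DR by blast
      show "D \<noteq> {}" using DI[of "\<zero>\<^bsub>R\<^esub>" "\<zero>\<^bsub>E\<^esub>"] GD(3) y by auto
      show "\<ominus>\<^bsub>R\<^esub> r \<in> D" if "r \<in> D" for r
        using DI[OF _ mult[of "\<ominus>\<^bsub>R\<^esub> \<one>\<^bsub>R\<^esub>" r]] that DR by (simp add: N.R.l_minus)
      show "r \<oplus>\<^bsub>R\<^esub> s \<in> D" if "r \<in> D" "s \<in> D" for r s
        using DI[OF _ add] that DR by simp
    qed
    show "x \<otimes>\<^bsub>R\<^esub> r \<in> D" "r \<otimes>\<^bsub>R\<^esub> x \<in> D" if "r \<in> D" "x \<in> carrier R" for r x
      using DI[OF _ mult[of x r]] that DR N.R.m_comm[of r x] by auto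
  qed
  moreover have "f \<in> module_hom R (ideal_module R D) E"
  proof (rule module_homI)
    fix r s assume "r \<in> carrier (ideal_module R D)" "s \<in> carrier (ideal_module R D)"
    then show "f (r \<oplus>\<^bsub>ideal_module R D\<^esub> s) = f r \<oplus>\<^bsub>E\<^esub> f s" using f_eq[OF _ add] DR by simp
  next
    fix r s assume "r \<in> carrier R" "s \<in> carrier (ideal_module R D)"
    then show "f (r \<odot>\<^bsub>ideal_module R D\<^esub> s) = r \<odot>\<^bsub>E\<^esub> f s" using f_eq[OF _ mult] DR by simp
  next
    show "f x \<in> carrier E" if "x \<in> carrier (ideal_module R D)" for x
      using GD(2)[OF fG] that by simp
  qed (simp add: f_def)
  ultimately have "\<exists>e0\<in>carrier E. \<forall>d\<in>D. f d = d \<odot>\<^bsub>E\<^esub> e0"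
    using baer[unfolded baer_def, rule_format, of D f] by simp
  then obtain e0 where e0: "e0 \<in> carrier E" "\<And>d. d \<in> D \<Longrightarrow> f d = d \<odot>\<^bsub>E\<^esub> e0"
    by auto
  \<comment> \<open>The extension by \<open>y \<mapsto> e0\<close>. Different \<open>x\<close> and
    \<open>r\<close> may give the same sum, but single-valuedness has to be checked only over
    zero.\<close>
  define H where "H = {(x \<oplus>\<^bsub>N\<^esub> r \<odot>\<^bsub>N\<^esub> y, e \<oplus>\<^bsub>E\<^esub> r \<odot>\<^bsub>E\<^esub> e0) | x e r. (x, e) \<in> G \<and> r \<in> carrier R}"
  have HI: "(x', e') \<in> H" if "(x, e) \<in> G" "r \<in> carrier R" "x' = x \<oplus>\<^bsub>N\<^esub> r \<odot>\<^bsub>N\<^esub> y" "e' = e \<oplus>\<^bsub>E\<^esub> r \<odot>\<^bsub>E\<^esub> e0" for x e r x' e'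
    using that by (auto simp: H_def)
  have HE: "\<exists>x e r. (x, e) \<in> G \<and> r \<in> carrier R \<and> x' = x \<oplus>\<^bsub>N\<^esub> r \<odot>\<^bsub>N\<^esub> y \<and> e' = e \<oplus>\<^bsub>E\<^esub> r \<odot>\<^bsub>E\<^esub> e0"
    if "(x', e') \<in> H" for x' e'
    using that by (auto simp: H_def)
  have "H \<in> linear_graphs R N E"
    unfolding linear_graphs_def mem_Collect_eq
  proof (intro conjI allI impI)
    show "H \<subseteq> carrier N \<times> carrier E"
    proof
      fix p assume "p \<in> H"
      then obtain x e r where "p = (x \<oplus>\<^bsub>N\<^esub> r \<odot>\<^bsub>N\<^esub> y, e \<oplus>\<^bsub>E\<^esub> r \<odot>\<^bsub>E\<^esub> e0)" "(x, e) \<in> G" "r \<in> carrier R"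
        unfolding H_def by blast
      then show "p \<in> carrier N \<times> carrier E" using y e0(1) GD(1,2)[of x e] by simp
    qed
    show "(\<zero>\<^bsub>N\<^esub>, \<zero>\<^bsub>E\<^esub>) \<in> H" by (rule HI[OF GD(3), of "\<zero>\<^bsub>R\<^esub>"]) (simp_all add: y e0)
  next
    fix x1 e1 x2 e2 assume "(x1, e1) \<in> H" "(x2, e2) \<in> H"
    then obtain x e r x' e' r' where *: "(x, e) \<in> G" "r \<in> carrier R" "x1 = x \<oplus>\<^bsub>N\<^esub> r \<odot>\<^bsub>N\<^esub> y" "e1 = e \<oplus>\<^bsub>E\<^esub> r \<odot>\<^bsub>E\<^esub> e0"
      "(x', e') \<in> G" "r' \<in> carrier R" "x2 = x' \<oplus>\<^bsub>N\<^esub> r' \<odot>\<^bsub>N\<^esub> y" "e2 = e' \<oplus>\<^bsub>E\<^esub> r' \<odot>\<^bsub>E\<^esub> e0"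
      by (auto simp: H_def)
    have c: "x \<in> carrier N" "x' \<in> carrier N" "e \<in> carrier E" "e' \<in> carrier E"
      using GD(1,2) *(1,5) by auto
    show "(x1 \<oplus>\<^bsub>N\<^esub> x2, e1 \<oplus>\<^bsub>E\<^esub> e2) \<in> H"
    proof (rule HI[OF GD(4)[OF *(1,5)]])
      show "r \<oplus>\<^bsub>R\<^esub> r' \<in> carrier R" using * by simp
    qed (use * c y e0 in \<open>simp_all add: N.smult_l_distr E.smult_l_distr N.M.a_ac E.M.a_ac\<close>)
  next
    fix s x1 e1 assume s: "s \<in> carrier R" and "(x1, e1) \<in> H"
    then obtain x e r where *: "(x, e) \<in> G" "r \<in> carrier R" "x1 = x \<oplus>\<^bsub>N\<^esub> r \<odot>\<^bsub>N\<^esub> y" "e1 = e \<oplus>\<^bsub>E\<^esub> r \<odot>\<^bsub>E\<^esub> e0"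
      by (auto simp: H_def)
    have c: "x \<in> carrier N" "e \<in> carrier E"
      using GD(1,2) *(1) by auto
    show "(s \<odot>\<^bsub>N\<^esub> x1, s \<odot>\<^bsub>E\<^esub> e1) \<in> H"
    proof (rule HI[OF GD(5)[OF s *(1)]])
      show "s \<otimes>\<^bsub>R\<^esub> r \<in> carrier R" using s * by simp
    qed (use * s c y e0 in \<open>simp_all add: N.smult_r_distr E.smult_r_distr N.smult_assoc1 E.smult_assoc1\<close>)
  next
    fix e1 assume "(\<zero>\<^bsub>N\<^esub>, e1) \<in> H"
    from HE[OF this] obtain x e r where *: "(x, e) \<in> G" "r \<in> carrier R" "x \<oplus>\<^bsub>N\<^esub> r \<odot>\<^bsub>N\<^esub> y = \<zero>\<^bsub>N\<^esub>" "e1 = e \<oplus>\<^bsub>E\<^esub> r \<odot>\<^bsub>E\<^esub> e0"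
      by (elim exE conjE) (rule that, simp_all)
    have c: "x \<in> carrier N" "e \<in> carrier E"
      using GD(1,2) *(1) by auto
    \<comment> \<open>If \<open>x + r y = 0\<close> then \<open>r y = - x\<close> lies in the domain
      of \<open>G\<close>, so \<open>r\<close> is in \<open>D\<close> and
      \<open>r e0 = f r = - e\<close>.\<close>
    have "(\<zero>\<^bsub>N\<^esub> \<ominus>\<^bsub>N\<^esub> x, \<zero>\<^bsub>E\<^esub> \<ominus>\<^bsub>E\<^esub> e) \<in> G" by (rule linear_graph_minus[OF N E G GD(3) *(1)])
    moreover have "\<zero>\<^bsub>N\<^esub> \<ominus>\<^bsub>N\<^esub> x = r \<odot>\<^bsub>N\<^esub> y"
      using N.M.minus_equality[of "r \<odot>\<^bsub>N\<^esub> y" x] *(2,3) c y by (simp add: N.M.a_comm N.M.minus_eq)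
    ultimately have "(r \<odot>\<^bsub>N\<^esub> y, \<ominus>\<^bsub>E\<^esub> e) \<in> G" using c by (simp add: E.M.minus_eq)
    then have "r \<odot>\<^bsub>E\<^esub> e0 = \<ominus>\<^bsub>E\<^esub> e" using f_eq[OF *(2)] DI[OF *(2)] e0(2) by simp
    then show "e1 = \<zero>\<^bsub>E\<^esub>" using c *(4) by (simp add: E.M.r_neg)
  qed
  moreover have "G \<subseteq> H"
  proof
    fix p assume "p \<in> G"
    then obtain x e where p: "p = (x, e)" "(x, e) \<in> G" by (cases p) auto
    then have "x \<in> carrier N" "e \<in> carrier E" using GD(1,2) by blast+
    then show "p \<in> H" unfolding p(1) by (intro HI[OF p(2), of "\<zero>\<^bsub>R\<^esub>"]) (simp_all add: y e0)
  qed
  moreover have "(y, e0) \<in> H" by (rule HI[OF GD(3), of "\<one>\<^bsub>R\<^esub>"]) (simp_all add: y e0)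
  then have "y \<in> fst ` H" by force
  ultimately show ?thesis by blast
qed

text \<open>Zorn's lemma on the linear graphs that contain that of \<open>f\<close>; a maximal one
  is total because any missing \<open>y\<close> could be added. The submodule \<open>K\<close> is a
  bare set, so that images of injective maps can be plugged in directly.\<close>

lemma baer_extension:
  assumes N: "Module.module R N" and E: "Module.module R E" and baer: "baer R E"
    and K: "K \<subseteq> carrier N" "\<zero>\<^bsub>N\<^esub> \<in> K" "\<And>x y. x \<in> K \<Longrightarrow> y \<in> K \<Longrightarrow> x \<oplus>\<^bsub>N\<^esub> y \<in> K"
      "\<And>r x. r \<in> carrier R \<Longrightarrow> x \<in> K \<Longrightarrow> r \<odot>\<^bsub>N\<^esub> x \<in> K"
    and f: "\<And>x. x \<in> K \<Longrightarrow> f x \<in> carrier E" "\<And>x y. x \<in> K \<Longrightarrow> y \<in> K \<Longrightarrow> f (x \<oplus>\<^bsub>N\<^esub> y) = f x \<oplus>\<^bsub>E\<^esub> f y"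
      "\<And>r x. r \<in> carrier R \<Longrightarrow> x \<in> K \<Longrightarrow> f (r \<odot>\<^bsub>N\<^esub> x) = r \<odot>\<^bsub>E\<^esub> f x"
  shows "\<exists>g\<in>module_hom R N E. \<forall>x\<in>K. g x = f x"
proof -
  interpret N: Module.module R N by fact
  interpret E: Module.module R E by fact
  define G0 where "G0 = (\<lambda>x. (x, f x)) ` K"
  have f0: "f \<zero>\<^bsub>N\<^esub> = \<zero>\<^bsub>E\<^esub>" using f(3)[of "\<zero>\<^bsub>R\<^esub>" "\<zero>\<^bsub>N\<^esub>"] K(2) f(1) by simp
  have G0: "G0 \<in> linear_graphs R N E"
    unfolding linear_graphs_def G0_def using K f f0 by (auto simp: image_iff)
  have "\<exists>M\<in>{G \<in> linear_graphs R N E. G0 \<subseteq> G}. \<forall>X\<in>{G \<in> linear_graphs R N E. G0 \<subseteq> G}. M \<subseteq> X \<longrightarrow> X = M"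
  proof (rule subset_Zorn_nonempty)
    show "{G \<in> linear_graphs R N E. G0 \<subseteq> G} \<noteq> {}" using G0 by blast
    fix C assume C: "C \<noteq> {}" "subset.chain {G \<in> linear_graphs R N E. G0 \<subseteq> G} C"
    have CD: "\<And>G. G \<in> C \<Longrightarrow> G \<in> linear_graphs R N E" "\<And>G. G \<in> C \<Longrightarrow> G0 \<subseteq> G"
      "\<And>G H. G \<in> C \<Longrightarrow> H \<in> C \<Longrightarrow> G \<subseteq> H \<or> H \<subseteq> G"
      using C(2) unfolding subset_chain_def by blast+
    have "\<Union>C \<in> linear_graphs R N E" using C(1) CD(1,3) by (rule linear_graphs_Union_chain)
    moreover have "G0 \<subseteq> \<Union>C" using C(1) CD(2) by blast
    ultimately show "\<Union>C \<in> {G \<in> linear_graphs R N E. G0 \<subseteq> G}" by blast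
  qed
  then obtain G where G': "G \<in> {G \<in> linear_graphs R N E. G0 \<subseteq> G}"
    "\<forall>X\<in>{G \<in> linear_graphs R N E. G0 \<subseteq> G}. G \<subseteq> X \<longrightarrow> X = G"
    by (rule bexE)
  then have G: "G \<in> linear_graphs R N E" "G0 \<subseteq> G" by simp_all
  have max: "H = G" if "H \<in> linear_graphs R N E" "G \<subseteq> H" for H
    using G'(2) that G(2) by simp
  note GD = linear_graphsD[OF G(1)]
  have total: "\<exists>e. (y, e) \<in> G" if y: "y \<in> carrier N" for y
  proof -
    obtain H where "H \<in> linear_graphs R N E" "G \<subseteq> H" "y \<in> fst ` H"
      using linear_graph_extend[OF N E G(1) y baer] by (rule bexE) auto
    with max[of H] show ?thesis by auto
  qed
  define g where "g = (\<lambda>y\<in>carrier N. THE e. (y, e) \<in> G)"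
  have g_eq: "g y = e" if "(y, e) \<in> G" for y e
    using that linear_graph_unique[OF N E G(1)] GD(1) by (auto simp: g_def)
  have gG: "(y, g y) \<in> G" if "y \<in> carrier N" for y
    using total[OF that] g_eq by auto
  have "g \<in> module_hom R N E"
  proof (rule module_homI)
    show "g x \<in> carrier E" if "x \<in> carrier N" for x using GD(2)[OF gG[OF that]] .
    show "g (x \<oplus>\<^bsub>N\<^esub> y) = g x \<oplus>\<^bsub>E\<^esub> g y" if "x \<in> carrier N" "y \<in> carrier N" for x y
      by (rule g_eq[OF GD(4)[OF gG gG]]) (use that in auto)
    show "g (r \<odot>\<^bsub>N\<^esub> x) = r \<odot>\<^bsub>E\<^esub> g x" if "r \<in> carrier R" "x \<in> carrier N" for r x
      by (rule g_eq[OF GD(5)[OF _ gG]]) (use that in auto)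
  qed (simp add: g_def)
  moreover have "g x = f x" if "x \<in> K" for x
    using that G(2) by (intro g_eq) (auto simp: G0_def)
  ultimately show ?thesis by blast
qed

lemma module_hom_zero:
  assumes "Module.module R M" "Module.module R N" "u \<in> module_hom R M N"
  shows "u \<zero>\<^bsub>M\<^esub> = \<zero>\<^bsub>N\<^esub>"
proof -
  interpret M: Module.module R M by fact
  interpret N: Module.module R N by fact
  show ?thesis using module_homD(3)[OF assms(3), of "\<zero>\<^bsub>R\<^esub>" "\<zero>\<^bsub>M\<^esub>"] module_homD(1)[OF assms(3)] by simp
qed

text \<open>With \<open>K\<close> the image of \<open>u\<close>, the map to extend is
  \<open>f\<close> after the inverse of \<open>u\<close>. The criterion mentions ideals only, so the
  element type of the test modules is arbitrary.\<close>

lemma baer_imp_injective_module: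
  fixes E :: "('a, 'e, 'q) module_scheme"
  assumes E: "Module.module R E" and baer: "baer R E"
  shows "injective_module TYPE('m) R E"
  unfolding injective_module_def
proof (intro conjI allI ballI impI)
  fix M N :: "('a, 'm) module" and u f
  assume u: "u \<in> module_hom R M N" and f: "f \<in> module_hom R M E"
    and M: "Module.module R M" and N: "Module.module R N" and inj: "inj_on u (carrier M)"
  interpret M: Module.module R M by fact
  note uD = module_homD[OF u] and fD = module_homD[OF f]
  let ?v = "inv_into (carrier M) u"
  have v: "?v (u x) = x" if "x \<in> carrier M" for x using that inj by simp
  have "\<exists>g\<in>module_hom R N E. \<forall>x\<in>u ` carrier M. g x = f (?v x)"
  proof (rule baer_extension[OF N E baer])
    show "\<zero>\<^bsub>N\<^esub> \<in> u ` carrier M" using module_hom_zero[OF M N u] by (metis M.M.zero_closed imageI)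
  next
    fix x y assume "x \<in> u ` carrier M" "y \<in> u ` carrier M"
    then obtain x' y' where *: "x' \<in> carrier M" "y' \<in> carrier M" "x = u x'" "y = u y'" by blast
    then have "x \<oplus>\<^bsub>N\<^esub> y = u (x' \<oplus>\<^bsub>M\<^esub> y')" by (simp add: uD(2))
    with * show "x \<oplus>\<^bsub>N\<^esub> y \<in> u ` carrier M" "f (?v (x \<oplus>\<^bsub>N\<^esub> y)) = f (?v x) \<oplus>\<^bsub>E\<^esub> f (?v y)"
      by (simp_all add: v fD(2))
  next
    fix r x assume "r \<in> carrier R" "x \<in> u ` carrier M"
    then obtain x' where *: "r \<in> carrier R" "x' \<in> carrier M" "x = u x'" by blast
    then have "r \<odot>\<^bsub>N\<^esub> x = u (r \<odot>\<^bsub>M\<^esub> x')" by (simp add: uD(3))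
    with * show "r \<odot>\<^bsub>N\<^esub> x \<in> u ` carrier M" "f (?v (r \<odot>\<^bsub>N\<^esub> x)) = r \<odot>\<^bsub>E\<^esub> f (?v x)"
      by (simp_all add: v fD(3))
  qed (use uD(1) fD(1) v in auto)
  then obtain g where g: "g \<in> module_hom R N E" "\<forall>x\<in>u ` carrier M. g x = f (?v x)" by (rule bexE)
  have "g (u x) = f x" if "x \<in> carrier M" for x using g(2) v that by simp
  with g(1) show "\<exists>g\<in>module_hom R N E. \<forall>x\<in>carrier M. g (u x) = f x" by (intro bexI[of _ g]) simp_all
qed (rule E)

section \<open>The classical ring of quotients\<close>

definition fraction :: "('a, 'r) ring_scheme \<Rightarrow> 'a \<Rightarrow> 'a \<Rightarrow> ('a \<times> 'a) set" where
  "fraction R a s = frac_rel R (non_zero_divisors R) `` {(a, s)}"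

lemma Q_cl_map_fraction: "Q_cl_map R a = fraction R a \<one>\<^bsub>R\<^esub>"
  by (simp add: Q_cl_map_def fraction_def)

context cring
begin

abbreviation nzd :: "'a set" where "nzd \<equiv> non_zero_divisors R"

lemma nzdI: "s \<in> carrier R \<Longrightarrow> (\<And>x. x \<in> carrier R \<Longrightarrow> s \<otimes> x = \<zero> \<Longrightarrow> x = \<zero>) \<Longrightarrow> s \<in> nzd"
  and nzd_carrier [simp]: "s \<in> nzd \<Longrightarrow> s \<in> carrier R"
  by (simp_all add: non_zero_divisors_def)

lemma nzd_zero:
  assumes "s \<in> nzd" "x \<in> carrier R" "s \<otimes> x = \<zero>"
  shows "x = \<zero>"
  using assms(1)[unfolded non_zero_divisors_def] assms(2,3) by blast

lemma nzd_cancel: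
  assumes "s \<in> nzd" "x \<in> carrier R" "y \<in> carrier R"
  shows "s \<otimes> x = s \<otimes> y \<longleftrightarrow> x = y"
proof
  assume eq: "s \<otimes> x = s \<otimes> y"
  have "s \<otimes> (x \<ominus> y) = s \<otimes> x \<ominus> s \<otimes> y"
    using assms by (simp add: minus_eq r_distr r_minus)
  also have "\<dots> = \<zero>" unfolding eq using assms by simp
  finally have "x \<ominus> y = \<zero>" using nzd_zero[OF assms(1)] assms by simp
  then show "x = y" using assms by simp
qed simp

lemma one_nzd [simp]: "\<one> \<in> nzd"
  by (rule nzdI) simp_all

lemma mult_nzd [simp]: "s \<in> nzd \<Longrightarrow> t \<in> nzd \<Longrightarrow> s \<otimes> t \<in> nzd"
  by (rule nzdI) (simp, metis m_assoc m_closed nzd_carrier nzd_zero)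

text \<open>The extra factor \<open>u\<close> in \<open>frac_rel\<close> is a non-zero-divisor here
  and cancels, which leaves cross multiplication.\<close>

lemma frac_rel_iff:
  "((a, s), (b, t)) \<in> frac_rel R nzd \<longleftrightarrow>
     a \<in> carrier R \<and> b \<in> carrier R \<and> s \<in> nzd \<and> t \<in> nzd \<and> a \<otimes> t = b \<otimes> s"
proof -
  have "(\<exists>u\<in>nzd. u \<otimes> (a \<otimes> t) = u \<otimes> (b \<otimes> s)) \<longleftrightarrow> a \<otimes> t = b \<otimes> s"
    if "a \<in> carrier R" "b \<in> carrier R" "s \<in> nzd" "t \<in> nzd"
    using that nzd_cancel[of _ "a \<otimes> t" "b \<otimes> s"] one_nzd by auto
  then show ?thesis unfolding frac_rel_def by blast
qed

lemma equiv_frac_rel: "equiv (carrier R \<times> nzd) (frac_rel R nzd)"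
proof (rule equivI)
  show "frac_rel R nzd \<subseteq> (carrier R \<times> nzd) \<times> (carrier R \<times> nzd)"
    by (auto simp: frac_rel_def)
  show "refl_on (carrier R \<times> nzd) (frac_rel R nzd)"
    by (auto simp: refl_on_def frac_rel_iff)
  show "sym (frac_rel R nzd)"
    by (auto simp: sym_def frac_rel_iff)
  show "trans (frac_rel R nzd)"
    unfolding trans_def
  proof (clarsimp simp: frac_rel_iff)
    fix a s b t c u
    assume *: "a \<in> carrier R" "b \<in> carrier R" "c \<in> carrier R" "s \<in> nzd" "t \<in> nzd" "u \<in> nzd"
      "a \<otimes> t = b \<otimes> s" "b \<otimes> u = c \<otimes> t"
    \<comment> \<open>Multiply by the middle denominator \<open>t\<close>, which is cancelled at the
      end.\<close>
    have "t \<otimes> (a \<otimes> u) = (a \<otimes> t) \<otimes> u" using *(1-6) by (simp add: m_ac)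
    also have "\<dots> = (b \<otimes> u) \<otimes> s" using *(1-6) by (simp add: *(7) m_ac)
    also have "\<dots> = t \<otimes> (c \<otimes> s)" using *(1-6) by (simp add: *(8) m_ac)
    finally show "a \<otimes> u = c \<otimes> s" using *(1-6) nzd_cancel by simp
  qed
qed

lemma fraction_eq_iff:
  assumes "a \<in> carrier R" "b \<in> carrier R" "s \<in> nzd" "t \<in> nzd"
  shows "fraction R a s = fraction R b t \<longleftrightarrow> a \<otimes> t = b \<otimes> s"
  using assms eq_equiv_class_iff[OF equiv_frac_rel, of "(a, s)" "(b, t)"]
  by (simp add: fraction_def frac_rel_iff)

lemma fraction_closed [simp]:
  "a \<in> carrier R \<Longrightarrow> s \<in> nzd \<Longrightarrow> fraction R a s \<in> carrier (Q_cl R)"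
  by (auto simp: Q_cl_def localization_def fraction_def intro: quotientI)

lemma Q_cl_cases:
  assumes "q \<in> carrier (Q_cl R)"
  obtains a s where "a \<in> carrier R" "s \<in> nzd" "q = fraction R a s"
  using assms by (auto simp: Q_cl_def localization_def fraction_def elim!: quotientE)

lemma mem_fraction_iff:
  "(b, t) \<in> fraction R a s \<longleftrightarrow>
     a \<in> carrier R \<and> b \<in> carrier R \<and> s \<in> nzd \<and> t \<in> nzd \<and> a \<otimes> t = b \<otimes> s"
  by (simp add: fraction_def frac_rel_iff)

text \<open>The operations of the localization are unions over all representatives; such a union
  collapses when the result does not depend on them, the class being nonempty.\<close>

lemma UN_fraction:
  assumes "a \<in> carrier R" "s \<in> nzd" "\<And>a' s'. (a', s') \<in> fraction R a s \<Longrightarrow> F a' s' = C"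
  shows "(\<Union>(a', s')\<in>fraction R a s. F a' s') = C"
proof -
  have "(a, s) \<in> fraction R a s" using assms(1,2) by (simp add: mem_fraction_iff)
  moreover have "\<forall>p\<in>fraction R a s. case_prod F p = C"
    using assms(3) by blast
  ultimately show ?thesis by (rule UN_constant_eq)
qed

lemma fraction_mult:
  assumes "a \<in> carrier R" "b \<in> carrier R" "s \<in> nzd" "t \<in> nzd"
  shows "fraction R a s \<otimes>\<^bsub>Q_cl R\<^esub> fraction R b t = fraction R (a \<otimes> b) (s \<otimes> t)"
proof -
  have "fraction R (a' \<otimes> b') (s' \<otimes> t') = fraction R (a \<otimes> b) (s \<otimes> t)"
    if "(a', s') \<in> fraction R a s" "(b', t') \<in> fraction R b t" for a' s' b' t'
  proof -
    have *: "a' \<in> carrier R" "b' \<in> carrier R" "s' \<in> nzd" "t' \<in> nzd" "a \<otimes> s' = a' \<otimes> s" "b \<otimes> t' = b' \<otimes> t"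
      using that by (auto simp: mem_fraction_iff)
    have "(a' \<otimes> b') \<otimes> (s \<otimes> t) = (a' \<otimes> s) \<otimes> (b' \<otimes> t)" using *(1-4) assms by (simp add: m_ac)
    also have "\<dots> = (a \<otimes> b) \<otimes> (s' \<otimes> t')" using assms *(1-4) by (simp flip: *(5,6)) (simp add: m_ac)
    finally show ?thesis using * assms by (simp add: fraction_eq_iff)
  qed
  then show ?thesis
    unfolding Q_cl_def localization_def monoid.select_convs fraction_def[symmetric]
    using assms by (intro UN_fraction)
qed

lemma fraction_add:
  assumes "a \<in> carrier R" "b \<in> carrier R" "s \<in> nzd" "t \<in> nzd"
  shows "fraction R a s \<oplus>\<^bsub>Q_cl R\<^esub> fraction R b t = fraction R (a \<otimes> t \<oplus> b \<otimes> s) (s \<otimes> t)"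
proof -
  have "fraction R (a' \<otimes> t' \<oplus> b' \<otimes> s') (s' \<otimes> t') = fraction R (a \<otimes> t \<oplus> b \<otimes> s) (s \<otimes> t)"
    if "(a', s') \<in> fraction R a s" "(b', t') \<in> fraction R b t" for a' s' b' t'
  proof -
    have *: "a' \<in> carrier R" "b' \<in> carrier R" "s' \<in> nzd" "t' \<in> nzd" "a \<otimes> s' = a' \<otimes> s" "b \<otimes> t' = b' \<otimes> t"
      using that by (auto simp: mem_fraction_iff)
    have "(a' \<otimes> t' \<oplus> b' \<otimes> s') \<otimes> (s \<otimes> t) = (a' \<otimes> s) \<otimes> (t \<otimes> t') \<oplus> (b' \<otimes> t) \<otimes> (s \<otimes> s')"
      using *(1-4) assms by (simp add: l_distr r_distr m_ac)
    also have "\<dots> = (a \<otimes> t \<oplus> b \<otimes> s) \<otimes> (s' \<otimes> t')"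
      using assms *(1-4) by (simp flip: *(5,6)) (simp add: l_distr r_distr m_ac)
    finally show ?thesis using * assms by (simp add: fraction_eq_iff)
  qed
  then show ?thesis
    unfolding Q_cl_def localization_def ring.select_convs fraction_def[symmetric]
    using assms by (intro UN_fraction)
qed

lemma Q_cl_one: "\<one>\<^bsub>Q_cl R\<^esub> = fraction R \<one> \<one>"
  and Q_cl_zero: "\<zero>\<^bsub>Q_cl R\<^esub> = fraction R \<zero> \<one>"
  by (simp_all add: Q_cl_def localization_def fraction_def)

lemma cring_Q_cl: "cring (Q_cl R)"
proof (rule cringI)
  note fraction_simps = fraction_add fraction_mult Q_cl_one Q_cl_zero fraction_eq_iff
  show "abelian_group (Q_cl R)"
  proof (rule abelian_groupI)
    fix x y z assume "x \<in> carrier (Q_cl R)" "y \<in> carrier (Q_cl R)" "z \<in> carrier (Q_cl R)"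
    then obtain a s b t c u where "a \<in> carrier R" "s \<in> nzd" "b \<in> carrier R" "t \<in> nzd" "c \<in> carrier R" "u \<in> nzd"
      "x = fraction R a s" "y = fraction R b t" "z = fraction R c u" by (elim Q_cl_cases)
    then show "x \<oplus>\<^bsub>Q_cl R\<^esub> y \<oplus>\<^bsub>Q_cl R\<^esub> z = x \<oplus>\<^bsub>Q_cl R\<^esub> (y \<oplus>\<^bsub>Q_cl R\<^esub> z)"
      by (simp add: fraction_simps) (simp add: l_distr r_distr m_ac a_ac)
  next
    fix x y assume "x \<in> carrier (Q_cl R)" "y \<in> carrier (Q_cl R)"
    then obtain a s b t where "a \<in> carrier R" "s \<in> nzd" "b \<in> carrier R" "t \<in> nzd"
      "x = fraction R a s" "y = fraction R b t" by (elim Q_cl_cases)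
    then show "x \<oplus>\<^bsub>Q_cl R\<^esub> y = y \<oplus>\<^bsub>Q_cl R\<^esub> x" "x \<oplus>\<^bsub>Q_cl R\<^esub> y \<in> carrier (Q_cl R)"
      by (simp_all add: fraction_simps) (simp add: l_distr r_distr m_ac a_ac)
  next
    fix x assume "x \<in> carrier (Q_cl R)"
    then obtain a s where "a \<in> carrier R" "s \<in> nzd" "x = fraction R a s" by (rule Q_cl_cases)
    then show "\<zero>\<^bsub>Q_cl R\<^esub> \<oplus>\<^bsub>Q_cl R\<^esub> x = x" "\<exists>y\<in>carrier (Q_cl R). y \<oplus>\<^bsub>Q_cl R\<^esub> x = \<zero>\<^bsub>Q_cl R\<^esub>"
      by (simp_all add: fraction_simps) (rule bexI[of _ "fraction R (\<ominus> a) s"],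
          simp_all add: fraction_simps l_minus l_neg)
  qed (simp add: fraction_simps)
  show "comm_monoid (Q_cl R)"
  proof (rule comm_monoidI)
    fix x y z assume "x \<in> carrier (Q_cl R)" "y \<in> carrier (Q_cl R)" "z \<in> carrier (Q_cl R)"
    then show "x \<otimes>\<^bsub>Q_cl R\<^esub> y \<otimes>\<^bsub>Q_cl R\<^esub> z = x \<otimes>\<^bsub>Q_cl R\<^esub> (y \<otimes>\<^bsub>Q_cl R\<^esub> z)"
      by (elim Q_cl_cases) (simp add: fraction_simps m_ac)
  next
    fix x y assume "x \<in> carrier (Q_cl R)" "y \<in> carrier (Q_cl R)"
    then show "x \<otimes>\<^bsub>Q_cl R\<^esub> y = y \<otimes>\<^bsub>Q_cl R\<^esub> x" "x \<otimes>\<^bsub>Q_cl R\<^esub> y \<in> carrier (Q_cl R)"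
      by (elim Q_cl_cases; simp add: fraction_simps m_ac)+
  next
    fix x assume "x \<in> carrier (Q_cl R)"
    then show "\<one>\<^bsub>Q_cl R\<^esub> \<otimes>\<^bsub>Q_cl R\<^esub> x = x" by (elim Q_cl_cases) (simp add: fraction_simps)
  qed (simp add: fraction_simps)
  fix x y z assume "x \<in> carrier (Q_cl R)" "y \<in> carrier (Q_cl R)" "z \<in> carrier (Q_cl R)"
  then obtain a s b t c u where "a \<in> carrier R" "s \<in> nzd" "b \<in> carrier R" "t \<in> nzd" "c \<in> carrier R" "u \<in> nzd"
    "x = fraction R a s" "y = fraction R b t" "z = fraction R c u" by (elim Q_cl_cases)
  then show "(x \<oplus>\<^bsub>Q_cl R\<^esub> y) \<otimes>\<^bsub>Q_cl R\<^esub> z = x \<otimes>\<^bsub>Q_cl R\<^esub> z \<oplus>\<^bsub>Q_cl R\<^esub> y \<otimes>\<^bsub>Q_cl R\<^esub> z"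
    by (simp add: fraction_simps) (simp add: l_distr r_distr m_ac a_ac)
qed

lemma Q_cl_map_closed [simp]: "a \<in> carrier R \<Longrightarrow> Q_cl_map R a \<in> carrier (Q_cl R)"
  by (simp add: Q_cl_map_fraction)

lemma Q_cl_map_hom: "Q_cl_map R \<in> ring_hom R (Q_cl R)"
  by (rule ring_hom_memI) (simp_all add: Q_cl_map_fraction fraction_mult fraction_add Q_cl_one)

lemma Q_cl_map_eq_iff:
  "a \<in> carrier R \<Longrightarrow> b \<in> carrier R \<Longrightarrow> Q_cl_map R a = Q_cl_map R b \<longleftrightarrow> a = b"
  by (simp add: Q_cl_map_fraction fraction_eq_iff)

lemma inj_on_Q_cl_map: "inj_on (Q_cl_map R) (carrier R)"
  by (simp add: inj_on_def Q_cl_map_eq_iff)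

lemma Q_cl_map_zero: "Q_cl_map R \<zero> = \<zero>\<^bsub>Q_cl R\<^esub>"
  by (simp add: Q_cl_map_fraction Q_cl_zero)

lemma Q_cl_map_mult_fraction:
  "a \<in> carrier R \<Longrightarrow> b \<in> carrier R \<Longrightarrow> s \<in> nzd \<Longrightarrow> Q_cl_map R a \<otimes>\<^bsub>Q_cl R\<^esub> fraction R b s = fraction R (a \<otimes> b) s"
  by (simp add: Q_cl_map_fraction fraction_mult)

lemma Q_cl_map_denominator:
  "a \<in> carrier R \<Longrightarrow> s \<in> nzd \<Longrightarrow> Q_cl_map R s \<otimes>\<^bsub>Q_cl R\<^esub> fraction R a s = Q_cl_map R a"
  by (simp add: Q_cl_map_mult_fraction) (simp add: Q_cl_map_fraction fraction_eq_iff m_comm)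

lemma Q_cl_cancel:
  assumes "s \<in> nzd" "p \<in> carrier (Q_cl R)" "q \<in> carrier (Q_cl R)"
  shows "Q_cl_map R s \<otimes>\<^bsub>Q_cl R\<^esub> p = Q_cl_map R s \<otimes>\<^bsub>Q_cl R\<^esub> q \<longleftrightarrow> p = q"
proof
  interpret Q: cring "Q_cl R" by (rule cring_Q_cl)
  have inv: "fraction R \<one> s \<otimes>\<^bsub>Q_cl R\<^esub> (Q_cl_map R s \<otimes>\<^bsub>Q_cl R\<^esub> x) = x" if "x \<in> carrier (Q_cl R)" for x
  proof -
    have "fraction R \<one> s \<otimes>\<^bsub>Q_cl R\<^esub> Q_cl_map R s = \<one>\<^bsub>Q_cl R\<^esub>"
      using assms(1) by (simp add: Q_cl_map_fraction fraction_mult fraction_eq_iff Q_cl_one)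
    then show ?thesis using assms(1) that by (simp flip: Q.m_assoc)
  qed
  assume "Q_cl_map R s \<otimes>\<^bsub>Q_cl R\<^esub> p = Q_cl_map R s \<otimes>\<^bsub>Q_cl R\<^esub> q"
  then have "fraction R \<one> s \<otimes>\<^bsub>Q_cl R\<^esub> (Q_cl_map R s \<otimes>\<^bsub>Q_cl R\<^esub> p) = fraction R \<one> s \<otimes>\<^bsub>Q_cl R\<^esub> (Q_cl_map R s \<otimes>\<^bsub>Q_cl R\<^esub> q)"
    by (rule arg_cong)
  then show "p = q" unfolding inv[OF assms(2)] inv[OF assms(3)] .
qed simp

lemma module_Q_cl: "Module.module R (restrict_scalars (Q_cl_map R) (Q_cl R))"
  by (intro module_restrict_scalars is_cring Q_cl_map_hom cring.axioms(1)[OF cring_Q_cl])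

text \<open>The image of a denominator is invertible, and inverses are unique.\<close>

lemma ring_epi_Q_cl: "ring_epi R (Q_cl R) (Q_cl_map R)"
  unfolding ring_epi_def
proof (intro conjI allI impI ballI)
  show "Q_cl_map R \<in> ring_hom R (Q_cl R)" by (rule Q_cl_map_hom)
  fix T :: "(('a \<times> 'a) set + ('a \<times> 'a) set) ring_term ring" and g h q
  assume T: "ring T" and g: "g \<in> ring_hom (Q_cl R) T" and h: "h \<in> ring_hom (Q_cl R) T"
    and eq: "\<forall>r\<in>carrier R. g (Q_cl_map R r) = h (Q_cl_map R r)" and q: "q \<in> carrier (Q_cl R)"
  interpret Q: cring "Q_cl R" by (rule cring_Q_cl)
  interpret T: ring T by fact
  obtain a s where as: "a \<in> carrier R" "s \<in> nzd" "q = fraction R a s" using q by (rule Q_cl_cases)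
  define u where "u = fraction R \<one> s"
  have u: "u \<in> carrier (Q_cl R)" using as by (simp add: u_def)
  have su: "Q_cl_map R s \<otimes>\<^bsub>Q_cl R\<^esub> u = \<one>\<^bsub>Q_cl R\<^esub>" "u \<otimes>\<^bsub>Q_cl R\<^esub> Q_cl_map R s = \<one>\<^bsub>Q_cl R\<^esub>"
    and qa: "q = Q_cl_map R a \<otimes>\<^bsub>Q_cl R\<^esub> u"
    using as by (simp_all add: u_def Q_cl_map_fraction fraction_mult fraction_eq_iff Q_cl_one)
  note gc = ring_hom_closed[OF g] and hc = ring_hom_closed[OF h]
  have "g u = g u \<otimes>\<^bsub>T\<^esub> h (Q_cl_map R s \<otimes>\<^bsub>Q_cl R\<^esub> u)"
    using u gc ring_hom_one[OF h] by (simp add: su)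
  also have "\<dots> = g u \<otimes>\<^bsub>T\<^esub> (g (Q_cl_map R s) \<otimes>\<^bsub>T\<^esub> h u)"
    using u as eq ring_hom_mult[OF h] by simp
  also have "\<dots> = g (u \<otimes>\<^bsub>Q_cl R\<^esub> Q_cl_map R s) \<otimes>\<^bsub>T\<^esub> h u"
    using u as gc hc ring_hom_mult[OF g] by (simp add: T.m_assoc)
  also have "\<dots> = h u"
    using u hc ring_hom_one[OF g] by (simp add: su)
  finally show "g q = h q"
    using qa u as eq by (simp add: ring_hom_mult[OF g] ring_hom_mult[OF h])
qed

end

section \<open>Ideals of \<open>R\<close> and fractions: integral parts and dense ideals\<close>

lemma ideal_subsetD: "ideal D R \<Longrightarrow> d \<in> D \<Longrightarrow> d \<in> carrier R"
  using ideal.Icarr by fast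

context cring
begin

abbreviation Q where "Q \<equiv> Q_cl R"
abbreviation \<iota> where "\<iota> \<equiv> Q_cl_map R"
abbreviation Q_mod where "Q_mod \<equiv> restrict_scalars \<iota> Q"

lemma ideal_if_closed:
  assumes "D \<subseteq> carrier R" "\<zero> \<in> D" "\<And>x y. x \<in> D \<Longrightarrow> y \<in> D \<Longrightarrow> x \<oplus> y \<in> D"
    "\<And>r x. r \<in> carrier R \<Longrightarrow> x \<in> D \<Longrightarrow> r \<otimes> x \<in> D"
  shows "ideal D R"
proof (rule idealI)
  show "ring R" by (rule ring_axioms)
  show "subgroup D (add_monoid R)"
  proof (rule add.subgroupI)
    show "\<ominus> x \<in> D" if "x \<in> D" for x
      using assms(4)[of "\<ominus> \<one>" x] that assms(1) by (auto simp: l_minus)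
  qed (use assms in auto)
  show "x \<otimes> a \<in> D" "a \<otimes> x \<in> D" if "a \<in> D" "x \<in> carrier R" for a x
    using assms(4)[OF that(2,1)] that assms(1) m_comm[of a x] by auto
qed

lemma ideal_mem:
  assumes "ideal D R"
  shows "\<zero> \<in> D" "x \<in> D \<Longrightarrow> y \<in> D \<Longrightarrow> x \<oplus> y \<in> D" "r \<in> carrier R \<Longrightarrow> x \<in> D \<Longrightarrow> r \<otimes> x \<in> D"
proof -
  interpret ideal D R by fact
  show "\<zero> \<in> D" "x \<in> D \<Longrightarrow> y \<in> D \<Longrightarrow> x \<oplus> y \<in> D" "r \<in> carrier R \<Longrightarrow> x \<in> D \<Longrightarrow> r \<otimes> x \<in> D"
    by (simp_all add: I_l_closed)
qed

lemma Q_cl_map_simps: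
  "x \<in> carrier R \<Longrightarrow> y \<in> carrier R \<Longrightarrow> \<iota> (x \<otimes> y) = \<iota> x \<otimes>\<^bsub>Q\<^esub> \<iota> y"
  "x \<in> carrier R \<Longrightarrow> y \<in> carrier R \<Longrightarrow> \<iota> (x \<oplus> y) = \<iota> x \<oplus>\<^bsub>Q\<^esub> \<iota> y"
  "\<iota> \<one> = \<one>\<^bsub>Q\<^esub>"
  using Q_cl_map_hom by (auto simp: ring_hom_def)

text \<open>Maps into \<open>Q\<close> are reduced to maps into \<open>R\<close>: \<open>f0\<close>
  is \<open>F\<close> on the part \<open>D0\<close> where its values are integral. Each
  \<open>d\<close> has a multiple \<open>s d\<close> in \<open>D0\<close> with \<open>s\<close>
  cancellable, so \<open>f0\<close> still determines \<open>F\<close>.\<close>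

lemma integral_part:
  assumes D: "ideal D R" and F: "F \<in> module_hom R (ideal_module R D) Q_mod"
  defines "D0 \<equiv> {d \<in> D. F d \<in> \<iota> ` carrier R}"
  defines "f0 \<equiv> (\<lambda>d\<in>D0. inv_into (carrier R) \<iota> (F d))"
  shows "ideal D0 R" "f0 \<in> module_hom R (ideal_module R D0) (regular_module R)"
    "d \<in> D0 \<Longrightarrow> f0 d \<in> carrier R \<and> \<iota> (f0 d) = F d" "d \<in> D \<Longrightarrow> \<exists>s\<in>nzd. s \<otimes> d \<in> D0"
proof -
  interpret Q: cring Q by (rule cring_Q_cl)
  note DD = ideal_mem[OF D] and DR = ideal_subsetD[OF D]
  note Fs = module_homD[OF F, simplified]
  have D0I: "d \<in> D0" if "d \<in> D" "c \<in> carrier R" "F d = \<iota> c" for d c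
    using that by (auto simp: D0_def)
  have D0E: "\<exists>c\<in>carrier R. F d = \<iota> c" "d \<in> D" if "d \<in> D0" for d
    using that by (auto simp: D0_def)
  have f0_eq: "f0 d = c" if "d \<in> D" "c \<in> carrier R" "F d = \<iota> c" for d c
  proof -
    have "f0 d = inv_into (carrier R) \<iota> (\<iota> c)"
      using D0I[OF that] by (simp add: f0_def that(3))
    then show ?thesis using that(2) by (simp add: inj_on_Q_cl_map)
  qed
  show f0: "f0 d \<in> carrier R \<and> \<iota> (f0 d) = F d" if "d \<in> D0" for d
    using D0E[OF that] f0_eq by auto
  have add: "F (x \<oplus> y) = \<iota> (f0 x \<oplus> f0 y)" if "x \<in> D0" "y \<in> D0" for x y
    using f0[OF that(1)] f0[OF that(2)] D0E(2) that by (simp add: Fs(2) Q_cl_map_simps)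
  have mult: "F (r \<otimes> x) = \<iota> (r \<otimes> f0 x)" if "r \<in> carrier R" "x \<in> D0" for r x
    using f0[OF that(2)] D0E(2) that by (simp add: Fs(3) Q_cl_map_simps)
  show "ideal D0 R"
  proof (rule ideal_if_closed)
    show "D0 \<subseteq> carrier R" using D0E(2) DR by blast
    have "F \<zero> = \<iota> \<zero>" using Fs(3)[of \<zero> \<zero>] Fs(1)[of \<zero>] DD(1)
      by (simp add: Q_cl_map_zero)
    then show "\<zero> \<in> D0" by (rule D0I[OF DD(1), rotated]) simp
    show "x \<oplus> y \<in> D0" if "x \<in> D0" "y \<in> D0" for x y
      using D0I[OF _ _ add[OF that]] that f0 D0E(2) DD(2) by simp
    show "r \<otimes> x \<in> D0" if "r \<in> carrier R" "x \<in> D0" for r x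
      using D0I[OF _ _ mult[OF that]] that f0 D0E(2) DD(3) by simp
  qed
  show "f0 \<in> module_hom R (ideal_module R D0) (regular_module R)"
  proof (rule module_homI; simp)
    show "f0 (x \<oplus> y) = f0 x \<oplus> f0 y" if "x \<in> D0" "y \<in> D0" for x y
      using f0_eq[OF _ _ add[OF that]] that f0 D0E(2) DD(2) by simp
    show "f0 (r \<otimes> x) = r \<otimes> f0 x" if "r \<in> carrier R" "x \<in> D0" for r x
      using f0_eq[OF _ _ mult[OF that]] that f0 D0E(2) DD(3) by simp
    show "f0 x \<in> carrier R" if "x \<in> D0" for x using f0[OF that] by simp
    show "f0 \<in> extensional D0" by (simp add: f0_def)
  qed
  show "\<exists>s\<in>nzd. s \<otimes> d \<in> D0" if d: "d \<in> D"
  proof -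
    obtain a s where as: "a \<in> carrier R" "s \<in> nzd" "F d = fraction R a s"
      using Q_cl_cases[OF Fs(1)[OF d]] by blast
    have "F (s \<otimes> d) = \<iota> a" using as d by (simp add: Fs(3) Q_cl_map_denominator)
    then have "s \<otimes> d \<in> D0" by (rule D0I[rotated 2]) (use as d DD(3) in simp_all)
    then show ?thesis using as(2) by blast
  qed
qed

text \<open>The difference \<open>p - q\<close> is killed by \<open>D\<close>, hence so is its
  numerator, which is then zero by density.\<close>

lemma dense_ideal_cancel:
  assumes D: "dense_ideal R D" and q: "p \<in> carrier Q" "q \<in> carrier Q"
    and eq: "\<And>d. d \<in> D \<Longrightarrow> \<iota> d \<otimes>\<^bsub>Q\<^esub> p = \<iota> d \<otimes>\<^bsub>Q\<^esub> q"
  shows "p = q"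
proof -
  interpret Q: cring Q by (rule cring_Q_cl)
  have DR: "d \<in> carrier R" if "d \<in> D" for d using D that ideal_subsetD by (auto simp: dense_ideal_def)
  have pq: "p \<ominus>\<^bsub>Q\<^esub> q \<in> carrier Q" using q by simp
  obtain b s where bs: "b \<in> carrier R" "s \<in> nzd" "p \<ominus>\<^bsub>Q\<^esub> q = fraction R b s" using pq by (rule Q_cl_cases)
  have "b \<otimes> d = \<zero>" if "d \<in> D" for d
  proof -
    have "fraction R (d \<otimes> b) s = \<iota> d \<otimes>\<^bsub>Q\<^esub> (p \<ominus>\<^bsub>Q\<^esub> q)"
      using bs that DR by (simp add: Q_cl_map_mult_fraction)
    also have "\<dots> = \<iota> d \<otimes>\<^bsub>Q\<^esub> p \<ominus>\<^bsub>Q\<^esub> \<iota> d \<otimes>\<^bsub>Q\<^esub> q"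
      using q DR[OF that] by (simp add: Q.minus_eq Q.r_distr Q.r_minus)
    also have "\<dots> = \<zero>\<^bsub>Q\<^esub>"
      unfolding eq[OF that] using q DR[OF that] by simp
    finally show ?thesis
      using bs that DR by (simp add: Q_cl_zero fraction_eq_iff m_comm)
  qed
  then have "b = \<zero>"
    using D bs(1) by (auto simp: dense_ideal_def annihilator_def)
  then have "p \<ominus>\<^bsub>Q\<^esub> q = \<zero>\<^bsub>Q\<^esub>"
    using bs by (simp add: Q_cl_zero fraction_eq_iff)
  then show ?thesis using q by simp
qed

lemma dense_idealI:
  assumes "ideal D R" "\<And>x. x \<in> carrier R \<Longrightarrow> (\<And>d. d \<in> D \<Longrightarrow> x \<otimes> d = \<zero>) \<Longrightarrow> x = \<zero>"
  shows "dense_ideal R D"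
  using assms ideal_subsetD[OF assms(1)] by (auto simp: dense_ideal_def annihilator_def)

lemma dense_idealD:
  assumes "dense_ideal R D"
  shows "ideal D R" "x \<in> carrier R \<Longrightarrow> (\<And>d. d \<in> D \<Longrightarrow> x \<otimes> d = \<zero>) \<Longrightarrow> x = \<zero>"
  using assms by (auto simp: dense_ideal_def annihilator_def)

lemma dense_ideal_carrier: "dense_ideal R (carrier R)"
proof (rule dense_idealI)
  show "ideal (carrier R) R" by (rule oneideal)
  show "x = \<zero>" if "x \<in> carrier R" "\<And>d. d \<in> carrier R \<Longrightarrow> x \<otimes> d = \<zero>" for x
    using that(2)[of \<one>] that(1) by simp
qed

text \<open>Both the intersection and the preimage of dense ideals contain the products \<open>d \<otimes> e\<close>.\<close>

lemma dense_idealI_mult: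
  assumes F: "ideal F R" and D: "dense_ideal R D" and E: "dense_ideal R E"
    and mult: "\<And>d e. d \<in> D \<Longrightarrow> e \<in> E \<Longrightarrow> d \<otimes> e \<in> F"
  shows "dense_ideal R F"
proof (rule dense_idealI[OF F])
  fix x assume x: "x \<in> carrier R" "\<And>d. d \<in> F \<Longrightarrow> x \<otimes> d = \<zero>"
  note DR = ideal_subsetD[OF dense_idealD(1)[OF D]] and ER = ideal_subsetD[OF dense_idealD(1)[OF E]]
  show "x = \<zero>"
  proof (rule dense_idealD(2)[OF D x(1)])
    fix d assume d: "d \<in> D"
    show "x \<otimes> d = \<zero>"
    proof (rule dense_idealD(2)[OF E])
      show "x \<otimes> d \<in> carrier R" using x(1) DR[OF d] by simp
      show "x \<otimes> d \<otimes> e = \<zero>" if "e \<in> E" for e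
        using x(2)[OF mult[OF d that]] x(1) DR[OF d] ER[OF that] by (simp add: m_assoc)
    qed
  qed
qed

end

section \<open>Rings in which every linear map on an ideal is a fraction\<close>

text \<open>\<open>hom_fraction\<close> says that linear maps on ideals are multiplications by
  elements of \<open>Q\<close>; \<open>reduced\<close> makes the map
  \<open>r a\<^sup>2 \<mapsto> r a\<close> well defined. The algebraic arguments use nothing else
  about \<open>C\<^sup>k\<close>.\<close>

locale fractional_homs = cring R for R (structure) +
  assumes hom_fraction: "ideal D R \<Longrightarrow> f \<in> module_hom R (ideal_module R D) (regular_module R) \<Longrightarrow>
      \<exists>v\<in>non_zero_divisors R. \<exists>a\<in>carrier R. \<forall>d\<in>D. v \<otimes> f d = a \<otimes> d"
    and reduced: "x \<in> carrier R \<Longrightarrow> x \<otimes> x = \<zero> \<Longrightarrow> x = \<zero>"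
begin

text \<open>On the integral part, \<open>F\<close> is multiplication by some \<open>a / v\<close>.
  For any \<open>d\<close> choose \<open>s\<close> with \<open>s d\<close> in that part; the
  equation for \<open>s d\<close>, multiplied by \<open>v\<close>, can be divided by
  \<open>v s\<close>.\<close>

lemma baer_Q_mod: "baer R Q_mod"
  unfolding baer_def
proof (intro allI impI ballI)
  fix D F assume D: "ideal D R" and F: "F \<in> module_hom R (ideal_module R D) Q_mod"
  interpret Q: cring Q by (rule cring_Q_cl)
  note DR = ideal_subsetD[OF D]
  note Fs = module_homD[OF F, simplified]
  define D0 where "D0 = {d \<in> D. F d \<in> \<iota> ` carrier R}"
  define f0 where "f0 = (\<lambda>d\<in>D0. inv_into (carrier R) \<iota> (F d))"
  note ip = integral_part[OF D F, folded D0_def, folded f0_def]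
  obtain v a where va: "v \<in> nzd" "a \<in> carrier R" "\<And>d. d \<in> D0 \<Longrightarrow> v \<otimes> f0 d = a \<otimes> d"
    using hom_fraction[OF ip(1,2)] by blast
  have "F d = \<iota> d \<otimes>\<^bsub>Q\<^esub> fraction R a v" if d: "d \<in> D" for d
  proof -
    obtain s where s: "s \<in> nzd" "s \<otimes> d \<in> D0" using ip(4)[OF d] by blast
    have "\<iota> (v \<otimes> s) \<otimes>\<^bsub>Q\<^esub> F d = \<iota> v \<otimes>\<^bsub>Q\<^esub> F (s \<otimes> d)"
      using va s d Fs(1)[OF d] by (simp add: Fs(3) Q_cl_map_simps Q.m_assoc)
    also have "\<dots> = \<iota> (v \<otimes> f0 (s \<otimes> d))"
      using ip(3)[OF s(2)] va by (simp add: Q_cl_map_simps)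
    also have "\<dots> = \<iota> (a \<otimes> (s \<otimes> d))" by (simp only: va(3)[OF s(2)])
    also have "\<dots> = \<iota> (s \<otimes> d) \<otimes>\<^bsub>Q\<^esub> \<iota> a"
      using va s(1) DR[OF d] by (simp add: Q_cl_map_simps Q.m_comm)
    also have "\<dots> = \<iota> (s \<otimes> d) \<otimes>\<^bsub>Q\<^esub> (\<iota> v \<otimes>\<^bsub>Q\<^esub> fraction R a v)"
      using va by (simp add: Q_cl_map_denominator)
    also have "\<dots> = \<iota> (v \<otimes> s) \<otimes>\<^bsub>Q\<^esub> (\<iota> d \<otimes>\<^bsub>Q\<^esub> fraction R a v)"
      using va s(1) DR[OF d] by (simp add: Q_cl_map_simps Q.m_ac)
    finally show ?thesis
      using va s(1) d DR[OF d] Fs(1)[OF d] by (subst (asm) Q_cl_cancel) auto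
  qed
  then show "\<exists>e\<in>carrier Q_mod. \<forall>d\<in>D. F d = d \<odot>\<^bsub>Q_mod\<^esub> e"
    using va(1,2) by (intro bexI[of _ "fraction R a v"]) simp_all
qed

text \<open>Contract the ideal of \<open>Q\<close> to \<open>R\<close> and apply the criterion over
  \<open>R\<close>. The contraction determines the map, since \<open>s x\<close> is integral when
  \<open>s\<close> is a denominator of \<open>x\<close>, and \<open>s\<close> is
  cancellable.\<close>

lemma baer_Q_cl: "baer Q (regular_module Q)"
  unfolding baer_def
proof (intro allI impI ballI)
  fix I f assume I: "ideal I Q" and f: "f \<in> module_hom Q (ideal_module Q I) (regular_module Q)"
  interpret Q: cring Q by (rule cring_Q_cl)
  note fs = module_homD[OF f, simplified] and Is = Q.ideal_mem[OF I] and IQ = ideal_subsetD[OF I]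
  define D where "D = {d \<in> carrier R. \<iota> d \<in> I}"
  have D: "ideal D R"
  proof (rule ideal_if_closed)
    show "\<zero> \<in> D" using Is(1) by (simp add: D_def Q_cl_map_zero)
    show "x \<oplus> y \<in> D" if "x \<in> D" "y \<in> D" for x y using that Is(2) by (simp add: D_def Q_cl_map_simps)
    show "r \<otimes> x \<in> D" if "r \<in> carrier R" "x \<in> D" for r x using that Is(3) by (simp add: D_def Q_cl_map_simps)
  qed (auto simp: D_def)
  have "(\<lambda>d\<in>D. f (\<iota> d)) \<in> module_hom R (ideal_module R D) Q_mod"
  proof (rule module_homI; simp add: ideal_mem[OF D])
    show "f (\<iota> x) \<in> carrier Q" if "x \<in> D" for x using that fs(1) by (simp add: D_def)
    show "f (\<iota> (x \<oplus> y)) = f (\<iota> x) \<oplus>\<^bsub>Q\<^esub> f (\<iota> y)" if "x \<in> D" "y \<in> D" for x y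
      using that fs(2) by (simp add: D_def Q_cl_map_simps)
    show "f (\<iota> (r \<otimes> x)) = \<iota> r \<otimes>\<^bsub>Q\<^esub> f (\<iota> x)" if "r \<in> carrier R" "x \<in> D" for r x
      using that fs(3) by (simp add: D_def Q_cl_map_simps)
  qed
  from baer_Q_mod[unfolded baer_def, rule_format, OF D this]
  obtain e where e: "e \<in> carrier Q" "\<And>d. d \<in> D \<Longrightarrow> f (\<iota> d) = \<iota> d \<otimes>\<^bsub>Q\<^esub> e" by auto
  have "f x = x \<otimes>\<^bsub>Q\<^esub> e" if x: "x \<in> I" for x
  proof -
    obtain a s where as: "a \<in> carrier R" "s \<in> nzd" "x = fraction R a s"
      using IQ[OF x] by (rule Q_cl_cases)
    have sx: "\<iota> s \<otimes>\<^bsub>Q\<^esub> x = \<iota> a" using as by (simp add: Q_cl_map_denominator)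
    have "\<iota> a \<in> I" using Is(3)[of "\<iota> s" x] x as(2) sx by simp
    then have "a \<in> D" using as by (simp add: D_def)
    have "\<iota> s \<otimes>\<^bsub>Q\<^esub> f x = f (\<iota> a)" using fs(3)[of "\<iota> s" x] x as(2) sx by simp
    also have "\<dots> = \<iota> a \<otimes>\<^bsub>Q\<^esub> e" by (rule e(2)[OF \<open>a \<in> D\<close>])
    also have "\<dots> = \<iota> s \<otimes>\<^bsub>Q\<^esub> (x \<otimes>\<^bsub>Q\<^esub> e)" using as(2) IQ[OF x] e(1) by (simp flip: sx add: Q.m_assoc)
    finally show ?thesis
      using as(2) fs(1)[OF x] IQ[OF x] e(1) by (subst (asm) Q_cl_cancel) auto
  qed
  then show "\<exists>e\<in>carrier (regular_module Q). \<forall>d\<in>I. f d = d \<odot>\<^bsub>regular_module Q\<^esub> e"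
    using e(1) by (intro bexI[of _ e]) simp_all
qed

lemma self_injective_Q_cl: "self_injective TYPE('m) Q"
  unfolding self_injective_def
  by (intro baer_imp_injective_module module_regular_module cring_Q_cl baer_Q_cl)

text \<open>The linear map \<open>r a\<^sup>2 \<mapsto> r a\<close> is a fraction, which makes \<open>a\<close> a multiple of \<open>a\<^sup>2\<close> in \<open>Q\<close>.\<close>

lemma ex_square_divides:
  assumes a: "a \<in> carrier R"
  shows "\<exists>v\<in>nzd. \<exists>b\<in>carrier R. v \<otimes> a = b \<otimes> (a \<otimes> a)"
proof -
  define D where "D = {r \<otimes> (a \<otimes> a) | r. r \<in> carrier R}"
  define f where "f = (\<lambda>d\<in>D. THE c. \<exists>r\<in>carrier R. c = r \<otimes> a \<and> d = r \<otimes> (a \<otimes> a))"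
  have DI: "r \<otimes> (a \<otimes> a) \<in> D" if "r \<in> carrier R" for r using that by (auto simp: D_def)
  have DE: "\<exists>r\<in>carrier R. x = r \<otimes> (a \<otimes> a)" if "x \<in> D" for x using that by (auto simp: D_def)
  have uniq: "r \<otimes> a = r' \<otimes> a" if "r \<in> carrier R" "r' \<in> carrier R" "r \<otimes> (a \<otimes> a) = r' \<otimes> (a \<otimes> a)" for r r'
  proof -
    define x where "x = r \<ominus> r'"
    have x: "x \<in> carrier R" using that by (simp add: x_def)
    have "x \<otimes> (a \<otimes> a) = r \<otimes> (a \<otimes> a) \<ominus> r' \<otimes> (a \<otimes> a)"
      using that(1,2) a by (simp add: x_def minus_eq l_distr l_minus)
    also have "\<dots> = \<zero>" unfolding that(3) using that a by simp
    \<comment> \<open>\<open>(x a)\<^sup>2 = x (x a\<^sup>2) = 0\<close>; this is where the ring has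
      to be reduced.\<close>
    finally have "x \<otimes> (x \<otimes> (a \<otimes> a)) = \<zero>" using x by simp
    then have "(x \<otimes> a) \<otimes> (x \<otimes> a) = \<zero>" using x a by (simp add: m_ac)
    then have "x \<otimes> a = \<zero>" using reduced[of "x \<otimes> a"] x a by simp
    then have "r \<otimes> a \<ominus> r' \<otimes> a = \<zero>" using that(1,2) a by (simp add: x_def minus_eq l_distr l_minus)
    then show ?thesis using that(1,2) a by simp
  qed
  have f_eq: "f (r \<otimes> (a \<otimes> a)) = r \<otimes> a" if "r \<in> carrier R" for r
  proof -
    have "(THE c. \<exists>r'\<in>carrier R. c = r' \<otimes> a \<and> r \<otimes> (a \<otimes> a) = r' \<otimes> (a \<otimes> a)) = r \<otimes> a"
    proof (rule the_equality)
      show "\<exists>r'\<in>carrier R. r \<otimes> a = r' \<otimes> a \<and> r \<otimes> (a \<otimes> a) = r' \<otimes> (a \<otimes> a)"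
        by (rule bexI[OF _ that]) simp
      fix c assume "\<exists>r'\<in>carrier R. c = r' \<otimes> a \<and> r \<otimes> (a \<otimes> a) = r' \<otimes> (a \<otimes> a)"
      then obtain r' where r': "r' \<in> carrier R" "c = r' \<otimes> a" "r \<otimes> (a \<otimes> a) = r' \<otimes> (a \<otimes> a)"
        by (elim bexE conjE)
      then show "c = r \<otimes> a" using uniq[OF that r'(1,3)] by simp
    qed
    then show ?thesis using DI[OF that] by (simp add: f_def)
  qed
  have "ideal D R"
  proof (rule ideal_if_closed)
    show "D \<subseteq> carrier R" using a by (auto dest!: DE)
    show "\<zero> \<in> D" using DI[of \<zero>] a by simp
    show "x \<oplus> y \<in> D" if xy: "x \<in> D" "y \<in> D" for x y
    proof -
      obtain r s where "r \<in> carrier R" "s \<in> carrier R" "x = r \<otimes> (a \<otimes> a)" "y = s \<otimes> (a \<otimes> a)"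
        using DE[OF xy(1)] DE[OF xy(2)] by (elim bexE)
      then show ?thesis using DI[of "r \<oplus> s"] a by (simp add: l_distr)
    qed
    show "s \<otimes> x \<in> D" if sx: "s \<in> carrier R" "x \<in> D" for s x
    proof -
      obtain r where "r \<in> carrier R" "x = r \<otimes> (a \<otimes> a)"
        using DE[OF sx(2)] by (rule bexE)
      then show ?thesis using DI[of "s \<otimes> r"] a sx(1) by (simp add: m_assoc)
    qed
  qed
  moreover have "f \<in> module_hom R (ideal_module R D) (regular_module R)"
  proof (rule module_homI; simp)
    show "f x \<in> carrier R" if "x \<in> D" for x using DE[OF that] f_eq a by auto
    show "f (x \<oplus> y) = f x \<oplus> f y" if xy: "x \<in> D" "y \<in> D" for x y
    proof -
      obtain r s where rs: "r \<in> carrier R" "s \<in> carrier R" "x = r \<otimes> (a \<otimes> a)" "y = s \<otimes> (a \<otimes> a)"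
        using DE[OF xy(1)] DE[OF xy(2)] by (elim bexE)
      then have "f (x \<oplus> y) = f ((r \<oplus> s) \<otimes> (a \<otimes> a))" using a by (simp add: l_distr)
      also have "\<dots> = r \<otimes> a \<oplus> s \<otimes> a" using f_eq[of "r \<oplus> s"] rs(1,2) a by (simp add: l_distr)
      finally show ?thesis using rs f_eq by simp
    qed
    show "f (s \<otimes> x) = s \<otimes> f x" if sx: "s \<in> carrier R" "x \<in> D" for s x
    proof -
      obtain r where r: "r \<in> carrier R" "x = r \<otimes> (a \<otimes> a)"
        using DE[OF sx(2)] by (rule bexE)
      then have "f (s \<otimes> x) = f ((s \<otimes> r) \<otimes> (a \<otimes> a))" using a sx(1) by (simp add: m_assoc)
      also have "\<dots> = s \<otimes> (r \<otimes> a)" using f_eq[of "s \<otimes> r"] r(1) sx(1) a by (simp add: m_assoc)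
      finally show ?thesis using r f_eq by simp
    qed
  qed (simp add: f_def)
  ultimately have "\<exists>v\<in>nzd. \<exists>b\<in>carrier R. \<forall>d\<in>D. v \<otimes> f d = b \<otimes> d" by (rule hom_fraction)
  then obtain v b where vb: "v \<in> nzd" "b \<in> carrier R" "\<forall>d\<in>D. v \<otimes> f d = b \<otimes> d" by (elim bexE)
  have "v \<otimes> a = b \<otimes> (a \<otimes> a)"
    using vb(3)[rule_format, OF DI[of \<one>]] f_eq[of \<one>] a by simp
  then show ?thesis using vb(1,2) by blast
qed

text \<open>From \<open>v a = b a\<^sup>2\<close>, the fraction \<open>b / v\<close> is a
  quasi-inverse of \<open>a\<close>, and multiplying it by \<open>s\<close> gives one of
  \<open>a / s\<close>.\<close>

lemma von_neumann_regular_Q_cl: "von_neumann_regular Q"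
  unfolding von_neumann_regular_def
proof (intro conjI ballI)
  show "ring Q" by (rule cring.axioms(1)[OF cring_Q_cl])
  fix q assume "q \<in> carrier Q"
  then obtain a s where as: "a \<in> carrier R" "s \<in> nzd" "q = fraction R a s" by (rule Q_cl_cases)
  obtain v b where vb: "v \<in> nzd" "b \<in> carrier R" "v \<otimes> a = b \<otimes> (a \<otimes> a)"
    using ex_square_divides[OF as(1)] by blast
  have "a \<otimes> (b \<otimes> s) \<otimes> a \<otimes> s = b \<otimes> (a \<otimes> a) \<otimes> (s \<otimes> s)"
    using as(1,2) vb(1,2) by (simp add: m_ac)
  also have "\<dots> = a \<otimes> (s \<otimes> v \<otimes> s)"
    unfolding vb(3)[symmetric] using as(1,2) vb(1,2) by (simp add: m_ac)
  finally have "q \<otimes>\<^bsub>Q\<^esub> fraction R (b \<otimes> s) v \<otimes>\<^bsub>Q\<^esub> q = q"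
    using as vb(1,2) by (simp add: fraction_mult fraction_eq_iff)
  then show "\<exists>y\<in>carrier Q. q \<otimes>\<^bsub>Q\<^esub> y \<otimes>\<^bsub>Q\<^esub> q = q"
    using as(2) vb(1,2) by (intro bexI[of _ "fraction R (b \<otimes> s) v"]) simp_all
qed

end

section \<open>Elements of \<open>Q\<close> as germs of partial homomorphisms\<close>

context cring
begin

text \<open>The dictionary between the two rings: a partial homomorphism corresponds to the fraction
  by which it multiplies.\<close>

definition represents :: "'a set \<times> ('a \<Rightarrow> 'a) \<Rightarrow> ('a \<times> 'a) set \<Rightarrow> bool" where
  "represents p q \<longleftrightarrow> p \<in> partial_homs R \<and> q \<in> carrier Q \<and>
     (\<forall>d\<in>fst p. \<iota> (snd p d) = \<iota> d \<otimes>\<^bsub>Q\<^esub> q)"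

lemma partial_homsD:
  assumes "(D, f) \<in> partial_homs R"
  shows "dense_ideal R D" "f \<in> module_hom R (ideal_module R D) (regular_module R)"
  using assms by (auto simp: partial_homs_def)

text \<open>Linearity of \<open>f\<close> comes for free, because multiplication by \<open>q\<close>
  is linear and \<open>\<iota>\<close> is injective.\<close>

lemma representsI:
  assumes D: "dense_ideal R D" and q: "q \<in> carrier Q" and ext: "f \<in> extensional D"
    and f: "\<And>d. d \<in> D \<Longrightarrow> f d \<in> carrier R \<and> \<iota> (f d) = \<iota> d \<otimes>\<^bsub>Q\<^esub> q"
  shows "represents (D, f) q"
proof -
  interpret Q: cring Q by (rule cring_Q_cl)
  note DI = dense_idealD(1)[OF D]
  note DR = ideal_subsetD[OF DI]
  have "f \<in> module_hom R (ideal_module R D) (regular_module R)"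
  proof (rule module_homI; simp)
    show "f d \<in> carrier R" if "d \<in> D" for d using f[OF that] by simp
    show "f (x \<oplus> y) = f x \<oplus> f y" if "x \<in> D" "y \<in> D" for x y
    proof -
      note xy = ideal_mem(2)[OF DI that]
      have "\<iota> (f (x \<oplus> y)) = \<iota> (f x \<oplus> f y)"
        using f[OF xy] f[OF that(1)] f[OF that(2)] DR[OF that(1)] DR[OF that(2)] q
        by (simp add: Q_cl_map_simps Q.l_distr)
      then show ?thesis
        using conjunct1[OF f[OF xy]] conjunct1[OF f[OF that(1)]] conjunct1[OF f[OF that(2)]]
        by (subst (asm) Q_cl_map_eq_iff) simp_all
    qed
    show "f (r \<otimes> x) = r \<otimes> f x" if "r \<in> carrier R" "x \<in> D" for r x
    proof -
      note rx = ideal_mem(3)[OF DI that]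
      have "\<iota> (f (r \<otimes> x)) = \<iota> (r \<otimes> f x)"
        using f[OF rx] f[OF that(2)] DR[OF that(2)] that(1) q
        by (simp add: Q_cl_map_simps Q.m_assoc)
      then show ?thesis using conjunct1[OF f[OF rx]] conjunct1[OF f[OF that(2)]] that(1)
        by (subst (asm) Q_cl_map_eq_iff) simp_all
    qed
  qed (rule ext)
  then show ?thesis using D q f by (simp add: represents_def partial_homs_def)
qed

lemma representsD:
  assumes "represents (D, f) q"
  shows "dense_ideal R D" "ideal D R" "q \<in> carrier Q"
    "d \<in> D \<Longrightarrow> d \<in> carrier R" "d \<in> D \<Longrightarrow> f d \<in> carrier R" "d \<in> D \<Longrightarrow> \<iota> (f d) = \<iota> d \<otimes>\<^bsub>Q\<^esub> q"
    "r \<in> carrier R \<Longrightarrow> d \<in> D \<Longrightarrow> f (r \<otimes> d) = r \<otimes> f d" "(D, f) \<in> partial_homs R"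
proof -
  have p: "(D, f) \<in> partial_homs R" using assms by (simp add: represents_def)
  note P = partial_homsD[OF p] and f = module_homD[OF partial_homsD(2)[OF p], simplified]
  show "dense_ideal R D" "ideal D R" "q \<in> carrier Q"
    "d \<in> D \<Longrightarrow> d \<in> carrier R" "d \<in> D \<Longrightarrow> f d \<in> carrier R" "d \<in> D \<Longrightarrow> \<iota> (f d) = \<iota> d \<otimes>\<^bsub>Q\<^esub> q"
    "r \<in> carrier R \<Longrightarrow> d \<in> D \<Longrightarrow> f (r \<otimes> d) = r \<otimes> f d" "(D, f) \<in> partial_homs R"
    using P(1) dense_idealD(1)[OF P(1)] assms f(1,3) p ideal_subsetD[OF dense_idealD(1)[OF P(1)]]
    by (simp_all add: represents_def)
qed

lemma represents_unique:
  assumes "represents (D, f) p" "represents (D, f) q"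
  shows "p = q"
  by (rule dense_ideal_cancel[OF representsD(1)[OF assms(1)]])
    (use representsD(3,6)[OF assms(1)] representsD(3,6)[OF assms(2)] in simp_all)

lemma represents_Int_dense:
  assumes "represents (D, f) p" "represents (E, g) q"
  shows "dense_ideal R (D \<inter> E)"
proof (rule dense_idealI_mult)
  note D = representsD[OF assms(1)] and E = representsD[OF assms(2)]
  show "ideal (D \<inter> E) R"
    using ideal_mem[OF D(2)] ideal_mem[OF E(2)] D(4) by (intro ideal_if_closed) auto
  show "d \<otimes> e \<in> D \<inter> E" if "d \<in> D" "e \<in> E" for d e
    using ideal_mem(3)[OF D(2) E(4)[OF that(2)] that(1)] ideal_mem(3)[OF E(2) D(4)[OF that(1)] that(2)]
      m_comm[OF D(4)[OF that(1)] E(4)[OF that(2)]]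
    by simp
qed (rule representsD(1)[OF assms(1)] representsD(1)[OF assms(2)])+

text \<open>From left to right, density of the common domain \<open>F\<close> makes the fractions
  equal; from right to left, \<open>f\<close> and \<open>g\<close> agree on all of
  \<open>D \<inter> E\<close>, which is dense.\<close>

lemma germ_rel_iff:
  assumes "represents (D, f) p" "represents (E, g) q"
  shows "((D, f), (E, g)) \<in> germ_rel R \<longleftrightarrow> p = q"
proof
  note D = representsD[OF assms(1)] and E = representsD[OF assms(2)]
  assume "((D, f), (E, g)) \<in> germ_rel R"
  then obtain F where F: "dense_ideal R F" "F \<subseteq> D \<inter> E" "\<forall>x\<in>F. f x = g x" by (auto simp: germ_rel_def)
  show "p = q"
  proof (rule dense_ideal_cancel[OF F(1) D(3) E(3)])
    fix d assume d: "d \<in> F"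
    then have "d \<in> D" "d \<in> E" using F(2) by blast+
    then show "\<iota> d \<otimes>\<^bsub>Q\<^esub> p = \<iota> d \<otimes>\<^bsub>Q\<^esub> q" using D(6)[of d] E(6)[of d] F(3) d by simp
  qed
next
  note D = representsD[OF assms(1)] and E = representsD[OF assms(2)]
  assume "p = q"
  have "f x = g x" if "x \<in> D \<inter> E" for x
    using that D(5,6)[of x] E(5,6)[of x] \<open>p = q\<close> Q_cl_map_eq_iff[of "f x" "g x"] by simp
  then show "((D, f), (E, g)) \<in> germ_rel R"
    using D(8) E(8) represents_Int_dense[OF assms] by (auto simp: germ_rel_def)
qed

text \<open>The natural domain is the ideal of all \<open>d\<close> with \<open>d q\<close> in
  \<open>R\<close>. It contains a denominator of \<open>q\<close>, a non-zero-divisor, and is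
  therefore dense.\<close>

lemma represents_ex_partial_hom:
  assumes q: "q \<in> carrier Q"
  shows "\<exists>D f. represents (D, f) q"
proof -
  interpret Q: cring Q by (rule cring_Q_cl)
  define F where "F = (\<lambda>d\<in>carrier R. \<iota> d \<otimes>\<^bsub>Q\<^esub> q)"
  have F: "F \<in> module_hom R (ideal_module R (carrier R)) Q_mod"
    using q by (intro module_homI) (simp_all add: F_def Q_cl_map_simps Q.l_distr Q.m_assoc)
  define D where "D = {d \<in> carrier R. F d \<in> \<iota> ` carrier R}"
  define f where "f = (\<lambda>d\<in>D. inv_into (carrier R) \<iota> (F d))"
  note ip = integral_part[OF oneideal F, folded D_def, folded f_def]
  have DR: "d \<in> carrier R" if "d \<in> D" for d using that by (simp add: D_def)
  have "represents (D, f) q"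
  proof (rule representsI)
    show "dense_ideal R D"
    proof (rule dense_idealI[OF ip(1)])
      fix x assume x: "x \<in> carrier R" "\<And>d. d \<in> D \<Longrightarrow> x \<otimes> d = \<zero>"
      obtain s where "s \<in> nzd" "s \<otimes> \<one> \<in> D" using ip(4)[OF one_closed] by (rule bexE)
      then show "x = \<zero>" using nzd_zero[of s x] x(1) x(2)[of s] by (simp add: m_comm)
    qed
    show "f d \<in> carrier R \<and> \<iota> (f d) = \<iota> d \<otimes>\<^bsub>Q\<^esub> q" if "d \<in> D" for d
      using ip(3)[OF that] DR[OF that] by (simp add: F_def)
  qed (simp_all add: q f_def)
  then show ?thesis by blast
qed

text \<open>The element of the complete ring that corresponds to \<open>q\<close>, described without
  choosing a representative; under \<open>fractional_homs\<close> it is the germ of each of its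
  members.\<close>

definition germ_class :: "('a \<times> 'a) set \<Rightarrow> ('a set \<times> ('a \<Rightarrow> 'a)) set" where
  "germ_class q = {p. represents p q}"

lemma mem_germ_class: "p \<in> germ_class q \<longleftrightarrow> represents p q"
  by (simp add: germ_class_def)

lemma UN_germ_class:
  assumes q: "q \<in> carrier Q" and F: "\<And>D f. represents (D, f) q \<Longrightarrow> F D f = C"
  shows "(\<Union>(D, f)\<in>germ_class q. F D f) = C"
proof -
  obtain D f where "represents (D, f) q" using represents_ex_partial_hom[OF q] by (elim exE)
  then have "(D, f) \<in> germ_class q" by (simp add: mem_germ_class)
  moreover have "\<forall>p\<in>germ_class q. case_prod F p = C"
    using F by (auto simp: mem_germ_class)
  ultimately show ?thesis by (rule UN_constant_eq)
qed

lemma represents_add: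
  assumes "represents (D, f) p" "represents (E, g) q"
  shows "represents (D \<inter> E, \<lambda>x\<in>D \<inter> E. f x \<oplus> g x) (p \<oplus>\<^bsub>Q\<^esub> q)"
proof (rule representsI[OF represents_Int_dense[OF assms]])
  interpret Q: cring Q by (rule cring_Q_cl)
  note D = representsD[OF assms(1)] and E = representsD[OF assms(2)]
  show "p \<oplus>\<^bsub>Q\<^esub> q \<in> carrier Q" using D(3) E(3) by simp
  fix d assume "d \<in> D \<inter> E"
  then show "(\<lambda>x\<in>D \<inter> E. f x \<oplus> g x) d \<in> carrier R \<and> \<iota> ((\<lambda>x\<in>D \<inter> E. f x \<oplus> g x) d) = \<iota> d \<otimes>\<^bsub>Q\<^esub> (p \<oplus>\<^bsub>Q\<^esub> q)"
    using D(3) E(3) D(4-6)[of d] E(4-6)[of d] by (simp add: Q_cl_map_simps Q.r_distr)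
qed simp

lemma represents_mult:
  assumes "represents (D, f) p" "represents (E, g) q"
  defines "F \<equiv> {x \<in> E. g x \<in> D}"
  shows "represents (F, \<lambda>x\<in>F. f (g x)) (p \<otimes>\<^bsub>Q\<^esub> q)"
proof (rule representsI)
  interpret Q: cring Q by (rule cring_Q_cl)
  note D = representsD[OF assms(1)] and E = representsD[OF assms(2)]
  note g = module_homD[OF partial_homsD(2)[OF E(8)], simplified]
  note DI = ideal_mem[OF D(2)] and EI = ideal_mem[OF E(2)]
  show "dense_ideal R F"
  proof (rule dense_idealI_mult[OF _ D(1) E(1)])
    show "ideal F R"
    proof (rule ideal_if_closed)
      show "F \<subseteq> carrier R" using E(4) by (auto simp: F_def)
      have "g \<zero> = \<zero>" using g(3)[of \<zero> \<zero>] g(1)[OF EI(1)] EI(1) by simp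
      then show "\<zero> \<in> F" using EI(1) DI(1) by (simp add: F_def)
      show "x \<oplus> y \<in> F" if "x \<in> F" "y \<in> F" for x y
        using that EI(2) DI(2) g(2) by (simp add: F_def)
      show "r \<otimes> x \<in> F" if "r \<in> carrier R" "x \<in> F" for r x
        using that EI(3) DI(3) g(3) by (simp add: F_def)
    qed
    show "d \<otimes> e \<in> F" if "d \<in> D" "e \<in> E" for d e
    proof -
      \<comment> \<open>\<open>g (d e) = d g(e)\<close> lies in \<open>D\<close> because
        \<open>D\<close> is an ideal.\<close>
      have "d \<otimes> g e \<in> D"
        using DI(3)[OF g(1)[OF that(2)] that(1)] m_comm[OF D(4)[OF that(1)] g(1)[OF that(2)]] by simp
      then show ?thesis using EI(3)[OF D(4)[OF that(1)] that(2)] g(3)[OF D(4)[OF that(1)] that(2)] by (simp add: F_def)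
    qed
  qed
  show "p \<otimes>\<^bsub>Q\<^esub> q \<in> carrier Q" using D(3) E(3) by simp
  fix d assume d: "d \<in> F"
  then have "d \<in> E" "g d \<in> D" by (simp_all add: F_def)
  then show "(\<lambda>x\<in>F. f (g x)) d \<in> carrier R \<and> \<iota> ((\<lambda>x\<in>F. f (g x)) d) = \<iota> d \<otimes>\<^bsub>Q\<^esub> (p \<otimes>\<^bsub>Q\<^esub> q)"
    using d D(3) E(3) D(5,6)[of "g d"] E(4,6)[of d] by (simp add: Q.m_assoc Q.m_comm[of q p])
qed simp

lemma represents_Q_cl_map:
  assumes "a \<in> carrier R"
  shows "represents (carrier R, \<lambda>x\<in>carrier R. a \<otimes> x) (\<iota> a)"
proof (rule representsI[OF dense_ideal_carrier])
  interpret Q: cring Q by (rule cring_Q_cl)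
  show "(\<lambda>x\<in>carrier R. a \<otimes> x) d \<in> carrier R \<and> \<iota> ((\<lambda>x\<in>carrier R. a \<otimes> x) d) = \<iota> d \<otimes>\<^bsub>Q\<^esub> \<iota> a"
    if "d \<in> carrier R" for d
    using assms that by (simp add: Q_cl_map_simps Q.m_comm)
qed (use assms in simp_all)

end

context fractional_homs
begin

text \<open>This is where \<open>hom_fraction\<close> enters: it makes the map from \<open>Q\<close>
  to the complete ring surjective.\<close>

lemma partial_hom_represents:
  assumes "(D, f) \<in> partial_homs R"
  shows "\<exists>q. represents (D, f) q"
proof -
  interpret Q: cring Q by (rule cring_Q_cl)
  note P = partial_homsD[OF assms]
  note DI = dense_idealD(1)[OF P(1)]
  note DR = ideal_subsetD[OF DI]
  note f = module_homD[OF P(2), simplified]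
  obtain v a where va: "v \<in> nzd" "a \<in> carrier R" "\<forall>d\<in>D. v \<otimes> f d = a \<otimes> d"
    using hom_fraction[OF DI P(2)] by (elim bexE)
  have "represents (D, f) (fraction R a v)"
  proof (rule representsI[OF P(1) _ f(4)])
    show "fraction R a v \<in> carrier Q" using va by simp
    fix d assume d: "d \<in> D"
    have "\<iota> (f d) = fraction R (v \<otimes> f d) v"
      using va(1) f(1)[OF d] by (simp add: Q_cl_map_fraction fraction_eq_iff m_comm)
    also have "\<dots> = \<iota> d \<otimes>\<^bsub>Q\<^esub> fraction R a v"
      using va DR[OF d] d by (simp add: Q_cl_map_mult_fraction m_comm)
    finally show "f d \<in> carrier R \<and> \<iota> (f d) = \<iota> d \<otimes>\<^bsub>Q\<^esub> fraction R a v" using f(1)[OF d] by simp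
  qed
  then show ?thesis by (rule exI)
qed

text \<open>Any partial homomorphism related to \<open>(D, f)\<close> is itself given by some
  fraction, so the germ relation can be decided by comparing fractions.\<close>

lemma germ_rel_Image:
  assumes "represents (D, f) q"
  shows "germ_rel R `` {(D, f)} = germ_class q"
proof (rule Set.set_eqI)
  fix p :: "'a set \<times> ('a \<Rightarrow> 'a)"
  obtain E g where p: "p = (E, g)" by (cases p)
  show "p \<in> germ_rel R `` {(D, f)} \<longleftrightarrow> p \<in> germ_class q"
  proof (cases "(E, g) \<in> partial_homs R")
    case True
    from partial_hom_represents[OF this] obtain q' where q': "represents (E, g) q'" by (rule exE)
    have "p \<in> germ_rel R `` {(D, f)} \<longleftrightarrow> q = q'"
      unfolding p using germ_rel_iff[OF assms q'] by simp
    also have "\<dots> \<longleftrightarrow> represents (E, g) q"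
      using represents_unique[OF q'] q' by metis
    finally show ?thesis by (simp add: p mem_germ_class)
  next
    case False
    then show ?thesis by (auto simp: p mem_germ_class germ_rel_def represents_def)
  qed
qed

lemma Q_complete_simps:
  "carrier (Q_complete R) = germ_class ` carrier Q"
  "p \<in> carrier Q \<Longrightarrow> q \<in> carrier Q \<Longrightarrow>
    germ_class p \<oplus>\<^bsub>Q_complete R\<^esub> germ_class q = germ_class (p \<oplus>\<^bsub>Q\<^esub> q)"
  "p \<in> carrier Q \<Longrightarrow> q \<in> carrier Q \<Longrightarrow>
    germ_class p \<otimes>\<^bsub>Q_complete R\<^esub> germ_class q = germ_class (p \<otimes>\<^bsub>Q\<^esub> q)"
  "a \<in> carrier R \<Longrightarrow> Q_complete_map R a = germ_class (\<iota> a)"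
  "\<one>\<^bsub>Q_complete R\<^esub> = germ_class \<one>\<^bsub>Q\<^esub>" "\<zero>\<^bsub>Q_complete R\<^esub> = germ_class \<zero>\<^bsub>Q\<^esub>"
proof -
  have "X \<in> partial_homs R // germ_rel R \<longleftrightarrow> X \<in> germ_class ` carrier Q" for X
  proof
    assume "X \<in> partial_homs R // germ_rel R"
    then obtain D f where "(D, f) \<in> partial_homs R" "X = germ_rel R `` {(D, f)}" 
      by (elim quotientE) (metis prod.exhaust)
    from partial_hom_represents[OF this(1)] obtain q where q: "represents (D, f) q" by (rule exE)
    have "X = germ_class q" unfolding \<open>X = _\<close> by (rule germ_rel_Image[OF q])
    then show "X \<in> germ_class ` carrier Q" using representsD(3)[OF q] by (rule image_eqI)
  next
    assume "X \<in> germ_class ` carrier Q"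
    then obtain q where q: "q \<in> carrier Q" "X = germ_class q" by blast
    then obtain D f where Df: "represents (D, f) q" using represents_ex_partial_hom by blast
    have "X = germ_rel R `` {(D, f)}" unfolding q(2) by (rule germ_rel_Image[OF Df, symmetric])
    then show "X \<in> partial_homs R // germ_rel R"
      using quotientI[OF representsD(8)[OF Df]] by simp
  qed
  then show "carrier (Q_complete R) = germ_class ` carrier Q"
    unfolding Q_complete_def by auto
  show "germ_class p \<oplus>\<^bsub>Q_complete R\<^esub> germ_class q = germ_class (p \<oplus>\<^bsub>Q\<^esub> q)"
    if "p \<in> carrier Q" "q \<in> carrier Q"
    unfolding Q_complete_def ring.select_convs
    by (intro UN_germ_class that germ_rel_Image represents_add)
  show "germ_class p \<otimes>\<^bsub>Q_complete R\<^esub> germ_class q = germ_class (p \<otimes>\<^bsub>Q\<^esub> q)"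
    if "p \<in> carrier Q" "q \<in> carrier Q"
    unfolding Q_complete_def monoid.select_convs
    by (intro UN_germ_class that germ_rel_Image represents_mult)
  have map: "germ_rel R `` {(carrier R, \<lambda>x\<in>carrier R. a \<otimes> x)} = germ_class (\<iota> a)" if "a \<in> carrier R" for a
    by (rule germ_rel_Image[OF represents_Q_cl_map[OF that]])
  then show "a \<in> carrier R \<Longrightarrow> Q_complete_map R a = germ_class (\<iota> a)"
    by (simp add: Q_complete_map_def)
  show "\<one>\<^bsub>Q_complete R\<^esub> = germ_class \<one>\<^bsub>Q\<^esub>"
    using map[of \<one>] by (simp add: Q_complete_def Q_cl_map_simps cong: restrict_cong)
  show "\<zero>\<^bsub>Q_complete R\<^esub> = germ_class \<zero>\<^bsub>Q\<^esub>"
    using map[of \<zero>] by (simp add: Q_complete_def Q_cl_map_zero cong: restrict_cong)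
qed

lemma inj_on_germ_class: "inj_on germ_class (carrier Q)"
proof (rule inj_onI)
  fix p q assume pq: "p \<in> carrier Q" "q \<in> carrier Q" "germ_class p = germ_class q"
  obtain D f where Df: "represents (D, f) p" using represents_ex_partial_hom[OF pq(1)] by (elim exE)
  then have "(D, f) \<in> germ_class q" unfolding pq(3)[symmetric] by (simp add: mem_germ_class)
  then show "p = q" using represents_unique[OF Df] by (simp add: mem_germ_class)
qed

lemma germ_class_iso: "restrict germ_class (carrier Q) \<in> ring_iso Q (Q_complete R)"
proof -
  interpret Q: cring Q by (rule cring_Q_cl)
  show ?thesis
    using inj_on_germ_class by (intro ring_iso_memI)
      (auto simp: Q_complete_simps bij_betw_def cong: inj_on_cong image_cong_simp)
qed

lemma coincide_Q_complete: "coincide_over R Q \<iota> (Q_complete R) (Q_complete_map R)"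
  unfolding coincide_over_def
proof (intro exI conjI)
  interpret Q: cring Q by (rule cring_Q_cl)
  let ?h = "restrict germ_class (carrier Q)"
  \<comment> \<open>The ring axioms transfer along the isomorphism to the record whose zero is the
    image of zero; this is already the zero of \<open>Q_complete R\<close>.\<close>
  have "ring (Q_complete R\<lparr>ring.zero := ?h \<zero>\<^bsub>Q\<^esub>\<rparr>)"
    by (rule Q.ring_iso_imp_img_ring[OF germ_class_iso])
  moreover have "Q_complete R\<lparr>ring.zero := ?h \<zero>\<^bsub>Q\<^esub>\<rparr> = Q_complete R"
    using Q_complete_simps(6) by simp
  ultimately have ring: "ring (Q_complete R)" by simp
  show "?h \<in> ring_iso Q (Q_complete R)" by (rule germ_class_iso)
  then have hom: "?h \<in> ring_hom Q (Q_complete R)" by (simp add: ring_iso_def)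
  show "homs_over R Q \<iota> (Q_complete R) (Q_complete_map R) = {?h}"
  proof (rule Set.set_eqI, rule iffI)
    fix g assume "g \<in> homs_over R Q \<iota> (Q_complete R) (Q_complete_map R)"
    then have g: "g \<in> ring_hom Q (Q_complete R)" "g \<in> extensional (carrier Q)"
      "\<forall>r\<in>carrier R. g (\<iota> r) = Q_complete_map R r" by (auto simp: homs_over_def)
    \<comment> \<open>Uniqueness of the map over \<open>R\<close>, as \<open>\<iota>\<close> is an
      epimorphism.\<close>
    have "g q = ?h q" if "q \<in> carrier Q" for q
      by (rule ring_epi_cancel[OF ring_epi_Q_cl ring g(1) hom _ that]) (simp add: g(3) Q_complete_simps(4))
    then have "g = ?h" using g(2) by (intro extensionalityI[of _ "carrier Q"]) simp_all
    then show "g \<in> {?h}" by simp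
  next
    fix g assume "g \<in> {?h}"
    then show "g \<in> homs_over R Q \<iota> (Q_complete R) (Q_complete_map R)"
      using hom by (simp add: homs_over_def Q_complete_simps(4))
  qed
qed

end

section \<open>Tensor products\<close>

locale tensor_pair = M: Module.module R M + P: Module.module R P
  for R :: "('a, 'r) ring_scheme" and M :: "('a, 'b, 'm) module_scheme" and P :: "('a, 'c, 'n) module_scheme"
begin

abbreviation G where "G \<equiv> free_Abelian_group (carrier M \<times> carrier P)"
abbreviation H where "H \<equiv> tensor_subgroup R M P"

lemma tensor_relations_subset: "tensor_relations R M P \<subseteq> carrier G"
proof
  fix z assume "z \<in> tensor_relations R M P"
  then consider (l) x y p where "z = frag_of (x \<oplus>\<^bsub>M\<^esub> y, p) - frag_of (x, p) - frag_of (y, p)"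
      "x \<in> carrier M" "y \<in> carrier M" "p \<in> carrier P"
    | (r) x p q where "z = frag_of (x, p \<oplus>\<^bsub>P\<^esub> q) - frag_of (x, p) - frag_of (x, q)"
      "x \<in> carrier M" "p \<in> carrier P" "q \<in> carrier P"
    | (s) r x p where "z = frag_of (r \<odot>\<^bsub>M\<^esub> x, p) - frag_of (x, r \<odot>\<^bsub>P\<^esub> p)"
      "r \<in> carrier R" "x \<in> carrier M" "p \<in> carrier P"
    unfolding tensor_relations_def by blast
  then show "z \<in> carrier G"
  proof cases
    case l
    have "Poly_Mapping.keys z \<subseteq> {(x \<oplus>\<^bsub>M\<^esub> y, p), (x, p), (y, p)}"
      unfolding l(1) by (rule order_trans[OF keys_diff Un_least[OF order_trans[OF keys_diff]]]) auto
    then show ?thesis using l by auto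
  next
    case r
    have "Poly_Mapping.keys z \<subseteq> {(x, p \<oplus>\<^bsub>P\<^esub> q), (x, p), (x, q)}"
      unfolding r(1) by (rule order_trans[OF keys_diff Un_least[OF order_trans[OF keys_diff]]]) auto
    then show ?thesis using r by auto
  next
    case s
    have "Poly_Mapping.keys z \<subseteq> {(r \<odot>\<^bsub>M\<^esub> x, p), (x, r \<odot>\<^bsub>P\<^esub> p)}"
      unfolding s(1) by (rule order_trans[OF keys_diff]) auto
    then show ?thesis using s by auto
  qed
qed

lemma subgroup_H: "subgroup H G"
  unfolding tensor_subgroup_def
  by (rule group.generate_is_subgroup[OF group_free_Abelian_group tensor_relations_subset])

lemma H_keys: "z \<in> H \<Longrightarrow> Poly_Mapping.keys z \<subseteq> carrier M \<times> carrier P"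
  using subsetD[OF subgroup.subset[OF subgroup_H], of z] by (simp only: carrier_free_Abelian_group_iff)

lemma H_zero [simp]: "0 \<in> H"
  using subgroup.one_closed[OF subgroup_H] by simp

lemma H_add: "z \<in> H \<Longrightarrow> w \<in> H \<Longrightarrow> z + w \<in> H"
  using subgroup.m_closed[OF subgroup_H] by simp

lemma H_uminus: "z \<in> H \<Longrightarrow> - z \<in> H"
  using subgroup.m_inv_closed[OF subgroup_H] H_keys by simp

lemma H_diff: "z \<in> H \<Longrightarrow> w \<in> H \<Longrightarrow> z - w \<in> H"
  using H_add[of z "- w"] H_uminus[of w] by simp

lemma H_l_distr:
  "x \<in> carrier M \<Longrightarrow> y \<in> carrier M \<Longrightarrow> p \<in> carrier P \<Longrightarrow>
    frag_of (x \<oplus>\<^bsub>M\<^esub> y, p) - frag_of (x, p) - frag_of (y, p) \<in> H"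
  unfolding tensor_subgroup_def tensor_relations_def by (intro generate.incl) blast

lemma H_r_distr:
  "x \<in> carrier M \<Longrightarrow> p \<in> carrier P \<Longrightarrow> q \<in> carrier P \<Longrightarrow>
    frag_of (x, p \<oplus>\<^bsub>P\<^esub> q) - frag_of (x, p) - frag_of (x, q) \<in> H"
  unfolding tensor_subgroup_def tensor_relations_def by (intro generate.incl) blast

lemma H_smult:
  "r \<in> carrier R \<Longrightarrow> x \<in> carrier M \<Longrightarrow> p \<in> carrier P \<Longrightarrow>
    frag_of (r \<odot>\<^bsub>M\<^esub> x, p) - frag_of (x, r \<odot>\<^bsub>P\<^esub> p) \<in> H"
  unfolding tensor_subgroup_def tensor_relations_def by (intro generate.incl) blast

lemma H_zero_l: "p \<in> carrier P \<Longrightarrow> frag_of (\<zero>\<^bsub>M\<^esub>, p) \<in> H"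
  using H_uminus[OF H_l_distr[of "\<zero>\<^bsub>M\<^esub>" "\<zero>\<^bsub>M\<^esub>" p]] by simp

lemma H_zero_r: "x \<in> carrier M \<Longrightarrow> frag_of (x, \<zero>\<^bsub>P\<^esub>) \<in> H"
  using H_uminus[OF H_r_distr[of x "\<zero>\<^bsub>P\<^esub>" "\<zero>\<^bsub>P\<^esub>"]] by simp

text \<open>The cases \<open>add\<close> and \<open>uminus\<close> keep membership in
  \<open>H\<close>: homomorphisms out of the free group are additive only on its carrier, so the
  supports have to be known.\<close>

lemma H_induct [consumes 1, case_names zero l_distr r_distr smult add uminus]:
  assumes z: "z \<in> H"
    and zero: "A 0"
    and l: "\<And>x y p. x \<in> carrier M \<Longrightarrow> y \<in> carrier M \<Longrightarrow> p \<in> carrier P \<Longrightarrow>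
      A (frag_of (x \<oplus>\<^bsub>M\<^esub> y, p) - frag_of (x, p) - frag_of (y, p))"
    and r: "\<And>x p q. x \<in> carrier M \<Longrightarrow> p \<in> carrier P \<Longrightarrow> q \<in> carrier P \<Longrightarrow>
      A (frag_of (x, p \<oplus>\<^bsub>P\<^esub> q) - frag_of (x, p) - frag_of (x, q))"
    and s: "\<And>r x p. r \<in> carrier R \<Longrightarrow> x \<in> carrier M \<Longrightarrow> p \<in> carrier P \<Longrightarrow>
      A (frag_of (r \<odot>\<^bsub>M\<^esub> x, p) - frag_of (x, r \<odot>\<^bsub>P\<^esub> p))"
    and add: "\<And>z w. z \<in> H \<Longrightarrow> w \<in> H \<Longrightarrow> A z \<Longrightarrow> A w \<Longrightarrow> A (z + w)"
    and uminus: "\<And>z. z \<in> H \<Longrightarrow> A z \<Longrightarrow> A (- z)"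
  shows "A z"
proof -
  have rel: "A z" if "z \<in> tensor_relations R M P" for z
  proof -
    from that consider (l) x y p where "z = frag_of (x \<oplus>\<^bsub>M\<^esub> y, p) - frag_of (x, p) - frag_of (y, p)"
        "x \<in> carrier M" "y \<in> carrier M" "p \<in> carrier P"
      | (r) x p q where "z = frag_of (x, p \<oplus>\<^bsub>P\<^esub> q) - frag_of (x, p) - frag_of (x, q)"
        "x \<in> carrier M" "p \<in> carrier P" "q \<in> carrier P"
      | (s) r x p where "z = frag_of (r \<odot>\<^bsub>M\<^esub> x, p) - frag_of (x, r \<odot>\<^bsub>P\<^esub> p)"
        "r \<in> carrier R" "x \<in> carrier M" "p \<in> carrier P"
      unfolding tensor_relations_def by blast
    then show ?thesis
      by cases (simp_all only: l r s)
  qed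
  have "z \<in> generate G (tensor_relations R M P)" using z by (simp add: tensor_subgroup_def)
  then show ?thesis
  proof (induction rule: generate.induct)
    case one
    then show ?case using zero by simp
  next
    case (incl h)
    then show ?case by (rule rel)
  next
    case (inv h)
    have "h \<in> H" using inv unfolding tensor_subgroup_def by (rule generate.incl)
    moreover have "inv\<^bsub>G\<^esub> h = - h" using subsetD[OF tensor_relations_subset inv] by simp
    ultimately show ?case using uminus[OF _ rel[OF inv]] by simp
  next
    case (eng h1 h2)
    then show ?case using add by (simp add: tensor_subgroup_def)
  qed
qed

lemma coset_eq: "H #>\<^bsub>G\<^esub> z = {w. w - z \<in> H}"
proof (rule Set.set_eqI)
  fix w
  have "w \<in> H #>\<^bsub>G\<^esub> z \<longleftrightarrow> (\<exists>h\<in>H. w = h + z)"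
    by (simp add: r_coset_def)
  also have "\<dots> \<longleftrightarrow> w - z \<in> H"
    by (metis add_diff_cancel diff_add_cancel)
  finally show "w \<in> H #>\<^bsub>G\<^esub> z \<longleftrightarrow> w \<in> {w. w - z \<in> H}" by simp
qed

lemma coset_eq_iff: "H #>\<^bsub>G\<^esub> z = H #>\<^bsub>G\<^esub> w \<longleftrightarrow> z - w \<in> H"
proof
  assume "H #>\<^bsub>G\<^esub> z = H #>\<^bsub>G\<^esub> w"
  moreover have "z \<in> H #>\<^bsub>G\<^esub> z" by (simp add: coset_eq)
  ultimately have "z \<in> H #>\<^bsub>G\<^esub> w" by simp
  then show "z - w \<in> H" by (simp add: coset_eq)
next
  assume zw: "z - w \<in> H"
  have "v - z \<in> H \<longleftrightarrow> v - w \<in> H" for v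
    using H_add[OF _ zw, of "v - z"] H_diff[OF _ zw, of "v - w"] by auto
  then show "H #>\<^bsub>G\<^esub> z = H #>\<^bsub>G\<^esub> w" by (simp add: coset_eq)
qed

lemma carrier_tensor_product:
  "carrier (tensor_product R M P) = (\<lambda>z. H #>\<^bsub>G\<^esub> z) ` carrier G"
  by (auto simp: tensor_product_def FactGroup_def RCOSETS_def)

lemma comm_group_tensor_product: "comm_group (tensor_product R M P)"
  unfolding tensor_product_def
  by (rule comm_group.abelian_FactGroup[OF abelian_free_Abelian_group subgroup_H])

lemma tensor_product_mult:
  assumes "z \<in> carrier G" "w \<in> carrier G"
  shows "(H #>\<^bsub>G\<^esub> z) \<otimes>\<^bsub>tensor_product R M P\<^esub> (H #>\<^bsub>G\<^esub> w) = H #>\<^bsub>G\<^esub> (z + w)"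
  using normal.rcos_sum[OF comm_group.subgroup_imp_normal[OF abelian_free_Abelian_group subgroup_H] assms]
  by (simp add: tensor_product_def FactGroup_def)

end

lemma (in abelian_group) add_minus_minus:
  assumes "a \<in> carrier G" "b \<in> carrier G"
  shows "a \<oplus> b \<ominus> a \<ominus> b = \<zero>"
proof -
  have "a \<oplus> b \<ominus> a = b" using assms by (simp add: minus_eq a_comm[of a b] a_assoc r_neg)
  then show ?thesis using assms by (simp add: minus_eq r_neg)
qed

lemma frag_hom_simps:
  assumes N: "abelian_group N" and h: "h \<in> hom (free_Abelian_group S) (add_monoid N)"
    and ab: "Poly_Mapping.keys a \<subseteq> S" "Poly_Mapping.keys b \<subseteq> S"
  shows "h a \<in> carrier N" "h (a + b) = h a \<oplus>\<^bsub>N\<^esub> h b" "h 0 = \<zero>\<^bsub>N\<^esub>" "h (- a) = \<ominus>\<^bsub>N\<^esub> h a" "h (a - b) = h a \<ominus>\<^bsub>N\<^esub> h b"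
proof -
  interpret N: abelian_group N by fact
  have closed: "h x \<in> carrier N" if "Poly_Mapping.keys x \<subseteq> S" for x
    using hom_in_carrier[OF h, of x] that by simp
  have add: "h (x + y) = h x \<oplus>\<^bsub>N\<^esub> h y" if "Poly_Mapping.keys x \<subseteq> S" "Poly_Mapping.keys y \<subseteq> S" for x y
    using hom_mult[OF h, of x y] that by simp
  show "h a \<in> carrier N" "h (a + b) = h a \<oplus>\<^bsub>N\<^esub> h b" using closed add ab by simp_all
  have "h 0 \<oplus>\<^bsub>N\<^esub> h 0 = h 0" using add[of 0 0] by simp
  then show 0: "h 0 = \<zero>\<^bsub>N\<^esub>" using closed[of 0] N.add.l_cancel_one by simp
  have neg: "h (- x) = \<ominus>\<^bsub>N\<^esub> h x" if "Poly_Mapping.keys x \<subseteq> S" for x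
    using add[of "- x" x] 0 that closed[of x] closed[of "- x"] N.minus_equality[of "h (- x)" "h x"] by simp
  show "h (- a) = \<ominus>\<^bsub>N\<^esub> h a" by (rule neg[OF ab(1)])
  show "h (a - b) = h a \<ominus>\<^bsub>N\<^esub> h b" using add[of a "- b"] neg[OF ab(2)] ab by (simp add: N.minus_eq)
qed

lemma ex_frag_hom:
  assumes N: "abelian_group N" and f: "\<And>x. x \<in> S \<Longrightarrow> f x \<in> carrier N"
  shows "\<exists>h\<in>hom (free_Abelian_group S) (add_monoid N). \<forall>x\<in>S. h (frag_of x) = f x"
proof -
  have "f ` S \<subseteq> carrier (add_monoid N)" using f by auto
  show ?thesis
  proof (rule comm_group.free_Abelian_group_universal[OF abelian_group.a_comm_group[OF N] \<open>f ` S \<subseteq> _\<close>])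
    fix h assume "h \<in> hom (free_Abelian_group S) (add_monoid N)" "\<And>x. x \<in> S \<Longrightarrow> h (frag_of x) = f x"
    then show ?thesis by (intro bexI[of _ h] ballI)
  qed
qed

abbreviation frag_map :: "('b \<Rightarrow> 'd) \<Rightarrow> (('b \<times> 'c) \<Rightarrow>\<^sub>0 int) \<Rightarrow> (('d \<times> 'c) \<Rightarrow>\<^sub>0 int)" where
  "frag_map u \<equiv> frag_extend (\<lambda>(x, p). frag_of (u x, p))"

lemma frag_map_tensor_subgroup:
  assumes "Module.module R M" "Module.module R N" "Module.module R P" and u: "u \<in> module_hom R M N"
    and z: "z \<in> tensor_subgroup R M P"
  shows "frag_map u z \<in> tensor_subgroup R N P"
proof -
  interpret MP: tensor_pair R M P by (intro tensor_pair.intro assms)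
  interpret NP: tensor_pair R N P by (intro tensor_pair.intro assms)
  note us = module_homD[OF u]
  from z show ?thesis
  proof (induction rule: MP.H_induct)
    case (l_distr x y p)
    then show ?case using NP.H_l_distr[of "u x" "u y" p] us by (simp add: frag_extend_diff)
  next
    case (r_distr x p q)
    then show ?case using NP.H_r_distr[of "u x" p q] us by (simp add: frag_extend_diff)
  next
    case (smult r x p)
    then show ?case using NP.H_smult[of r "u x" p] us by (simp add: frag_extend_diff)
  qed (simp_all add: frag_extend_add frag_extend_minus NP.H_add NP.H_uminus)
qed

text \<open>A homomorphism is injective iff its kernel is trivial. Phrased on representatives in the
  free groups, this spares the flatness arguments all cosets.\<close>

lemma inj_on_tensor_map_iff:
  assumes "Module.module R M" "Module.module R N" "Module.module R P" and u: "u \<in> module_hom R M N"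
  shows "inj_on (tensor_map R N P u) (carrier (tensor_product R M P)) \<longleftrightarrow>
    (\<forall>z. Poly_Mapping.keys z \<subseteq> carrier M \<times> carrier P \<longrightarrow>
       frag_map u z \<in> tensor_subgroup R N P \<longrightarrow> z \<in> tensor_subgroup R M P)"
proof -
  interpret MP: tensor_pair R M P by (intro tensor_pair.intro assms)
  interpret NP: tensor_pair R N P by (intro tensor_pair.intro assms)
  note FH = frag_map_tensor_subgroup[OF assms]
  \<comment> \<open>The union in \<open>tensor_map\<close> runs over all representatives of a coset,
    and it is constant by \<open>frag_map_tensor_subgroup\<close>.\<close>
  have map: "tensor_map R N P u (MP.H #>\<^bsub>MP.G\<^esub> z) = NP.H #>\<^bsub>NP.G\<^esub> frag_map u z" for z
    unfolding tensor_map_def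
  proof (rule UN_constant_eq)
    show "z \<in> MP.H #>\<^bsub>MP.G\<^esub> z" by (simp add: MP.coset_eq)
    show "\<forall>w\<in>MP.H #>\<^bsub>MP.G\<^esub> z. NP.H #>\<^bsub>NP.G\<^esub> frag_map u w = NP.H #>\<^bsub>NP.G\<^esub> frag_map u z"
    proof
      fix w assume "w \<in> MP.H #>\<^bsub>MP.G\<^esub> z"
      then have "frag_map u (w - z) \<in> NP.H" by (intro FH) (simp add: MP.coset_eq)
      then show "NP.H #>\<^bsub>NP.G\<^esub> frag_map u w = NP.H #>\<^bsub>NP.G\<^esub> frag_map u z"
        by (simp add: NP.coset_eq_iff frag_extend_diff)
    qed
  qed
  show ?thesis
  proof (intro iffI allI impI)
    fix z assume inj: "inj_on (tensor_map R N P u) (carrier (tensor_product R M P))"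
      and z: "Poly_Mapping.keys z \<subseteq> carrier M \<times> carrier P" "frag_map u z \<in> NP.H"
    have "MP.H #>\<^bsub>MP.G\<^esub> z = MP.H #>\<^bsub>MP.G\<^esub> 0"
    proof (rule inj_onD[OF inj])
      show "tensor_map R N P u (MP.H #>\<^bsub>MP.G\<^esub> z) = tensor_map R N P u (MP.H #>\<^bsub>MP.G\<^esub> 0)"
        unfolding map NP.coset_eq_iff using z(2) by simp
      show "MP.H #>\<^bsub>MP.G\<^esub> z \<in> carrier (tensor_product R M P)" "MP.H #>\<^bsub>MP.G\<^esub> 0 \<in> carrier (tensor_product R M P)"
        unfolding MP.carrier_tensor_product by (intro imageI; simp add: z(1))+
    qed
    then show "z \<in> MP.H" unfolding MP.coset_eq_iff by simp
  next
    assume *: "\<forall>z. Poly_Mapping.keys z \<subseteq> carrier M \<times> carrier P \<longrightarrow> frag_map u z \<in> NP.H \<longrightarrow> z \<in> MP.H"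
    show "inj_on (tensor_map R N P u) (carrier (tensor_product R M P))"
    proof (rule inj_onI)
      fix X Y assume "X \<in> carrier (tensor_product R M P)" "Y \<in> carrier (tensor_product R M P)"
        and eq: "tensor_map R N P u X = tensor_map R N P u Y"
      then obtain z w where zw: "Poly_Mapping.keys z \<subseteq> carrier M \<times> carrier P" "Poly_Mapping.keys w \<subseteq> carrier M \<times> carrier P"
        "X = MP.H #>\<^bsub>MP.G\<^esub> z" "Y = MP.H #>\<^bsub>MP.G\<^esub> w"
        unfolding MP.carrier_tensor_product by auto
      have "frag_map u (z - w) \<in> NP.H"
        using eq unfolding zw(3,4) map NP.coset_eq_iff by (simp add: frag_extend_diff)
      moreover have "Poly_Mapping.keys (z - w) \<subseteq> carrier M \<times> carrier P"
        by (rule order_trans[OF keys_diff Un_least[OF zw(1,2)]])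
      ultimately have "z - w \<in> MP.H" using * by simp
      then show "X = Y" unfolding zw(3,4) MP.coset_eq_iff .
    qed
  qed
qed

text \<open>Multiplication by \<open>s\<close> on \<open>R\<close> is injective, hence so is multiplication by \<open>s\<close> on \<open>R \<otimes> P = P\<close>.\<close>

lemma flat_module_torsion_free:
  fixes R :: "('a, 'r) ring_scheme" and P :: "('a, 'p, 'q) module_scheme"
  assumes flat: "flat_module TYPE('a) R P" and s: "s \<in> non_zero_divisors R"
    and x: "x \<in> carrier P" "s \<odot>\<^bsub>P\<^esub> x = \<zero>\<^bsub>P\<^esub>"
  shows "x = \<zero>\<^bsub>P\<^esub>"
proof -
  have P: "Module.module R P" using flat by (simp add: flat_module_def)
  interpret P: Module.module R P by (rule P)
  let ?R = "regular_module R"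
  have R: "Module.module R ?R" by (rule module_regular_module[OF P.R.is_cring])
  interpret RP: tensor_pair R ?R P by (intro tensor_pair.intro P R)
  have sR: "s \<in> carrier R" using s by simp
  define u where "u = (\<lambda>r\<in>carrier R. s \<otimes>\<^bsub>R\<^esub> r)"
  have u: "u \<in> module_hom R ?R ?R"
    using sR by (intro module_homI) (simp_all add: u_def P.R.r_distr P.R.m_lcomm)
  have inj: "inj_on u (carrier ?R)"
    using s P.R.nzd_cancel by (simp add: inj_on_def u_def)
  have "inj_on (tensor_map R ?R P u) (carrier (tensor_product R ?R P))"
    using flat[unfolded flat_module_def] u inj R by simp
  then have inj': "z \<in> RP.H" if "Poly_Mapping.keys z \<subseteq> carrier ?R \<times> carrier P" "frag_map u z \<in> RP.H" for z
    using that unfolding inj_on_tensor_map_iff[OF R R P u] by simp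
  \<comment> \<open>\<open>s \<otimes> x = 1 \<otimes> s x = 1 \<otimes> 0 = 0\<close>, and
    \<open>u\<close> sends \<open>1 \<otimes> x\<close> to \<open>s \<otimes> x\<close>, so
    injectivity gives \<open>1 \<otimes> x = 0\<close>.\<close>
  have "frag_of (s, x) - frag_of (\<one>\<^bsub>R\<^esub>, \<zero>\<^bsub>P\<^esub>) \<in> RP.H"
    using RP.H_smult[of s "\<one>\<^bsub>R\<^esub>" x] sR x by simp
  then have "frag_of (s, x) \<in> RP.H"
    using RP.H_add[OF _ RP.H_zero_r[of "\<one>\<^bsub>R\<^esub>"], of "frag_of (s, x) - frag_of (\<one>\<^bsub>R\<^esub>, \<zero>\<^bsub>P\<^esub>)"] by simp
  then have 1: "frag_of (\<one>\<^bsub>R\<^esub>, x) \<in> RP.H"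
    using x(1) sR \<open>frag_of (s, x) \<in> RP.H\<close> by - (rule inj', simp_all add: u_def)
  \<comment> \<open>The evaluation \<open>r \<otimes> p \<mapsto> r p\<close> respects the tensor
    relations and takes \<open>1 \<otimes> x\<close> to \<open>x\<close>.\<close>
  have "fst y \<odot>\<^bsub>P\<^esub> snd y \<in> carrier P" if "y \<in> carrier ?R \<times> carrier P" for y
    using that by auto
  from ex_frag_hom[OF P.M.abelian_group_axioms this]
  obtain h where h: "h \<in> hom RP.G (add_monoid P)"
    "\<forall>y\<in>carrier ?R \<times> carrier P. h (frag_of y) = fst y \<odot>\<^bsub>P\<^esub> snd y"
    by (rule bexE)
  note hs = frag_hom_simps[OF P.M.abelian_group_axioms h(1)]
  have keys3: "Poly_Mapping.keys (frag_of a - frag_of b) \<subseteq> carrier R \<times> carrier P"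
    if "a \<in> carrier R \<times> carrier P" "b \<in> carrier R \<times> carrier P" for a b
    by (rule order_trans[OF keys_diff]) (use that in auto)
  have "h z = \<zero>\<^bsub>P\<^esub>" if "z \<in> RP.H" for z
    using that
  proof (induction rule: RP.H_induct)
    case zero
    show ?case using hs(3)[of 0 0] by simp
  next
    case (l_distr x y p)
    then show ?case
      by (simp add: hs(5) keys3 h(2) P.smult_l_distr P.M.add_minus_minus)
  next
    case (r_distr x p q)
    then show ?case
      by (simp add: hs(5) keys3 h(2) P.smult_r_distr P.M.add_minus_minus)
  next
    case (smult r x p)
    then have "r \<odot>\<^bsub>P\<^esub> (x \<odot>\<^bsub>P\<^esub> p) = x \<odot>\<^bsub>P\<^esub> (r \<odot>\<^bsub>P\<^esub> p)"
      by (simp flip: P.smult_assoc1 add: P.R.m_comm)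
    with smult show ?case by (simp add: hs(5) h(2) P.smult_assoc1 P.M.minus_eq P.M.r_neg)
  next
    case (add z w)
    then show ?case using hs(2)[OF RP.H_keys RP.H_keys] by simp
  next
    case (uminus z)
    then show ?case using hs(4)[OF RP.H_keys[OF uminus(1)] RP.H_keys[OF uminus(1)]] by simp
  qed
  from this[OF 1] show ?thesis using h(2)[rule_format, of "(\<one>\<^bsub>R\<^esub>, x)"] x(1) by simp
qed


section \<open>Flatness of the classical ring of quotients\<close>

context cring
begin

lemma ex_denominator:
  assumes "q \<in> carrier Q"
  shows "\<exists>t\<in>nzd. \<exists>c\<in>carrier R. \<iota> t \<otimes>\<^bsub>Q\<^esub> q = \<iota> c"
proof -
  obtain a s where "a \<in> carrier R" "s \<in> nzd" "q = fraction R a s" using assms by (rule Q_cl_cases)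
  then show ?thesis by (intro bexI[of _ s] bexI[of _ a]) (simp_all add: Q_cl_map_denominator)
qed

text \<open>Localizing \<open>N\<close> at the non-zero-divisors is avoided by clearing denominators: for \<open>t\<close> divisible
  by all denominators that occur, \<open>n \<otimes> q \<mapsto> (t q) n\<close> respects the relations of the tensor product.\<close>

lemma tensor_Q_eq_zero:
  fixes N :: "('a, 'x, 'y) module_scheme"
  assumes N: "Module.module R N" and n: "n \<in> carrier N" and s: "s \<in> nzd"
    and z: "frag_of (n, fraction R \<one> s) \<in> tensor_subgroup R N Q_mod"
  shows "\<exists>t\<in>nzd. t \<odot>\<^bsub>N\<^esub> n = \<zero>\<^bsub>N\<^esub>"
proof -
  interpret N: Module.module R N by (rule N)
  interpret Q: cring Q by (rule cring_Q_cl)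
  interpret NQ: tensor_pair R N Q_mod by (intro tensor_pair.intro N module_Q_cl)
  \<comment> \<open>\<open>val t\<close> is \<open>n \<otimes> q \<mapsto> (t q) n\<close> where
    \<open>t q\<close> lies in \<open>R\<close>. The value zero elsewhere makes it total, so that it
    defines a homomorphism on the free group for every \<open>t\<close>.\<close>
  define val where "val t y =
    (if \<iota> t \<otimes>\<^bsub>Q\<^esub> snd y \<in> \<iota> ` carrier R then inv_into (carrier R) \<iota> (\<iota> t \<otimes>\<^bsub>Q\<^esub> snd y) \<odot>\<^bsub>N\<^esub> fst y else \<zero>\<^bsub>N\<^esub>)"
    for t and y :: "'x \<times> ('a \<times> 'a) set"
  have val_eq: "val t (x, q) = c \<odot>\<^bsub>N\<^esub> x" if "\<iota> t \<otimes>\<^bsub>Q\<^esub> q = \<iota> c" "c \<in> carrier R" for t x q c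
    using that by (simp add: val_def inj_on_Q_cl_map)
  have "val t y \<in> carrier N" if "y \<in> carrier N \<times> carrier Q_mod" for t y
  proof (cases "\<iota> t \<otimes>\<^bsub>Q\<^esub> snd y \<in> \<iota> ` carrier R")
    case True
    from inv_into_into[OF this] that show ?thesis by (auto simp: val_def)
  qed (simp add: val_def)
  from ex_frag_hom[OF N.M.abelian_group_axioms this]
  have "\<forall>t. \<exists>h. h \<in> hom NQ.G (add_monoid N) \<and> (\<forall>y\<in>carrier N \<times> carrier Q_mod. h (frag_of y) = val t y)"
    by (simp only: Bex_def) (rule allI)
  from choice[OF this] obtain h where
    h: "\<forall>t. h t \<in> hom NQ.G (add_monoid N) \<and> (\<forall>y\<in>carrier N \<times> carrier Q_mod. h t (frag_of y) = val t y)"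
    by (rule exE)
  note hs = frag_hom_simps[OF N.M.abelian_group_axioms conjunct1[OF h[rule_format]]]
  have hv: "h t (frag_of (x, q)) = c \<odot>\<^bsub>N\<^esub> x"
    if "\<iota> t \<otimes>\<^bsub>Q\<^esub> q = \<iota> c" "c \<in> carrier R" "x \<in> carrier N" "q \<in> carrier Q" for t x q c
    using h val_eq[OF that(1,2)] that(3,4) by simp
  have diff: "Poly_Mapping.keys (frag_of a - frag_of b) \<subseteq> carrier N \<times> carrier Q"
    if "a \<in> carrier N \<times> carrier Q" "b \<in> carrier N \<times> carrier Q" for a b
    by (rule order_trans[OF keys_diff]) (use that in auto)
  have scale: "\<iota> (t \<otimes> u) \<otimes>\<^bsub>Q\<^esub> q = \<iota> (c \<otimes> u)"
    if "\<iota> t \<otimes>\<^bsub>Q\<^esub> q = \<iota> c" "t \<in> nzd" "u \<in> carrier R" "c \<in> carrier R" "q \<in> carrier Q" for t u c q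
  proof -
    have "\<iota> (t \<otimes> u) \<otimes>\<^bsub>Q\<^esub> q = \<iota> u \<otimes>\<^bsub>Q\<^esub> (\<iota> t \<otimes>\<^bsub>Q\<^esub> q)"
      using that(2-5) by (simp add: Q_cl_map_simps Q.m_ac)
    then show ?thesis using that by (simp add: Q_cl_map_simps Q.m_comm)
  qed
  \<comment> \<open>Quantifying over all multiples \<open>t u\<close> lets the denominators that
    belong to two parts of an element be merged into their product.\<close>
  have "\<exists>t\<in>nzd. \<forall>u\<in>nzd. h (t \<otimes> u) z = \<zero>\<^bsub>N\<^esub>" if "z \<in> NQ.H" for z
    using that
  proof (induction rule: NQ.H_induct)
    case zero
    have "h u 0 = \<zero>\<^bsub>N\<^esub>" for u using hs(3)[of 0 0] by simp
    then show ?case by (intro bexI[of _ \<one>]) simp_all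
  next
    case (l_distr x y p)
    then have p: "p \<in> carrier Q" by simp
    obtain t c where t: "t \<in> nzd" "c \<in> carrier R" "\<iota> t \<otimes>\<^bsub>Q\<^esub> p = \<iota> c" using ex_denominator[OF p] by (elim bexE)
    show ?case
    proof (intro bexI[OF _ t(1)] ballI)
      fix u assume u: "u \<in> nzd"
      note v = scale[OF t(3,1) nzd_carrier[OF u] t(2) p]
      have cu: "c \<otimes> u \<in> carrier R" using t u by simp
      show "h (t \<otimes> u) (frag_of (x \<oplus>\<^bsub>N\<^esub> y, p) - frag_of (x, p) - frag_of (y, p)) = \<zero>\<^bsub>N\<^esub>"
        using l_distr(1,2) p cu by (simp add: hs(5) diff hv[OF v] N.smult_r_distr N.M.add_minus_minus)
    qed
  next
    case (r_distr x p q)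
    then have p: "p \<in> carrier Q" and q: "q \<in> carrier Q" by simp_all
    obtain t c where t: "t \<in> nzd" "c \<in> carrier R" "\<iota> t \<otimes>\<^bsub>Q\<^esub> p = \<iota> c" using ex_denominator[OF p] by (elim bexE)
    obtain s d where s: "s \<in> nzd" "d \<in> carrier R" "\<iota> s \<otimes>\<^bsub>Q\<^esub> q = \<iota> d" using ex_denominator[OF q] by (elim bexE)
    show ?case
    proof (intro bexI[OF _ mult_nzd[OF t(1) s(1)]] ballI)
      fix u assume u: "u \<in> nzd"
      note tR = nzd_carrier[OF t(1)] and sR = nzd_carrier[OF s(1)] and uR = nzd_carrier[OF u]
      have vp: "\<iota> (t \<otimes> s \<otimes> u) \<otimes>\<^bsub>Q\<^esub> p = \<iota> (c \<otimes> (s \<otimes> u))"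
        using scale[OF t(3,1) _ t(2) p, of "s \<otimes> u"] tR sR uR by (simp add: m_assoc)
      have vq: "\<iota> (t \<otimes> s \<otimes> u) \<otimes>\<^bsub>Q\<^esub> q = \<iota> (d \<otimes> (t \<otimes> u))"
        using scale[OF s(3,1) _ s(2) q, of "t \<otimes> u"] tR sR uR by (simp add: m_ac)
      have cd: "c \<otimes> (s \<otimes> u) \<in> carrier R" "d \<otimes> (t \<otimes> u) \<in> carrier R" using t(2) s(2) tR sR uR by simp_all
      have "\<iota> (t \<otimes> s \<otimes> u) \<otimes>\<^bsub>Q\<^esub> (p \<oplus>\<^bsub>Q\<^esub> q) = \<iota> (t \<otimes> s \<otimes> u) \<otimes>\<^bsub>Q\<^esub> p \<oplus>\<^bsub>Q\<^esub> \<iota> (t \<otimes> s \<otimes> u) \<otimes>\<^bsub>Q\<^esub> q"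
        using p q tR sR uR by (intro Q.r_distr) simp_all
      also have "\<dots> = \<iota> (c \<otimes> (s \<otimes> u) \<oplus> d \<otimes> (t \<otimes> u))"
        unfolding vp vq by (rule Q_cl_map_simps(2)[OF cd, symmetric])
      finally have v: "\<iota> (t \<otimes> s \<otimes> u) \<otimes>\<^bsub>Q\<^esub> (p \<oplus>\<^bsub>Q\<^esub> q) = \<iota> (c \<otimes> (s \<otimes> u) \<oplus> d \<otimes> (t \<otimes> u))" .
      show "h (t \<otimes> s \<otimes> u) (frag_of (x, p \<oplus>\<^bsub>Q_mod\<^esub> q) - frag_of (x, p) - frag_of (x, q)) = \<zero>\<^bsub>N\<^esub>"
        using r_distr(1) p q cd
        by (simp add: hs(5) diff hv[OF vp] hv[OF vq] hv[OF v] N.smult_l_distr N.M.add_minus_minus)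
    qed
  next
    case (smult r x p)
    then have p: "p \<in> carrier Q" by simp
    obtain t c where t: "t \<in> nzd" "c \<in> carrier R" "\<iota> t \<otimes>\<^bsub>Q\<^esub> p = \<iota> c" using ex_denominator[OF p] by (elim bexE)
    show ?case
    proof (intro bexI[OF _ t(1)] ballI)
      fix u assume u: "u \<in> nzd"
      note v = scale[OF t(3,1) nzd_carrier[OF u] t(2) p]
      have cu: "c \<otimes> u \<in> carrier R" using t u by simp
      have "\<iota> (t \<otimes> u) \<otimes>\<^bsub>Q\<^esub> (\<iota> r \<otimes>\<^bsub>Q\<^esub> p) = \<iota> r \<otimes>\<^bsub>Q\<^esub> (\<iota> (t \<otimes> u) \<otimes>\<^bsub>Q\<^esub> p)"
        using smult(1) p t(1) u by (intro Q.m_lcomm) simp_all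
      also have "\<dots> = \<iota> (c \<otimes> u \<otimes> r)"
        unfolding v using smult(1) cu by (simp flip: Q_cl_map_simps(1) add: m_comm)
      finally have vr: "\<iota> (t \<otimes> u) \<otimes>\<^bsub>Q\<^esub> (\<iota> r \<otimes>\<^bsub>Q\<^esub> p) = \<iota> (c \<otimes> u \<otimes> r)" .
      have "h (t \<otimes> u) (frag_of (r \<odot>\<^bsub>N\<^esub> x, p) - frag_of (x, \<iota> r \<otimes>\<^bsub>Q\<^esub> p))
          = (c \<otimes> u) \<odot>\<^bsub>N\<^esub> (r \<odot>\<^bsub>N\<^esub> x) \<ominus>\<^bsub>N\<^esub> (c \<otimes> u \<otimes> r) \<odot>\<^bsub>N\<^esub> x"
        using smult(1,2) p cu hv[OF v] hv[OF vr] by (simp add: hs(5))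
      also have "\<dots> = \<zero>\<^bsub>N\<^esub>"
        unfolding N.smult_assoc1[OF cu smult(1,2)] using smult(1,2) cu by (simp add: N.M.minus_eq N.M.r_neg)
      finally show "h (t \<otimes> u) (frag_of (r \<odot>\<^bsub>N\<^esub> x, p) - frag_of (x, r \<odot>\<^bsub>Q_mod\<^esub> p)) = \<zero>\<^bsub>N\<^esub>" by simp
    qed
  next
    case (add z w)
    obtain t where t: "t \<in> nzd" "\<forall>u\<in>nzd. h (t \<otimes> u) z = \<zero>\<^bsub>N\<^esub>" using add.IH(1) by (rule bexE)
    obtain s where s: "s \<in> nzd" "\<forall>u\<in>nzd. h (s \<otimes> u) w = \<zero>\<^bsub>N\<^esub>" using add.IH(2) by (rule bexE)
    show ?case
    proof (intro bexI[OF _ mult_nzd[OF t(1) s(1)]] ballI)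
      fix u assume u: "u \<in> nzd"
      have "h (t \<otimes> s \<otimes> u) z = \<zero>\<^bsub>N\<^esub>"
        using t(2)[rule_format, of "s \<otimes> u"] t(1) s(1) u by (simp add: m_assoc)
      moreover have "h (t \<otimes> s \<otimes> u) w = \<zero>\<^bsub>N\<^esub>"
        using s(2)[rule_format, of "t \<otimes> u"] t(1) s(1) u by (simp add: m_ac)
      ultimately show "h (t \<otimes> s \<otimes> u) (z + w) = \<zero>\<^bsub>N\<^esub>"
        using hs(2)[OF NQ.H_keys[OF add(1)] NQ.H_keys[OF add(2)]] by simp
    qed
  next
    case (uminus z)
    obtain t where t: "t \<in> nzd" "\<forall>u\<in>nzd. h (t \<otimes> u) z = \<zero>\<^bsub>N\<^esub>" using uminus.IH by (rule bexE)
    show ?case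
      using t(2) hs(4)[OF NQ.H_keys[OF uminus(1)] NQ.H_keys[OF uminus(1)]] by (intro bexI[OF _ t(1)]) simp
  qed
  from this[OF z] obtain t where t: "t \<in> nzd" "\<forall>u\<in>nzd. h (t \<otimes> u) (frag_of (n, fraction R \<one> s)) = \<zero>\<^bsub>N\<^esub>"
    by (rule bexE)
  \<comment> \<open>For \<open>u = s\<close> the scalar \<open>(t s) (1 / s)\<close> is
    \<open>t\<close>, so the vanishing of \<open>h (t s)\<close> says
    \<open>t n = 0\<close>.\<close>
  have "\<iota> (t \<otimes> s) \<otimes>\<^bsub>Q\<^esub> fraction R \<one> s = \<iota> t"
    using t(1) s by (simp add: Q_cl_map_mult_fraction) (simp add: Q_cl_map_fraction fraction_eq_iff)
  from hv[OF this] have "t \<odot>\<^bsub>N\<^esub> n = \<zero>\<^bsub>N\<^esub>"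
    using t(2)[rule_format, OF s] t(1) s n by simp
  then show ?thesis using t(1) by (rule bexI)
qed

text \<open>Finitely many fractions have a common denominator, so every element of
  \<open>M \<otimes> Q\<close> is a single tensor \<open>m \<otimes> 1 / s\<close>.\<close>

lemma tensor_Q_cases:
  fixes M :: "('a, 'x, 'y) module_scheme"
  assumes M: "Module.module R M" and z: "Poly_Mapping.keys z \<subseteq> carrier M \<times> carrier Q"
  shows "\<exists>m\<in>carrier M. \<exists>s\<in>nzd. z - frag_of (m, fraction R \<one> s) \<in> tensor_subgroup R M Q_mod"
proof -
  interpret M: Module.module R M by (rule M)
  interpret Q: cring Q by (rule cring_Q_cl)
  interpret MQ: tensor_pair R M Q_mod by (intro tensor_pair.intro M module_Q_cl)
  have move: "frag_of (m, fraction R a s) - frag_of (a \<odot>\<^bsub>M\<^esub> m, fraction R \<one> s) \<in> MQ.H"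
    if "m \<in> carrier M" "a \<in> carrier R" "s \<in> nzd" for m a s
    using MQ.H_uminus[OF MQ.H_smult[of a m "fraction R \<one> s"]] that by (simp add: Q_cl_map_mult_fraction)
  show ?thesis using z
  proof (induction rule: free_Abelian_group_induct[consumes 1])
    case 1
    show ?case
      using MQ.H_uminus[OF MQ.H_zero_l[of "fraction R \<one> \<one>"]]
      by (intro bexI[of _ "\<zero>\<^bsub>M\<^esub>"] bexI[of _ \<one>]) simp_all
  next
    case (2 x y)
    obtain m s where m: "m \<in> carrier M" "s \<in> nzd" "x - frag_of (m, fraction R \<one> s) \<in> MQ.H"
      using 2(3) by (elim bexE)
    obtain n t where n: "n \<in> carrier M" "t \<in> nzd" "y - frag_of (n, fraction R \<one> t) \<in> MQ.H"
      using 2(4) by (elim bexE)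
    \<comment> \<open>\<open>m \<otimes> 1 / s = t m \<otimes> 1 / (s t)\<close> and
      \<open>n \<otimes> 1 / t = s n \<otimes> 1 / (s t)\<close>. The induction step is a
      difference, hence \<open>m' - n'\<close> as the witness.\<close>
    define m' n' where "m' = t \<odot>\<^bsub>M\<^esub> m" and "n' = s \<odot>\<^bsub>M\<^esub> n"
    define e where "e = fraction R \<one> (s \<otimes> t)"
    have c: "m' \<in> carrier M" "n' \<in> carrier M" "e \<in> carrier Q" using m n by (simp_all add: m'_def n'_def e_def)
    have "fraction R t (s \<otimes> t) = fraction R \<one> s" "fraction R s (s \<otimes> t) = fraction R \<one> t"
      using m n by (simp_all add: fraction_eq_iff m_comm)
    then have x': "frag_of (m, fraction R \<one> s) - frag_of (m', e) \<in> MQ.H"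
      and y': "frag_of (n, fraction R \<one> t) - frag_of (n', e) \<in> MQ.H"
      using move[of m t "s \<otimes> t"] move[of n s "s \<otimes> t"] m n by (simp_all add: m'_def n'_def e_def)
    have "m' \<ominus>\<^bsub>M\<^esub> n' \<oplus>\<^bsub>M\<^esub> n' = m'" using c by (simp add: M.M.minus_eq M.M.a_assoc M.M.l_neg)
    then have d: "frag_of (m', e) - frag_of (m' \<ominus>\<^bsub>M\<^esub> n', e) - frag_of (n', e) \<in> MQ.H"
      using MQ.H_l_distr[of "m' \<ominus>\<^bsub>M\<^esub> n'" n' e] c by simp
    have "x - y - frag_of (m' \<ominus>\<^bsub>M\<^esub> n', e) \<in> MQ.H"
      using MQ.H_add[OF MQ.H_diff[OF MQ.H_add[OF m(3) x'] MQ.H_add[OF n(3) y']] d]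
      by (simp add: algebra_simps)
    then show ?case
      using c m n unfolding e_def by (intro bexI[of _ "m' \<ominus>\<^bsub>M\<^esub> n'"] bexI[of _ "s \<otimes> t"]) simp_all
  next
    case (3 p)
    obtain m q where p: "p = (m, q)" "m \<in> carrier M" "q \<in> carrier Q" using 3 by auto
    obtain a s where as: "a \<in> carrier R" "s \<in> nzd" "q = fraction R a s" using p(3) by (rule Q_cl_cases)
    show ?case
      using move[OF p(2) as(1,2)] p as by (intro bexI[of _ "a \<odot>\<^bsub>M\<^esub> m"] bexI[of _ s]) simp_all
  qed
qed

text \<open>Write a kernel element as \<open>m \<otimes> 1 / s\<close>. Then
  \<open>t u(m) = 0\<close> for some non-zero-divisor \<open>t\<close>, so \<open>t m = 0\<close> by
  injectivity of \<open>u\<close>, and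
  \<open>m \<otimes> 1 / s = t m \<otimes> 1 / (t s) = 0\<close>.\<close>

lemma flat_module_Q_cl: "flat_module TYPE('m) R Q_mod"
  unfolding flat_module_def
proof (intro conjI allI ballI impI)
  show Q: "Module.module R Q_mod" by (rule module_Q_cl)
  fix M N :: "('a, 'm) module" and u
  assume u: "u \<in> module_hom R M N" and M: "Module.module R M" and N: "Module.module R N"
    and inj: "inj_on u (carrier M)"
  interpret M: Module.module R M by (rule M)
  interpret MQ: tensor_pair R M Q_mod by (intro tensor_pair.intro M Q)
  interpret NQ: tensor_pair R N Q_mod by (intro tensor_pair.intro N Q)
  note us = module_homD[OF u]
  show "inj_on (tensor_map R N Q_mod u) (carrier (tensor_product R M Q_mod))"
    unfolding inj_on_tensor_map_iff[OF M N Q u]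
  proof (intro allI impI)
    fix z assume z: "Poly_Mapping.keys z \<subseteq> carrier M \<times> carrier Q_mod" "frag_map u z \<in> NQ.H"
    obtain m s where m: "m \<in> carrier M" "s \<in> nzd" "z - frag_of (m, fraction R \<one> s) \<in> MQ.H"
      using tensor_Q_cases[OF M z(1)[unfolded restrict_scalars_simps]] by (elim bexE)
    have e: "fraction R \<one> s \<in> carrier Q" using m(2) by simp
    have "frag_map u (z - frag_of (m, fraction R \<one> s)) \<in> NQ.H"
      by (rule frag_map_tensor_subgroup[OF M N Q u m(3)])
    from NQ.H_diff[OF z(2) this] have "frag_of (u m, fraction R \<one> s) \<in> NQ.H"
      by (simp add: frag_extend_diff)
    from tensor_Q_eq_zero[OF N us(1)[OF m(1)] m(2) this]
    obtain t where t: "t \<in> nzd" "t \<odot>\<^bsub>N\<^esub> u m = \<zero>\<^bsub>N\<^esub>" by (rule bexE)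
    have tm: "t \<odot>\<^bsub>M\<^esub> m \<in> carrier M" using t(1) m(1) by simp
    have "u (t \<odot>\<^bsub>M\<^esub> m) = u \<zero>\<^bsub>M\<^esub>"
      using t m(1) us(3) module_hom_zero[OF M N u] by simp
    then have "t \<odot>\<^bsub>M\<^esub> m = \<zero>\<^bsub>M\<^esub>" using inj_onD[OF inj _ tm] by simp
    then have H: "frag_of (t \<odot>\<^bsub>M\<^esub> m, fraction R \<one> (t \<otimes> s)) \<in> MQ.H"
      using MQ.H_zero_l[of "fraction R \<one> (t \<otimes> s)"] t(1) m(2) by simp
    have "fraction R t (t \<otimes> s) = fraction R \<one> s" using t(1) m(2) by (simp add: fraction_eq_iff)
    then have "frag_of (t \<odot>\<^bsub>M\<^esub> m, fraction R \<one> (t \<otimes> s)) - frag_of (m, fraction R \<one> s) \<in> MQ.H"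
      using MQ.H_smult[of t m "fraction R \<one> (t \<otimes> s)"] t(1) m by (simp add: Q_cl_map_mult_fraction)
    from MQ.H_diff[OF H this] have "frag_of (m, fraction R \<one> s) \<in> MQ.H" by simp
    from MQ.H_add[OF m(3) this] show "z \<in> MQ.H" by simp
  qed
qed

end

section \<open>Epimorphisms and balanced maps\<close>

locale biadditive_maps = S: ring S + A: comm_group A
  for S :: "('s, 'r) ring_scheme" and A :: "('c, 'z) monoid_scheme"
begin

text \<open>This is \<open>Hom(S \<otimes> S, A)\<close> over the integers. The group
  \<open>A\<close> is written multiplicatively so that a tensor product, itself a multiplicative
  record, can be substituted.\<close>

definition BM :: "('s \<times> 's \<Rightarrow> 'c) set" where
  "BM = {F \<in> carrier S \<times> carrier S \<rightarrow>\<^sub>E carrier A.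
     (\<forall>x\<in>carrier S. \<forall>x'\<in>carrier S. \<forall>y\<in>carrier S.
        F (x \<oplus>\<^bsub>S\<^esub> x', y) = F (x, y) \<otimes>\<^bsub>A\<^esub> F (x', y) \<and> F (y, x \<oplus>\<^bsub>S\<^esub> x') = F (y, x) \<otimes>\<^bsub>A\<^esub> F (y, x'))}"

lemma BM_I:
  assumes "\<And>x y. x \<in> carrier S \<Longrightarrow> y \<in> carrier S \<Longrightarrow> F (x, y) \<in> carrier A"
    "\<And>x x' y. x \<in> carrier S \<Longrightarrow> x' \<in> carrier S \<Longrightarrow> y \<in> carrier S \<Longrightarrow> F (x \<oplus>\<^bsub>S\<^esub> x', y) = F (x, y) \<otimes>\<^bsub>A\<^esub> F (x', y)"
    "\<And>x y y'. x \<in> carrier S \<Longrightarrow> y \<in> carrier S \<Longrightarrow> y' \<in> carrier S \<Longrightarrow> F (x, y \<oplus>\<^bsub>S\<^esub> y') = F (x, y) \<otimes>\<^bsub>A\<^esub> F (x, y')"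
  shows "restrict F (carrier S \<times> carrier S) \<in> BM"
  using assms by (simp add: BM_def restrict_PiE_iff Pi_iff split_paired_All)

lemma BM_D:
  assumes "F \<in> BM"
  shows "x \<in> carrier S \<Longrightarrow> y \<in> carrier S \<Longrightarrow> F (x, y) \<in> carrier A"
    "x \<in> carrier S \<Longrightarrow> x' \<in> carrier S \<Longrightarrow> y \<in> carrier S \<Longrightarrow> F (x \<oplus>\<^bsub>S\<^esub> x', y) = F (x, y) \<otimes>\<^bsub>A\<^esub> F (x', y)"
    "x \<in> carrier S \<Longrightarrow> y \<in> carrier S \<Longrightarrow> y' \<in> carrier S \<Longrightarrow> F (x, y \<oplus>\<^bsub>S\<^esub> y') = F (x, y) \<otimes>\<^bsub>A\<^esub> F (x, y')"
    "F \<in> extensional (carrier S \<times> carrier S)"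
proof -
  have P: "F \<in> carrier S \<times> carrier S \<rightarrow>\<^sub>E carrier A" using assms by (simp add: BM_def)
  show "x \<in> carrier S \<Longrightarrow> y \<in> carrier S \<Longrightarrow> F (x, y) \<in> carrier A" using PiE_mem[OF P, of "(x, y)"] by simp
  show "F \<in> extensional (carrier S \<times> carrier S)" using P by (simp add: PiE_def)
qed (use assms in \<open>simp_all add: BM_def\<close>)

lemma BM_eqI:
  assumes "F \<in> BM" "F' \<in> BM" "\<And>x y. x \<in> carrier S \<Longrightarrow> y \<in> carrier S \<Longrightarrow> F (x, y) = F' (x, y)"
  shows "F = F'"
proof (rule extensionalityI[OF BM_D(4)[OF assms(1)] BM_D(4)[OF assms(2)]])
  show "F p = F' p" if "p \<in> carrier S \<times> carrier S" for p using that assms(3)[of "fst p" "snd p"] by auto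
qed

definition zeroM where "zeroM = (\<lambda>p\<in>carrier S \<times> carrier S. \<one>\<^bsub>A\<^esub>)"
definition plusM where "plusM F F' = (\<lambda>p\<in>carrier S \<times> carrier S. F p \<otimes>\<^bsub>A\<^esub> F' p)"
definition uminusM where "uminusM F = (\<lambda>p\<in>carrier S \<times> carrier S. inv\<^bsub>A\<^esub> F p)"
text \<open>The bimodule structure: \<open>S\<close> acts on the left through right multiplication
  in the first argument, and on the right through left multiplication in the second. This order
  makes \<open>(s s') F = s (s' F)\<close>.\<close>

definition leftM where "leftM s F = (\<lambda>p\<in>carrier S \<times> carrier S. F (fst p \<otimes>\<^bsub>S\<^esub> s, snd p))"
definition rightM where "rightM F s = (\<lambda>p\<in>carrier S \<times> carrier S. F (fst p, s \<otimes>\<^bsub>S\<^esub> snd p))"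

lemma M_apply:
  assumes "x \<in> carrier S" "y \<in> carrier S"
  shows "zeroM (x, y) = \<one>\<^bsub>A\<^esub>" "plusM F F' (x, y) = F (x, y) \<otimes>\<^bsub>A\<^esub> F' (x, y)" "uminusM F (x, y) = inv\<^bsub>A\<^esub> F (x, y)"
    "leftM s F (x, y) = F (x \<otimes>\<^bsub>S\<^esub> s, y)" "rightM F s (x, y) = F (x, s \<otimes>\<^bsub>S\<^esub> y)"
  using assms by (simp_all add: zeroM_def plusM_def uminusM_def leftM_def rightM_def)

lemma zeroM [simp]: "zeroM \<in> BM"
  unfolding zeroM_def by (rule BM_I) simp_all

lemma plusM [simp]: "F \<in> BM \<Longrightarrow> F' \<in> BM \<Longrightarrow> plusM F F' \<in> BM"
  unfolding plusM_def by (rule BM_I) (simp_all add: BM_D A.m_ac)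

lemma uminusM [simp]: "F \<in> BM \<Longrightarrow> uminusM F \<in> BM"
  unfolding uminusM_def by (rule BM_I) (simp_all add: BM_D A.inv_mult)

lemma leftM [simp]: "F \<in> BM \<Longrightarrow> s \<in> carrier S \<Longrightarrow> leftM s F \<in> BM"
  unfolding leftM_def by (rule BM_I) (simp_all add: BM_D S.l_distr)

lemma rightM [simp]: "F \<in> BM \<Longrightarrow> s \<in> carrier S \<Longrightarrow> rightM F s \<in> BM"
  unfolding rightM_def by (rule BM_I) (simp_all add: BM_D S.r_distr)

text \<open>The square-zero extension of \<open>S\<close> by the bimodule \<open>BM\<close>. Ring
  homomorphisms that split its projection to \<open>S\<close> are the maps
  \<open>s \<mapsto> (s, d s)\<close> with \<open>d\<close> a derivation.\<close>

definition triv_ext :: "('s \<times> ('s \<times> 's \<Rightarrow> 'c)) ring" where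
  "triv_ext = \<lparr>carrier = carrier S \<times> BM,
     mult = (\<lambda>a b. (fst a \<otimes>\<^bsub>S\<^esub> fst b, plusM (leftM (fst a) (snd b)) (rightM (snd a) (fst b)))),
     one = (\<one>\<^bsub>S\<^esub>, zeroM), ring.zero = (\<zero>\<^bsub>S\<^esub>, zeroM),
     add = (\<lambda>a b. (fst a \<oplus>\<^bsub>S\<^esub> fst b, plusM (snd a) (snd b)))\<rparr>"

lemma triv_ext_simps [simp]:
  "carrier triv_ext = carrier S \<times> BM"
  "(s, F) \<otimes>\<^bsub>triv_ext\<^esub> (s', F') = (s \<otimes>\<^bsub>S\<^esub> s', plusM (leftM s F') (rightM F s'))"
  "(s, F) \<oplus>\<^bsub>triv_ext\<^esub> (s', F') = (s \<oplus>\<^bsub>S\<^esub> s', plusM F F')"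
  "\<one>\<^bsub>triv_ext\<^esub> = (\<one>\<^bsub>S\<^esub>, zeroM)" "\<zero>\<^bsub>triv_ext\<^esub> = (\<zero>\<^bsub>S\<^esub>, zeroM)"
  by (simp_all add: triv_ext_def)

lemma ring_triv_ext: "ring triv_ext"
proof (rule ringI)
  show "abelian_group triv_ext"
  proof (rule abelian_groupI)
    fix a b c assume "a \<in> carrier triv_ext" "b \<in> carrier triv_ext" "c \<in> carrier triv_ext"
    then obtain s F s' F' s'' F'' where "a = (s, F)" "b = (s', F')" "c = (s'', F'')"
      "s \<in> carrier S" "s' \<in> carrier S" "s'' \<in> carrier S" and F: "F \<in> BM" "F' \<in> BM" "F'' \<in> BM" by auto
    moreover have "plusM (plusM F F') F'' = plusM F (plusM F' F'')"
      using F by (intro BM_eqI) (simp_all add: M_apply BM_D A.m_assoc)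
    ultimately show "a \<oplus>\<^bsub>triv_ext\<^esub> b \<oplus>\<^bsub>triv_ext\<^esub> c = a \<oplus>\<^bsub>triv_ext\<^esub> (b \<oplus>\<^bsub>triv_ext\<^esub> c)" by (simp add: S.a_assoc)
  next
    fix a b assume "a \<in> carrier triv_ext" "b \<in> carrier triv_ext"
    then obtain s F s' F' where "a = (s, F)" "b = (s', F')"
      "s \<in> carrier S" "s' \<in> carrier S" and F: "F \<in> BM" "F' \<in> BM" by auto
    moreover have "plusM F F' = plusM F' F"
      using F by (intro BM_eqI) (simp_all add: M_apply BM_D A.m_comm)
    ultimately show "a \<oplus>\<^bsub>triv_ext\<^esub> b = b \<oplus>\<^bsub>triv_ext\<^esub> a" "a \<oplus>\<^bsub>triv_ext\<^esub> b \<in> carrier triv_ext"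
      by (simp_all add: S.a_comm)
  next
    fix a assume "a \<in> carrier triv_ext"
    then obtain s F where a: "a = (s, F)" "s \<in> carrier S" and F: "F \<in> BM" by auto
    have "plusM zeroM F = F" using F by (intro BM_eqI) (simp_all add: M_apply BM_D)
    then show "\<zero>\<^bsub>triv_ext\<^esub> \<oplus>\<^bsub>triv_ext\<^esub> a = a" using a by simp
    have "plusM (uminusM F) F = zeroM" using F by (intro BM_eqI) (simp_all add: M_apply BM_D)
    then show "\<exists>b\<in>carrier triv_ext. b \<oplus>\<^bsub>triv_ext\<^esub> a = \<zero>\<^bsub>triv_ext\<^esub>"
      using a F by (intro bexI[of _ "(\<ominus>\<^bsub>S\<^esub> s, uminusM F)"]) (simp_all add: S.l_neg)
  qed simp
  show "monoid triv_ext"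
  proof (rule monoidI)
    fix a b assume "a \<in> carrier triv_ext" "b \<in> carrier triv_ext"
    then show "a \<otimes>\<^bsub>triv_ext\<^esub> b \<in> carrier triv_ext" by auto
  next
    fix a b c assume "a \<in> carrier triv_ext" "b \<in> carrier triv_ext" "c \<in> carrier triv_ext"
    then obtain s F s' F' s'' F'' where abc: "a = (s, F)" "b = (s', F')" "c = (s'', F'')"
      "s \<in> carrier S" "s' \<in> carrier S" "s'' \<in> carrier S" and F: "F \<in> BM" "F' \<in> BM" "F'' \<in> BM" by auto
    moreover have "plusM (leftM (s \<otimes>\<^bsub>S\<^esub> s') F'') (rightM (plusM (leftM s F') (rightM F s')) s'')
        = plusM (leftM s (plusM (leftM s' F'') (rightM F' s''))) (rightM F (s' \<otimes>\<^bsub>S\<^esub> s''))"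
      using abc(4-6) F by (intro BM_eqI) (simp_all add: M_apply BM_D A.m_assoc S.m_assoc)
    ultimately show "a \<otimes>\<^bsub>triv_ext\<^esub> b \<otimes>\<^bsub>triv_ext\<^esub> c = a \<otimes>\<^bsub>triv_ext\<^esub> (b \<otimes>\<^bsub>triv_ext\<^esub> c)" by (simp add: S.m_assoc)
  next
    fix a assume "a \<in> carrier triv_ext"
    then obtain s F where a: "a = (s, F)" "s \<in> carrier S" and F: "F \<in> BM" by auto
    have "plusM (leftM \<one>\<^bsub>S\<^esub> F) (rightM zeroM s) = F" "plusM (leftM s zeroM) (rightM F \<one>\<^bsub>S\<^esub>) = F"
      using F a by (intro BM_eqI; simp add: M_apply BM_D)+
    then show "\<one>\<^bsub>triv_ext\<^esub> \<otimes>\<^bsub>triv_ext\<^esub> a = a" "a \<otimes>\<^bsub>triv_ext\<^esub> \<one>\<^bsub>triv_ext\<^esub> = a" using a by simp_all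
  qed simp
  fix a b c assume "a \<in> carrier triv_ext" "b \<in> carrier triv_ext" "c \<in> carrier triv_ext"
  then obtain s F s' F' s'' F'' where abc: "a = (s, F)" "b = (s', F')" "c = (s'', F'')"
    "s \<in> carrier S" "s' \<in> carrier S" "s'' \<in> carrier S" and F: "F \<in> BM" "F' \<in> BM" "F'' \<in> BM" by auto
  have "plusM (leftM (s \<oplus>\<^bsub>S\<^esub> s') F'') (rightM (plusM F F') s'')
      = plusM (plusM (leftM s F'') (rightM F s'')) (plusM (leftM s' F'') (rightM F' s''))"
    using abc(4-6) F by (intro BM_eqI) (simp_all add: M_apply BM_D A.m_ac S.r_distr)
  then show "(a \<oplus>\<^bsub>triv_ext\<^esub> b) \<otimes>\<^bsub>triv_ext\<^esub> c = a \<otimes>\<^bsub>triv_ext\<^esub> c \<oplus>\<^bsub>triv_ext\<^esub> b \<otimes>\<^bsub>triv_ext\<^esub> c"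
    using abc by (simp add: S.l_distr)
  have "plusM (leftM s'' (plusM F F')) (rightM F'' (s \<oplus>\<^bsub>S\<^esub> s'))
      = plusM (plusM (leftM s'' F) (rightM F'' s)) (plusM (leftM s'' F') (rightM F'' s'))"
    using abc(4-6) F by (intro BM_eqI) (simp_all add: M_apply BM_D A.m_ac S.l_distr)
  then show "c \<otimes>\<^bsub>triv_ext\<^esub> (a \<oplus>\<^bsub>triv_ext\<^esub> b) = c \<otimes>\<^bsub>triv_ext\<^esub> a \<oplus>\<^bsub>triv_ext\<^esub> c \<otimes>\<^bsub>triv_ext\<^esub> b"
    using abc by (simp add: S.r_distr)
qed

end

text \<open>In terms of tensor products: \<open>t \<otimes> y = 1 \<otimes> t y\<close> in \<open>S \<otimes>\<^sub>R S\<close>. The derivation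
  \<open>t \<mapsto> t B - B t\<close> vanishes on \<open>R\<close>, so \<open>t \<mapsto> (t, t B - B t)\<close> and \<open>t \<mapsto> (t, 0)\<close> are ring
  homomorphisms into the trivial extension that agree on \<open>R\<close>.\<close>

lemma ring_epi_balanced:
  assumes epi: "ring_epi R S \<phi>" and S: "ring S" and A: "comm_group A"
    and B: "\<And>x y. x \<in> carrier S \<Longrightarrow> y \<in> carrier S \<Longrightarrow> B x y \<in> carrier A"
    and l: "\<And>x x' y. x \<in> carrier S \<Longrightarrow> x' \<in> carrier S \<Longrightarrow> y \<in> carrier S \<Longrightarrow> B (x \<oplus>\<^bsub>S\<^esub> x') y = B x y \<otimes>\<^bsub>A\<^esub> B x' y"
    and r: "\<And>x y y'. x \<in> carrier S \<Longrightarrow> y \<in> carrier S \<Longrightarrow> y' \<in> carrier S \<Longrightarrow> B x (y \<oplus>\<^bsub>S\<^esub> y') = B x y \<otimes>\<^bsub>A\<^esub> B x y'"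
    and balanced: "\<And>r x y. r \<in> carrier R \<Longrightarrow> x \<in> carrier S \<Longrightarrow> y \<in> carrier S \<Longrightarrow> B (x \<otimes>\<^bsub>S\<^esub> \<phi> r) y = B x (\<phi> r \<otimes>\<^bsub>S\<^esub> y)"
    and t: "t \<in> carrier S" "y \<in> carrier S"
  shows "B t y = B \<one>\<^bsub>S\<^esub> (t \<otimes>\<^bsub>S\<^esub> y)"
proof -
  interpret biadditive_maps S A by (intro biadditive_maps.intro S A)
  have hom\<phi>: "\<phi> \<in> ring_hom R S" using epi by (simp add: ring_epi_def)
  define F where "F = (\<lambda>p\<in>carrier S \<times> carrier S. B (fst p) (snd p))"
  have F: "F \<in> BM" unfolding F_def by (rule BM_I) (simp_all add: B l r)
  have F_apply: "F (x, y) = B x y" if "x \<in> carrier S" "y \<in> carrier S" for x y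
    using that by (simp add: F_def)
  define d where "d s = plusM (leftM s F) (uminusM (rightM F s))" for s
  have d: "d s \<in> BM" if "s \<in> carrier S" for s using that F by (simp add: d_def)
  have d_apply: "d s (x, y) = B (x \<otimes>\<^bsub>S\<^esub> s) y \<otimes>\<^bsub>A\<^esub> inv\<^bsub>A\<^esub> B x (s \<otimes>\<^bsub>S\<^esub> y)"
    if "s \<in> carrier S" "x \<in> carrier S" "y \<in> carrier S" for s x y
    using that by (simp add: d_def M_apply F_apply)
  have g: "(\<lambda>s. (s, zeroM)) \<in> ring_hom S triv_ext"
  proof (rule ring_hom_memI)
    fix s s' assume s: "s \<in> carrier S" "s' \<in> carrier S"
    have "plusM (leftM s zeroM) (rightM zeroM s') = zeroM"
      using s by (intro BM_eqI) (simp_all add: M_apply)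
    then show "(s \<otimes>\<^bsub>S\<^esub> s', zeroM) = (s, zeroM) \<otimes>\<^bsub>triv_ext\<^esub> (s', zeroM)" by simp
    have "plusM zeroM zeroM = zeroM" by (intro BM_eqI) (simp_all add: M_apply)
    then show "(s \<oplus>\<^bsub>S\<^esub> s', zeroM) = (s, zeroM) \<oplus>\<^bsub>triv_ext\<^esub> (s', zeroM)" by simp
  qed simp_all
  have h: "(\<lambda>s. (s, d s)) \<in> ring_hom S triv_ext"
  proof (rule ring_hom_memI)
    show "(s, d s) \<in> carrier triv_ext" if "s \<in> carrier S" for s using that d by simp
    fix s s' assume s: "s \<in> carrier S" "s' \<in> carrier S"
    have "d (s \<otimes>\<^bsub>S\<^esub> s') = plusM (leftM s (d s')) (rightM (d s) s')"
    proof (rule BM_eqI)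
      fix x y assume xy: "x \<in> carrier S" "y \<in> carrier S"
      \<comment> \<open>Leibniz rule: the mixed term \<open>b\<close> occurs with both signs and
        cancels.\<close>
      define a b c where "a = B (x \<otimes>\<^bsub>S\<^esub> s \<otimes>\<^bsub>S\<^esub> s') y" and "b = B (x \<otimes>\<^bsub>S\<^esub> s) (s' \<otimes>\<^bsub>S\<^esub> y)" and "c = B x (s \<otimes>\<^bsub>S\<^esub> (s' \<otimes>\<^bsub>S\<^esub> y))"
      have abc: "a \<in> carrier A" "b \<in> carrier A" "c \<in> carrier A" using s xy by (simp_all add: a_def b_def c_def B)
      have "plusM (leftM s (d s')) (rightM (d s) s') (x, y) = (a \<otimes>\<^bsub>A\<^esub> inv\<^bsub>A\<^esub> b) \<otimes>\<^bsub>A\<^esub> (b \<otimes>\<^bsub>A\<^esub> inv\<^bsub>A\<^esub> c)"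
        using s xy by (simp add: M_apply d_apply a_def b_def c_def)
      also have "\<dots> = a \<otimes>\<^bsub>A\<^esub> inv\<^bsub>A\<^esub> c"
      proof -
        have "inv\<^bsub>A\<^esub> b \<otimes>\<^bsub>A\<^esub> (b \<otimes>\<^bsub>A\<^esub> inv\<^bsub>A\<^esub> c) = inv\<^bsub>A\<^esub> c"
          using abc by (simp flip: A.m_assoc)
        then show ?thesis using abc by (simp add: A.m_assoc)
      qed
      also have "\<dots> = d (s \<otimes>\<^bsub>S\<^esub> s') (x, y)"
        using s xy by (simp add: d_apply a_def c_def S.m_assoc)
      finally show "d (s \<otimes>\<^bsub>S\<^esub> s') (x, y) = plusM (leftM s (d s')) (rightM (d s) s') (x, y)" by (rule sym)
    qed (use s d in simp_all)
    then show "(s \<otimes>\<^bsub>S\<^esub> s', d (s \<otimes>\<^bsub>S\<^esub> s')) = (s, d s) \<otimes>\<^bsub>triv_ext\<^esub> (s', d s')" by simp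
    have "d (s \<oplus>\<^bsub>S\<^esub> s') = plusM (d s) (d s')"
      using s d by (intro BM_eqI) (simp_all add: M_apply d_apply S.l_distr S.r_distr l r B A.inv_mult A.m_ac)
    then show "(s \<oplus>\<^bsub>S\<^esub> s', d (s \<oplus>\<^bsub>S\<^esub> s')) = (s, d s) \<oplus>\<^bsub>triv_ext\<^esub> (s', d s')" by simp
  next
    have "d \<one>\<^bsub>S\<^esub> = zeroM"
      using d[of "\<one>\<^bsub>S\<^esub>"] by (intro BM_eqI) (simp_all add: M_apply d_apply B)
    then show "(\<one>\<^bsub>S\<^esub>, d \<one>\<^bsub>S\<^esub>) = \<one>\<^bsub>triv_ext\<^esub>" by simp
  qed
  have "(t, zeroM) = (t, d t)"
  proof (rule ring_epi_cancel[OF epi ring_triv_ext g h _ t(1)])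
    fix q assume q: "q \<in> carrier R"
    have "\<phi> q \<in> carrier S" using ring_hom_closed[OF hom\<phi> q] .
    then have "d (\<phi> q) = zeroM"
      using d[of "\<phi> q"] q by (intro BM_eqI) (simp_all add: M_apply d_apply B balanced)
    then show "(\<phi> q, zeroM) = (\<phi> q, d (\<phi> q))" by simp
  qed
  \<comment> \<open>With first argument one, the derivation at \<open>t\<close> is the difference of
    \<open>B t y\<close> and \<open>B 1 (t y)\<close>.\<close>
  then have "zeroM (\<one>\<^bsub>S\<^esub>, y) = d t (\<one>\<^bsub>S\<^esub>, y)" by simp
  then have "\<one>\<^bsub>A\<^esub> = B t y \<otimes>\<^bsub>A\<^esub> inv\<^bsub>A\<^esub> B \<one>\<^bsub>S\<^esub> (t \<otimes>\<^bsub>S\<^esub> y)"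
    using t by (simp add: M_apply d_apply)
  moreover have c: "B t y \<in> carrier A" "B \<one>\<^bsub>S\<^esub> (t \<otimes>\<^bsub>S\<^esub> y) \<in> carrier A" using t by (simp_all add: B)
  ultimately have "B t y = \<one>\<^bsub>A\<^esub> \<otimes>\<^bsub>A\<^esub> B \<one>\<^bsub>S\<^esub> (t \<otimes>\<^bsub>S\<^esub> y)"
    using A.inv_solve_right[OF A.one_closed c] by - (rule iffD1)
  then show ?thesis using c by simp
qed

text \<open>Apply \<open>ring_epi_balanced\<close> at \<open>y = 1\<close> to
  \<open>B x y = x \<phi>(r) y\<close>, which is balanced because \<open>R\<close> is commutative.
  The map \<open>\<rho>\<close> below is only left linear, so scalars on the right have to be
  moved.\<close>

lemma ring_epi_central:
  assumes R: "cring R" and S: "ring S" and epi: "ring_epi R S \<phi>" and r: "r \<in> carrier R" and t: "t \<in> carrier S"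
  shows "t \<otimes>\<^bsub>S\<^esub> \<phi> r = \<phi> r \<otimes>\<^bsub>S\<^esub> t"
proof -
  interpret R: cring R by fact
  interpret S: ring S by fact
  have \<phi>: "\<phi> \<in> ring_hom R S" using epi by (simp add: ring_epi_def)
  note \<phi>c = ring_hom_closed[OF \<phi>]
  have comm: "\<phi> q \<otimes>\<^bsub>S\<^esub> \<phi> r = \<phi> r \<otimes>\<^bsub>S\<^esub> \<phi> q" if "q \<in> carrier R" for q
    using ring_hom_mult[OF \<phi>] that r by (metis R.m_comm)
  have "t \<otimes>\<^bsub>S\<^esub> \<phi> r \<otimes>\<^bsub>S\<^esub> \<one>\<^bsub>S\<^esub> = \<one>\<^bsub>S\<^esub> \<otimes>\<^bsub>S\<^esub> \<phi> r \<otimes>\<^bsub>S\<^esub> (t \<otimes>\<^bsub>S\<^esub> \<one>\<^bsub>S\<^esub>)"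
  proof (rule ring_epi_balanced[OF epi S S.a_comm_group])
    fix q x y assume *: "q \<in> carrier R" "x \<in> carrier S" "y \<in> carrier S"
    have "x \<otimes>\<^bsub>S\<^esub> \<phi> q \<otimes>\<^bsub>S\<^esub> \<phi> r \<otimes>\<^bsub>S\<^esub> y = x \<otimes>\<^bsub>S\<^esub> (\<phi> q \<otimes>\<^bsub>S\<^esub> \<phi> r) \<otimes>\<^bsub>S\<^esub> y"
      using * r \<phi>c by (simp add: S.m_assoc)
    also have "\<dots> = x \<otimes>\<^bsub>S\<^esub> \<phi> r \<otimes>\<^bsub>S\<^esub> (\<phi> q \<otimes>\<^bsub>S\<^esub> y)"
      unfolding comm[OF *(1)] using * r \<phi>c by (simp add: S.m_assoc)
    finally show "x \<otimes>\<^bsub>S\<^esub> \<phi> q \<otimes>\<^bsub>S\<^esub> \<phi> r \<otimes>\<^bsub>S\<^esub> y = x \<otimes>\<^bsub>S\<^esub> \<phi> r \<otimes>\<^bsub>S\<^esub> (\<phi> q \<otimes>\<^bsub>S\<^esub> y)" .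
  qed (use r t \<phi>c in \<open>simp_all add: S.l_distr S.r_distr\<close>)
  then show ?thesis using r t \<phi>c by simp
qed


section \<open>The maximal flat epimorphic ring of quotients\<close>

context cring
begin

lemma flat_epi_ext_Q_cl: "flat_epi_ext TYPE('m) R Q \<iota>"
  unfolding flat_epi_ext_def
  by (intro conjI cring.axioms(1)[OF cring_Q_cl] Q_cl_map_hom inj_on_Q_cl_map ring_epi_Q_cl flat_module_Q_cl)

end

context fractional_homs
begin

text \<open>Since \<open>Q\<close> is an injective \<open>R\<close>-module, \<open>R \<rightarrow> Q\<close> extends to an \<open>R\<close>-linear map \<open>\<rho> : S \<rightarrow> Q\<close>.
  It is multiplicative by lemma \<open>ring_epi_balanced\<close> for \<open>\<rho> x \<rho> y\<close>. For \<open>y \<otimes> \<rho> x\<close> in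
  \<open>S \<otimes>\<^sub>R Q\<close>, the lemma shows that an element of the kernel is killed by a non-zero-divisor of \<open>R\<close>,
  and \<open>S\<close> is torsion-free by flatness.\<close>

lemma flat_epi_ext_embeds:
  fixes S :: "'s ring"
  assumes S: "flat_epi_ext TYPE('a) R S \<phi>"
  shows "\<exists>h. homs_over R S \<phi> Q \<iota> = {h} \<and> inj_on h (carrier S)"
proof -
  have ringS: "ring S" and \<phi>: "\<phi> \<in> ring_hom R S" and inj: "inj_on \<phi> (carrier R)"
    and epi: "ring_epi R S \<phi>" and flat: "flat_module TYPE('a) R (restrict_scalars \<phi> S)"
    using S by (simp_all add: flat_epi_ext_def)
  interpret S: ring S by (rule ringS)
  interpret Q: cring Q by (rule cring_Q_cl)
  let ?S = "restrict_scalars \<phi> S"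
  have modS: "Module.module R ?S" by (rule module_restrict_scalars[OF is_cring ringS \<phi>])
  note \<phi>s = ring_hom_closed[OF \<phi>] ring_hom_mult[OF \<phi>] ring_hom_add[OF \<phi>] ring_hom_one[OF \<phi>]
  define f where "f x = \<iota> (inv_into (carrier R) \<phi> x)" for x
  have f: "f (\<phi> r) = \<iota> r" if "r \<in> carrier R" for r using that inj by (simp add: f_def)
  have "\<exists>\<rho>\<in>module_hom R ?S Q_mod. \<forall>x\<in>\<phi> ` carrier R. \<rho> x = f x"
  proof (rule baer_extension[OF modS module_Q_cl baer_Q_mod])
    show "\<phi> ` carrier R \<subseteq> carrier ?S" using \<phi>s(1) by auto
    have "\<phi> \<zero> = \<zero>\<^bsub>S\<^esub>" by (rule ring_hom_zero[OF \<phi> ring_axioms ringS])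
    then show "\<zero>\<^bsub>?S\<^esub> \<in> \<phi> ` carrier R" by (intro image_eqI[of _ _ \<zero>]) simp_all
    show "f x \<in> carrier Q_mod" if "x \<in> \<phi> ` carrier R" for x using that f by auto
  next
    fix x y assume "x \<in> \<phi> ` carrier R" "y \<in> \<phi> ` carrier R"
    then obtain a b where ab: "a \<in> carrier R" "b \<in> carrier R" "x = \<phi> a" "y = \<phi> b" by (elim imageE)
    have xy: "x \<oplus>\<^bsub>S\<^esub> y = \<phi> (a \<oplus> b)" using ab by (simp add: \<phi>s(3))
    show "x \<oplus>\<^bsub>?S\<^esub> y \<in> \<phi> ` carrier R" using xy ab by (intro image_eqI[of _ _ "a \<oplus> b"]) simp_all
    show "f (x \<oplus>\<^bsub>?S\<^esub> y) = f x \<oplus>\<^bsub>Q_mod\<^esub> f y"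
      using ab by (simp flip: \<phi>s(3) add: f Q_cl_map_simps)
  next
    fix r x assume r: "r \<in> carrier R" and "x \<in> \<phi> ` carrier R"
    then obtain a where a: "a \<in> carrier R" "x = \<phi> a" by (elim imageE)
    have rx: "\<phi> r \<otimes>\<^bsub>S\<^esub> x = \<phi> (r \<otimes> a)" using a r by (simp add: \<phi>s(2))
    show "r \<odot>\<^bsub>?S\<^esub> x \<in> \<phi> ` carrier R" using rx a r by (intro image_eqI[of _ _ "r \<otimes> a"]) simp_all
    show "f (r \<odot>\<^bsub>?S\<^esub> x) = r \<odot>\<^bsub>Q_mod\<^esub> f x"
      using a r by (simp flip: \<phi>s(2) add: f Q_cl_map_simps)
  qed
  then obtain \<rho> where \<rho>: "\<rho> \<in> module_hom R ?S Q_mod" and \<rho>\<phi>: "\<forall>x\<in>\<phi> ` carrier R. \<rho> x = f x" by (rule bexE)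
  note \<rho>s = module_homD[OF \<rho>, simplified]
  have \<rho>r: "\<rho> (\<phi> r) = \<iota> r" if "r \<in> carrier R" for r using \<rho>\<phi> that f by simp
  have \<rho>1: "\<rho> \<one>\<^bsub>S\<^esub> = \<one>\<^bsub>Q\<^esub>" using \<rho>r[of \<one>] by (simp add: \<phi>s(4) Q_cl_map_simps)
  have central: "x \<otimes>\<^bsub>S\<^esub> \<phi> r = \<phi> r \<otimes>\<^bsub>S\<^esub> x" if "r \<in> carrier R" "x \<in> carrier S" for r x
    by (rule ring_epi_central[OF is_cring ringS epi that])
  have mult: "\<rho> (x \<otimes>\<^bsub>S\<^esub> y) = \<rho> x \<otimes>\<^bsub>Q\<^esub> \<rho> y" if xy: "x \<in> carrier S" "y \<in> carrier S" for x y
  proof -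
    have "\<rho> x \<otimes>\<^bsub>Q\<^esub> \<rho> y = \<rho> \<one>\<^bsub>S\<^esub> \<otimes>\<^bsub>Q\<^esub> \<rho> (x \<otimes>\<^bsub>S\<^esub> y)"
    proof (rule ring_epi_balanced[OF epi ringS Q.a_comm_group])
      fix r x y assume *: "r \<in> carrier R" "x \<in> carrier S" "y \<in> carrier S"
      then show "\<rho> (x \<otimes>\<^bsub>S\<^esub> \<phi> r) \<otimes>\<^bsub>Q\<^esub> \<rho> y = \<rho> x \<otimes>\<^bsub>Q\<^esub> \<rho> (\<phi> r \<otimes>\<^bsub>S\<^esub> y)"
        by (simp add: central \<rho>s(1,3) Q.m_ac)
    qed (use xy in \<open>simp_all add: \<rho>s(1,2) Q.l_distr Q.r_distr\<close>)
    then show ?thesis using xy by (simp add: \<rho>1 \<rho>s(1))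
  qed
  have \<rho>_hom: "\<rho> \<in> ring_hom S Q"
    by (rule ring_hom_memI) (simp_all add: \<rho>s(1,2) mult \<rho>1)
  interpret SQ: tensor_pair R ?S Q_mod by (intro tensor_pair.intro modS module_Q_cl)
  let ?A = "tensor_product R ?S Q_mod"
  let ?c = "\<lambda>x q. SQ.H #>\<^bsub>SQ.G\<^esub> frag_of (x, q)"
  have kernel: "x = \<zero>\<^bsub>S\<^esub>" if x: "x \<in> carrier S" "\<rho> x = \<zero>\<^bsub>Q\<^esub>" for x
  proof -
    \<comment> \<open>Here \<open>B x y = y \<otimes> \<rho> x\<close>, with the factors swapped so
      that the first argument is the one fed to \<open>\<rho>\<close>. The conclusion
      \<open>1 \<otimes> \<rho> x = x \<otimes> 1\<close> turns \<open>\<rho> x = 0\<close> into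
      \<open>x \<otimes> 1 = 0\<close>.\<close>
    have "?c \<one>\<^bsub>S\<^esub> (\<rho> x) = ?c (x \<otimes>\<^bsub>S\<^esub> \<one>\<^bsub>S\<^esub>) (\<rho> \<one>\<^bsub>S\<^esub>)"
    proof (rule ring_epi_balanced[OF epi ringS SQ.comm_group_tensor_product, where B = "\<lambda>x y. ?c y (\<rho> x)"])
      fix x y assume "x \<in> carrier S" "y \<in> carrier S"
      then show "?c y (\<rho> x) \<in> carrier ?A"
        unfolding SQ.carrier_tensor_product by (intro imageI) (simp add: \<rho>s(1))
    next
      fix x x' y assume *: "x \<in> carrier S" "x' \<in> carrier S" "y \<in> carrier S"
      have "?c y (\<rho> x) \<otimes>\<^bsub>?A\<^esub> ?c y (\<rho> x') = SQ.H #>\<^bsub>SQ.G\<^esub> (frag_of (y, \<rho> x) + frag_of (y, \<rho> x'))"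
        by (rule SQ.tensor_product_mult) (use * in \<open>simp_all add: \<rho>s(1)\<close>)
      also have "\<dots> = ?c y (\<rho> (x \<oplus>\<^bsub>S\<^esub> x'))"
        using SQ.H_uminus[OF SQ.H_r_distr[of y "\<rho> x" "\<rho> x'"]] * \<rho>s(1,2)
        unfolding SQ.coset_eq_iff by (simp add: algebra_simps)
      finally show "?c y (\<rho> (x \<oplus>\<^bsub>S\<^esub> x')) = ?c y (\<rho> x) \<otimes>\<^bsub>?A\<^esub> ?c y (\<rho> x')" by (rule sym)
    next
      fix x y y' assume *: "x \<in> carrier S" "y \<in> carrier S" "y' \<in> carrier S"
      have "?c y (\<rho> x) \<otimes>\<^bsub>?A\<^esub> ?c y' (\<rho> x) = SQ.H #>\<^bsub>SQ.G\<^esub> (frag_of (y, \<rho> x) + frag_of (y', \<rho> x))"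
        by (rule SQ.tensor_product_mult) (use * in \<open>simp_all add: \<rho>s(1)\<close>)
      also have "\<dots> = ?c (y \<oplus>\<^bsub>S\<^esub> y') (\<rho> x)"
        using SQ.H_uminus[OF SQ.H_l_distr[of y y' "\<rho> x"]] * \<rho>s(1)
        unfolding SQ.coset_eq_iff by (simp add: algebra_simps)
      finally show "?c (y \<oplus>\<^bsub>S\<^esub> y') (\<rho> x) = ?c y (\<rho> x) \<otimes>\<^bsub>?A\<^esub> ?c y' (\<rho> x)" by (rule sym)
    next
      fix r x y assume *: "r \<in> carrier R" "x \<in> carrier S" "y \<in> carrier S"
      show "?c y (\<rho> (x \<otimes>\<^bsub>S\<^esub> \<phi> r)) = ?c (\<phi> r \<otimes>\<^bsub>S\<^esub> y) (\<rho> x)"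
        using SQ.H_uminus[OF SQ.H_smult[of r y "\<rho> x"]] * \<rho>s(1)
        unfolding SQ.coset_eq_iff by (simp add: central \<rho>s(3))
    qed (use x in simp_all)
    then have "frag_of (\<one>\<^bsub>S\<^esub>, \<zero>\<^bsub>Q\<^esub>) - frag_of (x, \<one>\<^bsub>Q\<^esub>) \<in> SQ.H"
      unfolding SQ.coset_eq_iff using x by (simp add: \<rho>1)
    from SQ.H_diff[OF SQ.H_zero_r[of "\<one>\<^bsub>S\<^esub>"] this] have "frag_of (x, fraction R \<one> \<one>) \<in> SQ.H"
      by (simp add: Q_cl_one)
    from tensor_Q_eq_zero[OF modS _ one_nzd this] x(1)
    obtain t where "t \<in> nzd" "t \<odot>\<^bsub>?S\<^esub> x = \<zero>\<^bsub>?S\<^esub>" by auto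
    from flat_module_torsion_free[OF flat this(1) _ this(2)] x(1) show ?thesis by simp
  qed
  have "inj_on \<rho> (carrier S)"
  proof (rule inj_onI)
    fix x y assume xy: "x \<in> carrier S" "y \<in> carrier S" "\<rho> x = \<rho> y"
    have "\<rho> (x \<ominus>\<^bsub>S\<^esub> y) \<oplus>\<^bsub>Q\<^esub> \<rho> y = \<rho> y"
      using \<rho>s(2)[of "x \<ominus>\<^bsub>S\<^esub> y" y] xy by (simp add: S.minus_eq S.a_assoc S.l_neg)
    then have "\<rho> (x \<ominus>\<^bsub>S\<^esub> y) = \<zero>\<^bsub>Q\<^esub>" using \<rho>s(1) xy(1,2) by (simp add: Q.add.r_cancel_one)
    with kernel[of "x \<ominus>\<^bsub>S\<^esub> y"] xy show "x = y" by simp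
  qed
  moreover have "homs_over R S \<phi> Q \<iota> = {\<rho>}"
  proof (rule Set.set_eqI, rule iffI)
    fix g assume "g \<in> homs_over R S \<phi> Q \<iota>"
    then have g: "g \<in> ring_hom S Q" "g \<in> extensional (carrier S)" "\<forall>r\<in>carrier R. g (\<phi> r) = \<iota> r"
      by (auto simp: homs_over_def)
    have "g s = \<rho> s" if "s \<in> carrier S" for s
      by (rule ring_epi_cancel[OF epi Q.ring_axioms g(1) \<rho>_hom _ that]) (simp add: g(3) \<rho>r)
    then have "g = \<rho>" using g(2) \<rho>s(4) by (intro extensionalityI[of _ "carrier S"]) simp_all
    then show "g \<in> {\<rho>}" by simp
  next
    fix g assume "g \<in> {\<rho>}"
    then show "g \<in> homs_over R S \<phi> Q \<iota>" using \<rho>_hom \<rho>s(4) \<rho>r by (simp add: homs_over_def)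
  qed
  ultimately show ?thesis by (intro exI[of _ \<rho>] conjI)
qed

lemma is_Q_tot_Q_cl: "is_Q_tot TYPE('m) TYPE('s) R Q \<iota>"
  unfolding is_Q_tot_def by (intro conjI allI impI flat_epi_ext_Q_cl flat_epi_ext_embeds)

text \<open>Both extensions are epimorphic and each maps to the other over \<open>R\<close>, so the
  composites are identities. The universal property of \<open>T\<close> is applied to
  \<open>Q\<close> alone, hence the element type of \<open>Q\<close> in the hypothesis.\<close>

lemma coincide_Q_tot:
  fixes T :: "'s ring"
  assumes T: "is_Q_tot TYPE('a) TYPE(('a \<times> 'a) set) R T \<tau>"
  shows "coincide_over R Q \<iota> T \<tau>"
proof -
  have flatT: "flat_epi_ext TYPE('a) R T \<tau>" using T by (simp add: is_Q_tot_def)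
  then have ringT: "ring T" and epiT: "ring_epi R T \<tau>" by (simp_all add: flat_epi_ext_def)
  have "flat_epi_ext TYPE('a) R Q \<iota>" by (rule flat_epi_ext_Q_cl)
  then have "\<exists>h. homs_over R Q \<iota> T \<tau> = {h} \<and> inj_on h (carrier Q)"
    using T unfolding is_Q_tot_def by simp
  then obtain h where h: "homs_over R Q \<iota> T \<tau> = {h}" by (elim exE conjE)
  obtain k where k: "homs_over R T \<tau> Q \<iota> = {k}" using flat_epi_ext_embeds[OF flatT] by (elim exE conjE)
  have h': "h \<in> ring_hom Q T" "\<forall>r\<in>carrier R. h (\<iota> r) = \<tau> r"
    using h unfolding homs_over_def by auto
  have k': "k \<in> ring_hom T Q" "\<forall>r\<in>carrier R. k (\<tau> r) = \<iota> r"
    using k unfolding homs_over_def by auto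
  note ringQ = cring.axioms(1)[OF cring_Q_cl]
  have id_hom: "(\<lambda>x. x) \<in> ring_hom A A" for A :: "('x, 'y) ring_scheme" by (auto simp: ring_hom_def)
  have kh: "(k \<circ> h) q = q" if "q \<in> carrier Q" for q
    by (rule ring_epi_cancel[OF ring_epi_Q_cl ringQ ring_hom_trans[OF h'(1) k'(1)] id_hom _ that])
      (simp add: h'(2) k'(2))
  have hk: "(h \<circ> k) q = q" if "q \<in> carrier T" for q
    by (rule ring_epi_cancel[OF epiT ringT ring_hom_trans[OF k'(1) h'(1)] id_hom _ that])
      (simp add: h'(2) k'(2))
  have "bij_betw h (carrier Q) (carrier T)"
    by (rule bij_betwI[of _ _ _ k])
      (use kh hk ring_hom_closed[OF h'(1)] ring_hom_closed[OF k'(1)] in auto)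
  then show ?thesis using h h'(1) unfolding coincide_over_def ring_iso_def by auto
qed

end

section \<open>The rings of continuously differentiable functions\<close>

lemma C_fin_0: "f \<in> C_fin 0 \<longleftrightarrow> continuous_on UNIV f"
  by (simp add: C_fin_def)

text \<open>Recursive form for inductions on the order. Continuity of \<open>f\<close> itself
  follows from differentiability.\<close>

lemma C_fin_Suc:
  "f \<in> C_fin (Suc n) \<longleftrightarrow> (\<forall>x. f differentiable (at x)) \<and> deriv f \<in> C_fin n"
proof -
  have less: "(\<forall>j<Suc n. P j) \<longleftrightarrow> P 0 \<and> (\<forall>j<n. P (Suc j))"
    and le: "(\<forall>j\<le>Suc n. P j) \<longleftrightarrow> P 0 \<and> (\<forall>j\<le>n. P (Suc j))" for P
    by (simp add: All_less_Suc2) (metis Suc_le_mono le0 not0_implies_Suc)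
  have "f \<in> C_fin (Suc n) \<longleftrightarrow> (\<forall>x. f differentiable (at x)) \<and> continuous_on UNIV f \<and> deriv f \<in> C_fin n"
    unfolding C_fin_def mem_Collect_eq less le funpow_Suc_right comp_apply funpow_0 by blast
  moreover have "continuous_on UNIV f" if "\<forall>x. f differentiable (at x)"
    using that by (simp add: differentiable_imp_continuous_within continuous_at_imp_continuous_on)
  ultimately show ?thesis by blast
qed

lemma deriv_if_has_deriv: "(\<And>x. (f has_real_derivative f' x) (at x)) \<Longrightarrow> deriv f = f'"
  by (auto intro: DERIV_imp_deriv)

lemma C_fin_SucI:
  assumes "\<And>x. (f has_real_derivative f' x) (at x)" "f' \<in> C_fin n"
  shows "f \<in> C_fin (Suc n)"
  using assms deriv_if_has_deriv[OF assms(1)]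
  by (auto simp: C_fin_Suc real_differentiable_def)

lemma C_fin_SucD:
  assumes "f \<in> C_fin (Suc n)"
  shows "(f has_real_derivative deriv f x) (at x)" "deriv f \<in> C_fin n"
  using assms by (auto simp: C_fin_Suc DERIV_deriv_iff_real_differentiable)

lemma C_fin_Suc_subset: "C_fin (Suc n) \<subseteq> C_fin n"
  by (auto simp: C_fin_def)

lemma C_fin_antimono: "m \<le> n \<Longrightarrow> C_fin n \<subseteq> C_fin m"
  by (auto simp: C_fin_def)

lemma C_fin_const: "(\<lambda>x. c) \<in> C_fin n"
proof (induction n arbitrary: c)
  case (Suc n)
  show ?case by (rule C_fin_SucI[of _ "\<lambda>x. 0"]) (auto simp: Suc)
qed (simp add: C_fin_0)

lemma C_fin_add: "f \<in> C_fin n \<Longrightarrow> g \<in> C_fin n \<Longrightarrow> (\<lambda>x. f x + g x) \<in> C_fin n"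
proof (induction n arbitrary: f g)
  case (Suc n)
  show ?case
    by (rule C_fin_SucI[of _ "\<lambda>x. deriv f x + deriv g x"])
      (auto intro!: derivative_eq_intros Suc C_fin_SucD[OF Suc.prems(1)] C_fin_SucD[OF Suc.prems(2)])
qed (auto simp: C_fin_0 intro: continuous_intros)

lemma C_fin_mult: "f \<in> C_fin n \<Longrightarrow> g \<in> C_fin n \<Longrightarrow> (\<lambda>x. f x * g x) \<in> C_fin n"
proof (induction n arbitrary: f g)
  case (Suc n)
  note f = C_fin_SucD[OF Suc.prems(1)] and g = C_fin_SucD[OF Suc.prems(2)]
  have "f \<in> C_fin n" "g \<in> C_fin n"
    using Suc.prems C_fin_Suc_subset by blast+
  then show ?case
    by (intro C_fin_SucI[of _ "\<lambda>x. deriv f x * g x + deriv g x * f x"] C_fin_add Suc.IH DERIV_mult f g)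
qed (auto simp: C_fin_0 intro: continuous_intros)

text \<open>One description for finite and infinite \<open>k\<close>, so that later proofs need no
  case split. For \<open>k = \<infinity>\<close>, order zero comes from order one.\<close>

lemma C_class_iff: "f \<in> C_class k \<longleftrightarrow> (\<forall>n. enat n \<le> k \<longrightarrow> f \<in> C_fin n)"
proof (cases k)
  case (enat n)
  then show ?thesis using C_fin_antimono[of _ n] by (auto simp: C_class_def)
next
  case infinity
  have "f \<in> C_fin n" if "\<forall>n\<ge>1. f \<in> C_fin n" for n
    using that C_fin_Suc_subset[of n] by auto
  then show ?thesis using infinity by (auto simp: C_class_def)
qed

lemma C_class_const: "(\<lambda>x. c) \<in> C_class k"
  and C_class_add: "f \<in> C_class k \<Longrightarrow> g \<in> C_class k \<Longrightarrow> (\<lambda>x. f x + g x) \<in> C_class k"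
  and C_class_mult: "f \<in> C_class k \<Longrightarrow> g \<in> C_class k \<Longrightarrow> (\<lambda>x. f x * g x) \<in> C_class k"
  by (auto simp: C_class_iff C_fin_const C_fin_add C_fin_mult)

lemma C_class_uminus: "f \<in> C_class k \<Longrightarrow> (\<lambda>x. - f x) \<in> C_class k"
  using C_class_mult[OF C_class_const[of "- 1"], of f k] by simp

lemma C_class_continuous: "f \<in> C_class k \<Longrightarrow> continuous_on UNIV f"
  by (metis C_class_iff C_fin_0 enat_0 zero_le)

lemma cring_C_ring: "cring (C_ring k)"
proof (rule cringI)
  show "abelian_group (C_ring k)"
  proof (rule abelian_groupI)
    fix f assume "f \<in> carrier (C_ring k)"
    then show "\<exists>g\<in>carrier (C_ring k). g \<oplus>\<^bsub>C_ring k\<^esub> f = \<zero>\<^bsub>C_ring k\<^esub>"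
      by (intro bexI[of _ "\<lambda>x. - f x"]) (auto simp: C_ring_def C_class_uminus)
  qed (auto simp: C_ring_def C_class_const C_class_add add_ac)
  show "comm_monoid (C_ring k)"
    by (rule comm_monoidI) (auto simp: C_ring_def C_class_const C_class_mult mult_ac)
qed (auto simp: C_ring_def algebra_simps)

section \<open>Summing countably many functions\<close>

lemma C_fin_deriv_continuous: "f \<in> C_fin n \<Longrightarrow> j \<le> n \<Longrightarrow> continuous_on UNIV ((deriv ^^ j) f)"
  by (simp add: C_fin_def)

text \<open>The bound concerns \<open>[-i, i]\<close> and late indices only, yet it eventually
  covers each bounded interval. So the derivatives up to order \<open>n\<close> form series that
  converge uniformly on bounded sets, by comparison with a geometric series.\<close>

definition derivs_small :: "nat \<Rightarrow> (nat \<Rightarrow> real \<Rightarrow> real) \<Rightarrow> bool" where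
  "derivs_small n f \<longleftrightarrow>
     (\<exists>N. \<forall>i\<ge>N. \<forall>j\<le>n. \<forall>x. \<bar>x\<bar> \<le> real i \<longrightarrow> \<bar>(deriv ^^ j) (f i) x\<bar> \<le> (1/2) ^ i)"

lemma derivs_small_Suc:
  assumes "derivs_small (Suc n) f"
  shows "derivs_small n f" "derivs_small n (\<lambda>i. deriv (f i))"
proof -
  obtain N where N: "\<And>i j x. N \<le> i \<Longrightarrow> j \<le> Suc n \<Longrightarrow> \<bar>x\<bar> \<le> real i \<Longrightarrow> \<bar>(deriv ^^ j) (f i) x\<bar> \<le> (1/2) ^ i"
    using assms unfolding derivs_small_def by blast
  show "derivs_small n f"
    unfolding derivs_small_def using N by (intro exI[of _ N]) simp
  show "derivs_small n (\<lambda>i. deriv (f i))"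
    unfolding derivs_small_def using N[of _ "Suc _"] by (intro exI[of _ N]) (simp add: funpow_swap1)
qed

lemma uniform_limit_derivs_small:
  assumes "derivs_small n f"
  shows "uniform_limit (ball 0 r) (\<lambda>m x. \<Sum>i<m. f i x) (\<lambda>x. suminf (\<lambda>i. f i x)) sequentially"
proof (rule Weierstrass_m_test_ev)
  obtain N where N: "\<And>i x. N \<le> i \<Longrightarrow> \<bar>x\<bar> \<le> real i \<Longrightarrow> \<bar>f i x\<bar> \<le> (1/2) ^ i"
    using assms unfolding derivs_small_def by (metis funpow_0 zero_le)
  obtain N' where N': "r \<le> real N'" using real_arch_simple by blast
  show "\<forall>\<^sub>F i in sequentially. \<forall>x\<in>ball 0 r. norm (f i x) \<le> (1/2) ^ i"
    using eventually_ge_at_top[of "max N N'"]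
  proof eventually_elim
    case (elim i)
    show ?case
    proof
      fix x :: real assume "x \<in> ball 0 r"
      then have "\<bar>x\<bar> \<le> real i" using N' elim by (auto simp: dist_real_def)
      then show "norm (f i x) \<le> (1/2) ^ i"
        using N elim by simp
    qed
  qed
qed (simp add: summable_geometric)

lemma ex_ball_0: "\<exists>r>0. x \<in> ball (0::real) r"
  by (rule exI[of _ "\<bar>x\<bar> + 1"]) auto

lemma summable_derivs_small:
  assumes "derivs_small n f"
  shows "summable (\<lambda>i. f i x)"
proof -
  obtain r where "x \<in> ball 0 r" using ex_ball_0 by blast
  from tendsto_uniform_limitI[OF uniform_limit_derivs_small[OF assms] this] show ?thesis
    unfolding summable_iff_convergent convergent_def by blast
qed

text \<open>Termwise differentiation, by induction on the order; the differentiated series converges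
  uniformly on each ball.\<close>

lemma C_fin_suminf:
  assumes "\<And>i. f i \<in> C_fin n" "derivs_small n f"
  shows "(\<lambda>x. suminf (\<lambda>i. f i x)) \<in> C_fin n"
  using assms
proof (induction n arbitrary: f)
  case 0
  have "isCont (\<lambda>x. suminf (\<lambda>i. f i x)) x" for x
  proof -
    obtain r where r: "x \<in> ball (0::real) r" using ex_ball_0 by blast
    have "continuous_on (ball 0 r) (\<lambda>x. suminf (\<lambda>i. f i x))"
      using 0 by (intro uniform_limit_theorem[OF _ uniform_limit_derivs_small[OF 0(2)]] always_eventually allI)
        (auto simp: C_fin_0 intro!: continuous_on_sum intro: continuous_on_subset)
    then show ?thesis using r by (simp add: continuous_on_eq_continuous_at)
  qed
  then show ?case by (simp add: C_fin_0 continuous_at_imp_continuous_on)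
next
  case (Suc n)
  note small = derivs_small_Suc[OF Suc.prems(2)]
  show ?case
  proof (rule C_fin_SucI)
    fix x
    obtain r where r: "x \<in> ball (0::real) r" using ex_ball_0 by blast
    show "((\<lambda>x. suminf (\<lambda>i. f i x)) has_real_derivative suminf (\<lambda>i. deriv (f i) x)) (at x)"
    proof (rule has_field_derivative_series'(2)[of "ball 0 r"])
      show "uniformly_convergent_on (ball 0 r) (\<lambda>n x. \<Sum>i<n. deriv (f i) x)"
        using uniform_limit_derivs_small[OF small(2)] by (auto simp: uniformly_convergent_on_def)
    qed (use r C_fin_SucD(1)[OF Suc.prems(1)] summable_derivs_small[OF small(1)]
         in \<open>auto intro: has_field_derivative_at_within\<close>)
  next
    show "(\<lambda>x. suminf (\<lambda>i. deriv (f i) x)) \<in> C_fin n"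
      using Suc.IH[OF _ small(2)] C_fin_SucD(2)[OF Suc.prems(1)] by blast
  qed
qed

lemma deriv_funpow_cmult:
  assumes "f \<in> C_fin n" "j \<le> n"
  shows "(deriv ^^ j) (\<lambda>x. c * f x) = (\<lambda>x. c * (deriv ^^ j) f x)"
  using assms
proof (induction j arbitrary: f n)
  case (Suc j)
  then obtain m where m: "n = Suc m" "j \<le> m" by (cases n) auto
  have "deriv (\<lambda>x. c * f x) = (\<lambda>x. c * deriv f x)"
    using Suc.prems(1) m by (intro deriv_if_has_deriv DERIV_cmult C_fin_SucD(1)) auto
  with Suc.IH[of "deriv f" m] C_fin_SucD(2)[of f m] Suc.prems(1) m show ?case
    by (simp add: funpow_swap1)
qed simp

text \<open>Continuous derivatives are bounded on the compact interval \<open>[-i, i]\<close>. The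
  order is capped by \<open>i\<close> so that for \<open>k = \<infinity>\<close> only finitely many
  bounds are combined.\<close>

lemma C_class_bound:
  assumes "f \<in> C_class k"
  shows "\<exists>B. \<forall>j\<le>i. enat j \<le> k \<longrightarrow> (\<forall>x. \<bar>x\<bar> \<le> real i \<longrightarrow> \<bar>(deriv ^^ j) f x\<bar> \<le> B)"
proof -
  have "\<exists>B. \<forall>x. \<bar>x\<bar> \<le> real i \<longrightarrow> \<bar>(deriv ^^ j) f x\<bar> \<le> B" if "enat j \<le> k" for j
  proof -
    have "continuous_on (cball 0 (real i)) ((deriv ^^ j) f)"
      using assms that C_fin_deriv_continuous[of f j j] by (auto simp: C_class_iff intro: continuous_on_subset)
    then have "bounded ((deriv ^^ j) f ` cball 0 (real i))"
      by (intro compact_imp_bounded compact_continuous_image) auto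
    then show ?thesis by (fastforce simp: bounded_iff)
  qed
  then obtain B where B: "\<And>j x. enat j \<le> k \<Longrightarrow> \<bar>x\<bar> \<le> real i \<Longrightarrow> \<bar>(deriv ^^ j) f x\<bar> \<le> B j"
    by metis
  have "B j \<le> Max (B ` {..i})" if "j \<le> i" for j using that by simp
  with B show ?thesis by (metis order_trans)
qed

text \<open>All \<open>c\<close> below a positive bound are allowed, and not just one choice, so
  that two series can later share their coefficients.\<close>

lemma C_class_series_coefficients:
  assumes f: "\<And>i. f i \<in> C_class k"
  shows "\<exists>B :: nat \<Rightarrow> real. (\<forall>i. 0 < B i) \<and> (\<forall>c. (\<forall>i. \<bar>c i\<bar> \<le> B i) \<longrightarrow>
    (\<forall>x. summable (\<lambda>i. c i * f i x)) \<and> (\<lambda>x. suminf (\<lambda>i. c i * f i x)) \<in> C_class k)"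
proof -
  have "\<forall>i. \<exists>B. \<forall>j\<le>i. enat j \<le> k \<longrightarrow> (\<forall>x. \<bar>x\<bar> \<le> real i \<longrightarrow> \<bar>(deriv ^^ j) (f i) x\<bar> \<le> B)"
    using C_class_bound[OF f] by simp
  from choice[OF this] obtain M where
    M: "\<forall>i. \<forall>j\<le>i. enat j \<le> k \<longrightarrow> (\<forall>x. \<bar>x\<bar> \<le> real i \<longrightarrow> \<bar>(deriv ^^ j) (f i) x\<bar> \<le> M i)"
    by (rule exE)
  \<comment> \<open>Dividing by \<open>1 + \<bar>M i\<bar>\<close> makes the scaled derivatives at
    most \<open>(1/2) ^ i\<close>; the summand one keeps the denominator positive.\<close>
  define B where "B i = (1/2) ^ i / (1 + \<bar>M i\<bar>)" for i
  have "derivs_small n (\<lambda>i x. c i * f i x)" if c: "\<And>i. \<bar>c i\<bar> \<le> B i" and n: "enat n \<le> k" for n c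
    unfolding derivs_small_def
  \<comment> \<open>For \<open>i \<ge> n\<close> the orders \<open>j \<le> n\<close> are among those
    bounded by \<open>M i\<close>, so \<open>n\<close> serves as the threshold.\<close>
  proof (intro exI[of _ n] allI impI)
    fix i j x assume *: "n \<le> i" "j \<le> n" "\<bar>x\<bar> \<le> real i"
    have "enat j \<le> k" using *(2) n by (meson enat_ord_simps(1) order_trans)
    then have "\<bar>(deriv ^^ j) (f i) x\<bar> \<le> 1 + \<bar>M i\<bar>" using M[rule_format, of j i x] * by linarith
    then have "\<bar>c i\<bar> * \<bar>(deriv ^^ j) (f i) x\<bar> \<le> B i * (1 + \<bar>M i\<bar>)"
      by (intro mult_mono c) (auto simp: B_def)
    also have "\<dots> = (1/2) ^ i" by (simp add: B_def add_pos_nonneg)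
    finally show "\<bar>(deriv ^^ j) (\<lambda>x. c i * f i x) x\<bar> \<le> (1/2) ^ i"
      using f n *(2) by (subst deriv_funpow_cmult[of _ n]) (auto simp: abs_mult C_class_iff)
  qed
  note small = this
  show ?thesis
  proof (intro exI[of _ B] conjI allI impI)
    show "0 < B i" for i by (simp add: B_def add_pos_nonneg)
  next
    fix c :: "nat \<Rightarrow> real" assume "\<forall>i. \<bar>c i\<bar> \<le> B i"
    then have c: "\<bar>c i\<bar> \<le> B i" for i by simp
    have "derivs_small 0 (\<lambda>i x. c i * f i x)" by (rule small[OF c]) (simp flip: zero_enat_def)
    then show "summable (\<lambda>i. c i * f i x)" for x by (rule summable_derivs_small)
    show "(\<lambda>x. suminf (\<lambda>i. c i * f i x)) \<in> C_class k"
      unfolding C_class_iff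
    proof (intro allI impI C_fin_suminf)
      fix n i assume "enat n \<le> k"
      then show "(\<lambda>x. c i * f i x) \<in> C_fin n"
        using f[of i] by (intro C_fin_mult C_fin_const) (simp add: C_class_iff)
    qed (rule small[OF c])
  qed
qed

text \<open>A common quotient \<open>b / d\<close> is only defined locally; \<open>s = \<Sum> c\<^sub>i d\<^sub>i\<^sup>2\<close> and
  \<open>a = \<Sum> c\<^sub>i d\<^sub>i b\<^sub>i\<close> turn it into a global fraction \<open>a / s\<close>.\<close>

lemma common_fraction:
  assumes G: "G \<subseteq> C_class k \<times> C_class k"
    and compat: "\<And>d b d' b' x. (d, b) \<in> G \<Longrightarrow> (d', b') \<in> G \<Longrightarrow> d x * b' x = d' x * b x"
  obtains s a where "s \<in> C_class k" "a \<in> C_class k"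
    "\<And>d b x. (d, b) \<in> G \<Longrightarrow> s x * b x = a x * d x"
    "\<And>d b x. (d, b) \<in> G \<Longrightarrow> d x \<noteq> 0 \<Longrightarrow> s x \<noteq> 0"
proof (cases "G = {}")
  case True
  then show ?thesis using C_class_const that by blast
next
  case False
  define coz where "coz p = {x. fst p x \<noteq> 0}" for p :: "(real \<Rightarrow> real) \<times> (real \<Rightarrow> real)"
  have "open (coz p)" if "p \<in> G" for p
  proof -
    have "continuous_on UNIV (fst p)" using that G by (intro C_class_continuous[of _ k]) auto
    then have "open (fst p -` (- {0}))" by (intro open_vimage) auto
    then show ?thesis by (simp add: coz_def vimage_def)
  qed
  then have "S \<in> coz ` G \<Longrightarrow> open S" for S by blast
  then obtain C where C: "C \<subseteq> coz ` G" "countable C" "\<Union>C = \<Union>(coz ` G)"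
    by (rule Lindelof)
  obtain G' where G': "countable G'" "G' \<subseteq> G" "C = coz ` G'"
    using C(1,2) countable_subset_image[of C coz G] by blast
  \<comment> \<open>A sequence needs a nonempty range, but \<open>G'\<close> may be empty when all
    \<open>d\<close> vanish identically; inserting \<open>p0\<close> repairs this.\<close>
  obtain p0 where p0: "p0 \<in> G" using False by blast
  define p where "p = from_nat_into (insert p0 G')"
  have rp: "range p = insert p0 G'" unfolding p_def by (rule range_from_nat_into) (use G' in auto)
  define d b where "d i = fst (p i)" and "b i = snd (p i)" for i
  have pG: "(d i, b i) \<in> G" for i
  proof -
    have "p i \<in> range p" by simp
    then show ?thesis using rp p0 G'(2) unfolding d_def b_def by auto
  qed
  then have dbC: "(d i, b i) \<in> C_class k \<times> C_class k" for i using G by blast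
  then have dC: "d i \<in> C_class k" and bC: "b i \<in> C_class k" for i by blast+
  obtain B where B: "\<forall>i. 0 < B i" "\<forall>c. (\<forall>i. \<bar>c i\<bar> \<le> B i) \<longrightarrow>
      (\<forall>x. summable (\<lambda>i. c i * (d i x * d i x))) \<and> (\<lambda>x. suminf (\<lambda>i. c i * (d i x * d i x))) \<in> C_class k"
    using C_class_series_coefficients[of "\<lambda>i x. d i x * d i x" k, OF C_class_mult[OF dC dC]] by (elim exE conjE)
  obtain B' where B': "\<forall>i. 0 < B' i" "\<forall>c. (\<forall>i. \<bar>c i\<bar> \<le> B' i) \<longrightarrow>
      (\<forall>x. summable (\<lambda>i. c i * (d i x * b i x))) \<and> (\<lambda>x. suminf (\<lambda>i. c i * (d i x * b i x))) \<in> C_class k"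
    using C_class_series_coefficients[of "\<lambda>i x. d i x * b i x" k, OF C_class_mult[OF dC bC]] by (elim exE conjE)
  \<comment> \<open>The smaller bound serves both series, so \<open>s\<close> and \<open>a\<close>
    have the same coefficients.\<close>
  define c where "c i = min (B i) (B' i)" for i
  have c_pos: "0 < c i" for i using B(1) B'(1) by (simp add: c_def)
  have c: "\<forall>i. \<bar>c i\<bar> \<le> B i" "\<forall>i. \<bar>c i\<bar> \<le> B' i"
    using c_pos by (simp_all add: abs_of_pos) (simp_all add: c_def)
  define s where "s = (\<lambda>x. suminf (\<lambda>i. c i * (d i x * d i x)))"
  define a where "a = (\<lambda>x. suminf (\<lambda>i. c i * (d i x * b i x)))"
  have s: "summable (\<lambda>i. c i * (d i x * d i x))" "s \<in> C_class k" for x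
    using B(2)[rule_format, OF c(1)[rule_format]] unfolding s_def by blast+
  have a: "summable (\<lambda>i. c i * (d i x * b i x))" "a \<in> C_class k" for x
    using B'(2)[rule_format, OF c(2)[rule_format]] unfolding a_def by blast+
  show ?thesis
  proof
    fix e f x assume ef: "(e, f) \<in> G"
    have "s x * f x = suminf (\<lambda>i. c i * (d i x * d i x) * f x)"
      unfolding s_def by (rule suminf_mult2[OF s(1)])
    also have "\<dots> = suminf (\<lambda>i. c i * (d i x * b i x) * e x)"
    proof -
      \<comment> \<open>By \<open>compat\<close>, \<open>d i x * f x = e x * b i x\<close>, so the
        two series agree term by term.\<close>
      have "c i * (d i x * d i x) * f x = c i * (d i x * b i x) * e x" for i
        using compat[OF pG ef, of i x] by (metis mult.assoc mult.commute)
      then show ?thesis by (simp only:)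
    qed
    also have "\<dots> = a x * e x"
      unfolding a_def by (rule suminf_mult2[OF a(1), symmetric])
    finally show "s x * f x = a x * e x" .
    \<comment> \<open>Some \<open>d i\<close> is nonzero at \<open>x\<close> by the choice of the
      cover, and all terms are nonnegative, so \<open>s x > 0\<close>.\<close>
    assume "e x \<noteq> 0"
    then have "x \<in> coz (e, f)" by (simp add: coz_def)
    then have "x \<in> \<Union>C" using ef unfolding C(3) by (rule UN_I[rotated])
    then obtain g where g: "g \<in> G'" "x \<in> coz g" unfolding G'(3) by (rule UN_E)
    then have "g \<in> range p" unfolding rp by (rule_tac insertI2)
    then obtain i where "g = p i" by (rule rangeE)
    then have "d i x \<noteq> 0" using g(2) unfolding coz_def d_def by simp
    then have pos: "0 < c i * (d i x * d i x)"
      using mult_pos_pos[OF c_pos, of "d i x * d i x" i] not_real_square_gt_zero[of "d i x"] by metis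
    have nonneg: "0 \<le> c j * (d j x * d j x)" for j
      using mult_nonneg_nonneg[of "c j" "d j x * d j x"] c_pos[of j] by simp
    have "0 < s x"
      unfolding s_def using suminf_pos2[of "\<lambda>i. c i * (d i x * d i x)" i, OF s(1) nonneg pos] .
    then show "s x \<noteq> 0" by simp
  qed (rule s(2) a(2))+
qed

section \<open>Linear maps on ideals of \<open>C\<^sup>k\<close> as fractions\<close>

lemma C_ring_simps [simp]:
  "carrier (C_ring k) = C_class k" "f \<otimes>\<^bsub>C_ring k\<^esub> g = (\<lambda>x. f x * g x)" "f \<oplus>\<^bsub>C_ring k\<^esub> g = (\<lambda>x. f x + g x)"
  "\<one>\<^bsub>C_ring k\<^esub> = (\<lambda>x. 1)" "\<zero>\<^bsub>C_ring k\<^esub> = (\<lambda>x. 0)"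
  by (simp_all add: C_ring_def)

text \<open>Adding the pairs \<open>(e, 0)\<close> with \<open>e\<close> in the annihilator of \<open>D\<close> makes the denominator a
  non-zero-divisor.\<close>

lemma C_ring_hom_fraction:
  assumes D: "ideal D (C_ring k)"
    and f: "f \<in> module_hom (C_ring k) (ideal_module (C_ring k) D) (regular_module (C_ring k))"
  shows "\<exists>v\<in>non_zero_divisors (C_ring k). \<exists>a\<in>carrier (C_ring k). \<forall>d\<in>D.
    v \<otimes>\<^bsub>C_ring k\<^esub> f d = a \<otimes>\<^bsub>C_ring k\<^esub> d"
proof -
  interpret R: cring "C_ring k" by (rule cring_C_ring)
  note fs = module_homD[OF f, simplified]
  have DC: "d \<in> C_class k" if "d \<in> D" for d using ideal_subsetD[OF D that] by simp
  define N where "N = {e \<in> C_class k. \<forall>d\<in>D. \<forall>x. e x * d x = 0}"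
  define G where "G = {(d, f d) | d. d \<in> D} \<union> {(e, \<lambda>x. 0) | e. e \<in> N}"
  \<comment> \<open>Up to the order of the factors, both sides are the value of \<open>f\<close> at
    the product \<open>d e\<close>, by linearity in either factor.\<close>
  have fD: "f d x * e x = d x * f e x" if "d \<in> D" "e \<in> D" for d e x
  proof -
    have "(\<lambda>x. e x * f d x) = f (\<lambda>x. e x * d x)" using fs(3)[OF DC[OF that(2)] that(1)] by simp
    also have "\<dots> = (\<lambda>x. d x * f e x)" using fs(3)[OF DC[OF that(1)] that(2)] by (simp add: mult.commute)
    finally show ?thesis by (metis mult.commute)
  qed
  have f0: "f (\<lambda>x. 0) = (\<lambda>x. 0)" and "(\<lambda>x. 0) \<in> D"
    using fs(3)[of "\<lambda>x. 0" "\<lambda>x. 0"] R.ideal_mem(1)[OF D] by (simp_all add: C_class_const)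
  \<comment> \<open>For \<open>e\<close> in the annihilator,
    \<open>e f(d) = f(e d) = f(0) = 0\<close>, which makes \<open>(e, 0)\<close> compatible with
    \<open>(d, f d)\<close>.\<close>
  have fN: "e x * f d x = 0" if "e \<in> N" "d \<in> D" for e d x
  proof -
    have "(\<lambda>x. e x * f d x) = f (\<lambda>x. e x * d x)" using fs(3)[of e d] that by (simp add: N_def)
    also have "(\<lambda>x. e x * d x) = (\<lambda>x. 0)" using that by (simp add: N_def fun_eq_iff)
    also note f0
    finally show ?thesis by (rule fun_cong)
  qed
  have GE: "(\<exists>d\<in>D. p = (d, f d)) \<or> (\<exists>e\<in>N. p = (e, \<lambda>x. 0))" if "p \<in> G" for p
    using that by (auto simp: G_def)
  have GD: "(d, f d) \<in> G" if "d \<in> D" for d using that by (auto simp: G_def)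
  have GN: "(e, \<lambda>x. 0) \<in> G" if "e \<in> N" for e using that by (auto simp: G_def)
  have "G \<subseteq> C_class k \<times> C_class k"
  proof
    fix p assume "p \<in> G"
    from GE[OF this] show "p \<in> C_class k \<times> C_class k"
      using DC fs(1) by (elim disjE bexE) (simp_all add: C_class_const N_def)
  qed
  moreover have "d x * b' x = d' x * b x" if db: "(d, b) \<in> G" "(d', b') \<in> G" for d b d' b' x
    using GE[OF db(1)] GE[OF db(2)] fD fN
    by (elim disjE bexE) (simp_all add: mult.commute)
  ultimately obtain v a where va: "v \<in> C_class k" "a \<in> C_class k"
    "\<And>d b x. (d, b) \<in> G \<Longrightarrow> v x * b x = a x * d x"
    "\<And>d b x. (d, b) \<in> G \<Longrightarrow> d x \<noteq> 0 \<Longrightarrow> v x \<noteq> 0"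
    by (rule common_fraction) (auto intro: that)
  have "v \<in> non_zero_divisors (C_ring k)"
  proof (rule R.nzdI)
    fix g assume "g \<in> carrier (C_ring k)" "v \<otimes>\<^bsub>C_ring k\<^esub> g = \<zero>\<^bsub>C_ring k\<^esub>"
    then have g: "g \<in> C_class k" "(\<lambda>x. v x * g x) = (\<lambda>x. 0)" by simp_all
    have vg: "v x = 0 \<or> g x = 0" for x using fun_cong[OF g(2), of x] by simp
    \<comment> \<open>Where some \<open>d\<close> is nonzero so is \<open>v\<close>, hence
      \<open>g\<close> vanishes there and lies in \<open>N\<close>. But then \<open>v\<close> is
      nonzero wherever \<open>g\<close> is, which forces \<open>g = 0\<close>.\<close>
    have "g x * d x = 0" if "d \<in> D" for d x using va(4)[OF GD[OF that], of x] vg[of x] by auto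
    then have "g \<in> N" using g(1) by (simp add: N_def)
    then have "g x = 0" for x using va(4)[OF GN, of g x] vg[of x] by auto
    then show "g = \<zero>\<^bsub>C_ring k\<^esub>" by auto
  qed (simp add: va)
  moreover have "v \<otimes>\<^bsub>C_ring k\<^esub> f d = a \<otimes>\<^bsub>C_ring k\<^esub> d" if "d \<in> D" for d
    using va(3)[OF GD[OF that]] by simp
  ultimately show ?thesis using va(2) by (intro bexI[of _ v] bexI[of _ a]) simp_all
qed

lemma fractional_homs_C_ring: "fractional_homs (C_ring k)"
proof (intro fractional_homs.intro fractional_homs_axioms.intro cring_C_ring C_ring_hom_fraction)
  fix f assume "f \<otimes>\<^bsub>C_ring k\<^esub> f = \<zero>\<^bsub>C_ring k\<^esub>"
  then have "f x * f x = 0" for x by (simp add: fun_eq_iff)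
  then show "f = \<zero>\<^bsub>C_ring k\<^esub>" by (simp add: fun_eq_iff)
qed

theorem theorem3p3:
  fixes k :: enat
  assumes "1 \<le> k"
  shows "coincide_over (C_ring k) (Q_cl (C_ring k)) (Q_cl_map (C_ring k))
           (Q_complete (C_ring k)) (Q_complete_map (C_ring k)) \<and>
         is_Q_tot TYPE('m) TYPE('s) (C_ring k) (Q_cl (C_ring k)) (Q_cl_map (C_ring k)) \<and>
         (\<forall>(T :: 's ring) \<tau>.
            is_Q_tot TYPE(real \<Rightarrow> real) TYPE(((real \<Rightarrow> real) \<times> (real \<Rightarrow> real)) set) (C_ring k) T \<tau> \<longrightarrow>
            coincide_over (C_ring k) (Q_cl (C_ring k)) (Q_cl_map (C_ring k)) T \<tau>) \<and>
         von_neumann_regular (Q_cl (C_ring k)) \<and>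
         self_injective TYPE('m) (Q_cl (C_ring k))"
proof -
  interpret fractional_homs "C_ring k" by (rule fractional_homs_C_ring)
  show ?thesis
    using coincide_Q_complete is_Q_tot_Q_cl coincide_Q_tot von_neumann_regular_Q_cl self_injective_Q_cl
    by (intro conjI allI impI)
qed

end
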